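(* Fix an integer $k\ge1$. For every sufficiently large odd integer $\lambda$ (depending on $k$), the set $$\Sigma_{\lambda,k}:=\{\boldsymbol x\in\operatorname{Conf}_k(\mathbb T^3):\operatorname{rank}\mathcal J_{\lambda,\boldsymbol x}<8k\}$$ is a proper real-analytic subset of $\operatorname{Conf}_k(\mathbb T^3)$ with Hausdorff dimension $\dim_{\mathrm H}\Sigma_{\lambda,k}\le3k-1$. In particular, it has measure zero and empty interior, and $\mathcal J_{\lambda,\boldsymbol x}$ is surjective whenever $\boldsymbol x\notin\Sigma_{\lambda,k}$. For every $\boldsymbol x=(x_1,\dots,x_k)\in\operatorname{Conf}_k(\mathbb T^3)\setminus\Sigma_{\lambda,k}$ and every $H_1,\ldots,H_k\in\operatorname{Sym}_0(3)$, there is a $W\in E_\lambda^+$ satisfying $$W(x_\ell)=0,\qquad\nabla W(x_\ell)=H_\ell\qquad(1\le\ell\le k).$$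
   Context: $\mathbb T^3=(\mathbb R/2\pi\mathbb Z)^3$. $\operatorname{Sym}_0(3)$ is the ($5$-dimensional) space of trace-free real symmetric $3\times3$ matrices, and $\operatorname{sym}A=\frac12(A+A^\top)$. For a positive curl eigenvalue $\lambda$, $E_\lambda^+=\{W\in C^\omega(\mathbb T^3;\mathbb R^3):\nabla\times W=\lambda W\}$. $\operatorname{Conf}_k(\mathbb T^3)=\{(x_1,\ldots,x_k)\in(\mathbb T^3)^k:x_i\ne x_j\text{ for }i\ne j\}$ is the ordered configuration space, a connected real-analytic manifold of dimension $3k$. For $\boldsymbol x\in\operatorname{Conf}_k(\mathbb T^3)$ the jet map is the linear map $$\mathcal J_{\lambda,\boldsymbol x}:E_\lambda^+\to(\mathbb R^3\oplus\operatorname{Sym}_0(3))^k,\qquad \mathcal J_{\lambda,\boldsymbol x}W=\bigl(W(x_\ell),\operatorname{sym}\nabla W(x_\ell)\bigr)_{\ell=1}^k.$$ *)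

theory Defs
  imports "HOL-Analysis.Analysis" "HOL-Library.Real_Mod"
begin

quotient_type circle = real / "\<lambda>x y :: real. [x = y] (rmod 2 * pi)"
  morphisms rep_circle circ
  by (intro equivpI reflpI sympI transpI) (auto intro: rcong_sym rcong_trans)

lemma circ_eq_iff: "circ a = circ b \<longleftrightarrow> (\<exists>n::int. b = a + of_int n * (2 * pi))"
  unfolding circle.abs_eq_iff rcong_altdef ..

lemma circ_surj: "\<exists>a. circ a = x"
  by (induct x rule: circle.abs_induct) blast

instantiation circle :: ab_group_add
begin

lift_definition zero_circle :: circle is 0 .
lift_definition plus_circle :: "circle \<Rightarrow> circle \<Rightarrow> circle" is "(+)"
  by (rule rcong_add)
lift_definition minus_circle :: "circle \<Rightarrow> circle \<Rightarrow> circle" is "(-)"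
  by (rule rcong_diff)
lift_definition uminus_circle :: "circle \<Rightarrow> circle" is uminus
  using rcong_diff[of 0 0 "2 * pi"] by simp

instance
  by standard (transfer; simp add: algebra_simps)+

end

text \<open>The quotient metric, i.e. arc length. The torus \<open>circle ^ 3\<close> and its powers
  \<open>circle ^ 3 ^ 'k\<close> then carry the Euclidean product metric of the vector type, which is
  the distance of the flat Riemannian metric.\<close>

instantiation circle :: metric_space
begin

definition dist_circle :: "circle \<Rightarrow> circle \<Rightarrow> real" where
  "dist_circle x y = Inf {\<bar>a - b\<bar> | a b. circ a = x \<and> circ b = y}"

definition uniformity_circle :: "(circle \<times> circle) filter" where
  "uniformity_circle = (INF e\<in>{0<..}. principal {(x, y). dist x y < e})"

definition open_circle :: "circle set \<Rightarrow> bool" where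
  "open_circle U \<longleftrightarrow> (\<forall>x\<in>U. eventually (\<lambda>(x', y). x' = x \<longrightarrow> y \<in> U) uniformity)"

instance
proof
  fix x y z :: circle
  let ?D = "\<lambda>x y. {\<bar>a - b\<bar> | a b. circ a = x \<and> circ b = y}"
  have ne: "?D x y \<noteq> {}" for x y
    using circ_surj[of x] circ_surj[of y] by blast
  have bdd: "bdd_below (?D x y)" for x y
    by (rule bdd_belowI[of _ 0]) auto
  show "dist x y = 0 \<longleftrightarrow> x = y"
  proof
    assume xy: "x = y"
    obtain a where a: "circ a = x" using circ_surj by blast
    have "\<bar>a - a\<bar> \<in> ?D x y" using a xy by blast
    then have "0 \<in> ?D x y" by simp
    then have "Inf (?D x y) \<le> 0" using bdd by (rule cInf_lower)
    moreover have "0 \<le> Inf (?D x y)" by (rule cInf_greatest[OF ne]) auto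
    ultimately show "dist x y = 0" by (simp add: dist_circle_def)
  next
    assume "dist x y = 0"
    then have close: "\<exists>a b. circ a = x \<and> circ b = y \<and> \<bar>a - b\<bar> < e" if "e > 0" for e
      using cInf_lessD[OF ne, of x y e] that by (auto simp: dist_circle_def)
    obtain a b where ab: "circ a = x" "circ b = y" "\<bar>a - b\<bar> < 1"
      using close[of 1] by auto
    have "a = b"
    proof (rule ccontr)
      assume "a \<noteq> b"
      then obtain a' b' where ab': "circ a' = x" "circ b' = y" "\<bar>a' - b'\<bar> < \<bar>a - b\<bar>"
        using close[of "\<bar>a - b\<bar>"] by auto
      from ab ab' have "circ a = circ a'" "circ b = circ b'" by simp_all
      then obtain m n :: int where "a' = a + of_int m * (2 * pi)" "b' = b + of_int n * (2 * pi)"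
        unfolding circ_eq_iff by blast
      then have d: "a' - b' = (a - b) + of_int (m - n) * (2 * pi)"
        by (simp add: algebra_simps)
      then have small: "\<bar>of_int (m - n) * (2 * pi)\<bar> < 2"
        using ab(3) ab'(3) by linarith
      have "m - n = 0"
      proof (rule ccontr)
        assume "m - n \<noteq> 0"
        then have "1 \<le> \<bar>real_of_int (m - n)\<bar>" by linarith
        then have "1 * (2 * pi) \<le> \<bar>real_of_int (m - n)\<bar> * (2 * pi)"
          by (rule mult_right_mono) simp
        then have "2 * pi \<le> \<bar>of_int (m - n) * (2 * pi)\<bar>" by (simp add: abs_mult)
        with small show False using pi_gt3 by linarith
      qed
      with d ab'(3) show False by simp
    qed
    with ab show "x = y" by simp
  qed
  have tri: "Inf (?D x y) \<le> \<bar>a - c\<bar> + \<bar>b - c'\<bar>"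
    if h: "circ a = x" "circ c = z" "circ b = y" "circ c' = z" for a b c c'
  proof -
    obtain n :: int where n: "c = c' + of_int n * (2 * pi)"
      using h(2,4) circ_eq_iff[of c' c] by auto
    define b' where "b' = b + of_int n * (2 * pi)"
    have "circ b' = y" using h(3) circ_eq_iff[of b b'] b'_def by auto
    then have "\<bar>a - b'\<bar> \<in> ?D x y" using h(1) by blast
    then have "Inf (?D x y) \<le> \<bar>a - b'\<bar>" using bdd by (rule cInf_lower)
    also have "\<dots> \<le> \<bar>a - c\<bar> + \<bar>b - c'\<bar>" using n b'_def by linarith
    finally show ?thesis .
  qed
  have "Inf (?D x y) - \<bar>a - c\<bar> \<le> Inf (?D y z)" if "circ a = x" "circ c = z" for a c
  proof (rule cInf_greatest[OF ne])
    fix t assume "t \<in> ?D y z"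
    then obtain b c' where "t = \<bar>b - c'\<bar>" "circ b = y" "circ c' = z" by blast
    with tri[OF that(1,2), of b c'] show "Inf (?D x y) - \<bar>a - c\<bar> \<le> t" by linarith
  qed
  then have le: "Inf (?D x y) - Inf (?D y z) \<le> \<bar>a - c\<bar>" if "circ a = x" "circ c = z" for a c
    using that by (simp add: algebra_simps)
  have "Inf (?D x y) - Inf (?D y z) \<le> Inf (?D x z)"
  proof (rule cInf_greatest[OF ne])
    fix t assume "t \<in> ?D x z"
    then show "Inf (?D x y) - Inf (?D y z) \<le> t" using le by blast
  qed
  then show "dist x y \<le> dist x z + dist y z"
    by (simp add: dist_circle_def)
qed (rule uniformity_circle_def open_circle_def)+

end

type_synonym torus3 = "circle ^ 3"

definition tproj :: "real ^ 3 \<Rightarrow> torus3" where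
  "tproj v = (\<chi> i. circ (v $ i))"

definition tprojs :: "real ^ 3 ^ 'k \<Rightarrow> torus3 ^ 'k" where
  "tprojs v = (\<chi> l. tproj (v $ l))"

definition Conf :: "(torus3 ^ 'k) set" where
  "Conf = {x. \<forall>i j. i \<noteq> j \<longrightarrow> x $ i \<noteq> x $ j}"

text \<open>Lebesgue null sets in \<open>torus3 ^ 'k\<close>: the covering map \<^const>\<open>tprojs\<close> is locally
  an isometry and its inverse branches are the standard charts.\<close>

definition torus_null :: "(torus3 ^ 'k) set \<Rightarrow> bool" where
  "torus_null S \<longleftrightarrow> negligible (tprojs -` S)"

text \<open>A multi-index on a Euclidean space is a function \<open>\<alpha> \<in> Basis \<rightarrow>\<^sub>E UNIV\<close>.
  The convergence demanded by \<^const>\<open>has_sum\<close> is unconditional.\<close>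

definition real_analytic_at ::
    "('a::euclidean_space \<Rightarrow> 'b::euclidean_space) \<Rightarrow> 'a \<Rightarrow> bool" where
  "real_analytic_at f x \<longleftrightarrow>
     (\<exists>(c :: ('a \<Rightarrow> nat) \<Rightarrow> 'b) r. r > 0 \<and>
        (\<forall>h. norm h < r \<longrightarrow>
           ((\<lambda>\<alpha>. (\<Prod>b\<in>Basis. (h \<bullet> b) ^ \<alpha> b) *\<^sub>R c \<alpha>) has_sum f (x + h))
             (Basis \<rightarrow>\<^sub>E UNIV)))"

text \<open>Functions on a torus are expressed near a point \<open>p\<close> in the chart
  \<open>v \<mapsto> p + tproj v\<close> (resp. \<open>tprojs\<close>), \<open>v\<close> near \<open>0\<close>.\<close>

definition torus_analytic :: "(torus3 \<Rightarrow> real ^ 3) \<Rightarrow> bool" where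
  "torus_analytic W \<longleftrightarrow> (\<forall>p. real_analytic_at (\<lambda>v. W (p + tproj v)) 0)"

definition torus_analytic_on :: "(torus3 ^ 'k) set \<Rightarrow> (torus3 ^ 'k \<Rightarrow> real) \<Rightarrow> bool" where
  "torus_analytic_on U f \<longleftrightarrow> (\<forall>p\<in>U. real_analytic_at (\<lambda>v. f (p + tprojs v)) 0)"

text \<open>Analytic subset of an open subset \<open>M\<close>: near every point of \<open>M\<close> (not only of \<open>S\<close>) the
  common zero set of finitely many analytic functions.\<close>

definition real_analytic_subset :: "(torus3 ^ 'k) set \<Rightarrow> (torus3 ^ 'k) set \<Rightarrow> bool" where
  "real_analytic_subset M S \<longleftrightarrow> S \<subseteq> M \<and>
     (\<forall>p\<in>M. \<exists>U F. open U \<and> p \<in> U \<and> U \<subseteq> M \<and> finite F \<and>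
        (\<forall>f\<in>F. torus_analytic_on U f) \<and> S \<inter> U = {x\<in>U. \<forall>f\<in>F. f x = 0})"

text \<open>The case distinction implements \<open>0 ^ 0 = 1\<close> for nonempty sets, unlike \<^const>\<open>powr\<close>.
  Covers are restricted to bounded sets because \<^const>\<open>diameter\<close> is unspecified otherwise.\<close>

definition diam_power :: "real \<Rightarrow> 'a::metric_space set \<Rightarrow> ennreal" where
  "diam_power s U =
     (if U = {} then 0 else if s = 0 then 1 else ennreal (diameter U powr s))"

definition hausdorff_premeasure :: "real \<Rightarrow> real \<Rightarrow> 'a::metric_space set \<Rightarrow> ennreal" where
  "hausdorff_premeasure s \<delta> S =
     (INF U \<in> {U :: nat \<Rightarrow> 'a set. S \<subseteq> (\<Union>n. U n) \<and> (\<forall>n. bounded (U n) \<and> diameter (U n) \<le> \<delta>)}.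
        \<Sum>n. diam_power s (U n))"

definition hausdorff_measure :: "real \<Rightarrow> 'a::metric_space set \<Rightarrow> ennreal" where
  "hausdorff_measure s S = (SUP \<delta>\<in>{0<..}. hausdorff_premeasure s \<delta> S)"

definition hausdorff_dim :: "'a::metric_space set \<Rightarrow> ereal" where
  "hausdorff_dim S = (INF s\<in>{s. s \<ge> 0 \<and> hausdorff_measure s S = 0}. ereal s)"

text \<open>\<open>grad W p $ i $ j\<close> is the derivative of \<open>W\<^sub>i\<close> in direction \<open>j\<close>.\<close>

definition grad :: "(torus3 \<Rightarrow> real ^ 3) \<Rightarrow> torus3 \<Rightarrow> real ^ 3 ^ 3" where
  "grad W p = jacobian (\<lambda>v. W (p + tproj v)) (at 0)"

definition curl :: "(torus3 \<Rightarrow> real ^ 3) \<Rightarrow> torus3 \<Rightarrow> real ^ 3" where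
  "curl W p = vector
     [grad W p $ 3 $ 2 - grad W p $ 2 $ 3,
      grad W p $ 1 $ 3 - grad W p $ 3 $ 1,
      grad W p $ 2 $ 1 - grad W p $ 1 $ 2]"

definition curl_eigenspace :: "real \<Rightarrow> (torus3 \<Rightarrow> real ^ 3) set" where
  "curl_eigenspace lam = {W. torus_analytic W \<and> (\<forall>p. curl W p = lam *\<^sub>R W p)}"

definition sym_part :: "real ^ 3 ^ 3 \<Rightarrow> real ^ 3 ^ 3" where
  "sym_part A = (1 / 2) *\<^sub>R (A + transpose A)"

definition Sym0 :: "(real ^ 3 ^ 3) set" where
  "Sym0 = {A. transpose A = A \<and> trace A = 0}"

definition jet_space :: "(((real ^ 3) \<times> (real ^ 3 ^ 3)) ^ 'k) set" where
  "jet_space = {y. \<forall>l. snd (y $ l) \<in> Sym0}"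

definition jet_map ::
    "torus3 ^ 'k \<Rightarrow> (torus3 \<Rightarrow> real ^ 3) \<Rightarrow> ((real ^ 3) \<times> (real ^ 3 ^ 3)) ^ 'k" where
  "jet_map x W = (\<chi> l. (W (x $ l), sym_part (grad W (x $ l))))"

definition jet_rank :: "real \<Rightarrow> torus3 ^ 'k \<Rightarrow> nat" where
  "jet_rank lam x = dim (jet_map x ` curl_eigenspace lam)"

definition Sigma_set :: "real \<Rightarrow> (torus3 ^ 'k) set" where
  "Sigma_set lam = {x \<in> Conf. jet_rank lam x < 8 * CARD('k)}"

end

theory Submission
  imports Defs "HOL-Number_Theory.Cong" "HOL-Complex_Analysis.Conformal_Mappings"
begin

text \<open>For an eigenfield \<open>W\<close> the antisymmetric part of \<open>\<nabla>W\<close> is determined by \<open>curl W = lam W\<close>, so the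
  jet of \<open>W\<close> at a point is equivalent to the trace-free matrix \<open>\<nabla>W\<close>. By Fourier analysis the
  eigenspace is spanned by finitely many Beltrami modes, one plane of them for each frequency
  \<open>n \<in> \<int>\<^sup>3\<close> with \<open>|n| = lam\<close>. Hence the singular set is the zero set of a single trigonometric
  polynomial, a Gram determinant. If that polynomial does not vanish identically, its zero set is
  covered by countably many Lipschitz graphs of dimension \<open>3k - 1\<close>, since every zero is a simple zero,
  along a suitable direction, of some iterated derivative.

  For the nonvanishing put the points on one line, so that gradients become sums of exponentials. A
  leading-term argument yields a configuration of full rank as soon as every nonzero functional on
  trace-free matrices is seen by many frequencies. The frequency set is invariant under the symmetries
  of the cube, and for odd \<open>lam\<close> no such functional is invisible to a whole orbit off the coordinate
  axes; so it suffices that the number of integer points on the sphere of radius \<open>l\<close> tends to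
  infinity over odd \<open>l\<close>. A large \<open>l\<close> has a large prime factor or is divisible by a high power of a prime.
  In the first case short vectors in many lattices modulo \<open>p\<close> write small multiples of \<open>p\<close> as sums of
  four squares and give, through quaternion conjugation, many points; in the second case there are
  primitive points at every power of the prime.\<close>

section \<open>Integer points on spheres of odd integer radius\<close>

text \<open>The crux of the count is that the points are distinct. From an isotropic vector
  \<open>(1, \<alpha>, \<beta>)\<close> modulo \<open>p\<close> a short lattice vector yields a
  quaternion of norm \<open>m * p\<close> with \<open>1 \<le> m \<le> 4\<close>, and the integer
  point obtained from it is a nonzero multiple of \<open>(1, \<alpha>, \<beta>)\<close> modulo
  \<open>p\<close>. The point thus remembers the isotropic vector, and different vectors give
  different points. The multiplier \<open>m\<close> is removed at bounded cost: halving and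
  reflections in sign vectors lead from radius \<open>m * p\<close> back to radius \<open>p\<close>.
  Powers of 2 are the obstacle behind the restriction to odd radii, since radius
  \<open>2 ^ a\<close> carries only the six axis points. Interpolation is carried out in all nine
  matrix entries, and the induction over the points consumes nine visible exponents per point. Every
  frequency that a trace-free functional sees accounts for at most \<open>6 ^ 3 = 216\<close>
  frequencies of the sphere, whence the constant \<open>1944 = 9 * 216\<close>; the remaining 6
  stands for the axis points.\<close>

lemma dvd_small_eq_0: "p dvd x \<Longrightarrow> \<bar>x\<bar> < p \<Longrightarrow> x = (0::int)"
  using dvd_imp_le_int[of x p] by linarith

lemma odd_dvd_double_iff: "odd p \<Longrightarrow> p dvd 2 * x \<longleftrightarrow> p dvd (x::int)"
  by (rule coprime_dvd_mult_right_iff) simp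

lemma odd_prime_ge_3: "prime p \<Longrightarrow> odd p \<Longrightarrow> p \<ge> (3::int)"
  using prime_ge_2_int[of p] by (cases "p = 2") auto

text \<open>Pigeonhole for the lattice of index \<open>p^2\<close> cut out by the two congruences,
  on which the sum of four squares is divisible by \<open>p\<close>. The box has sides about
  \<open>sqrt (p / 2)\<close> for \<open>a\<close>, \<open>b\<close> and \<open>sqrt (2 * p)\<close>
  for \<open>c\<close>, \<open>d\<close>. Their product is still \<open>p^2\<close>, but the
  imbalance gives \<open>0 < a^2 + b^2 < p\<close>, so that \<open>a^2 + b^2\<close> is not
  divisible by \<open>p\<close>. The price is the bound 4 for \<open>m\<close>.\<close>

lemma small_quadruple_in_lattice:
  fixes p \<alpha> \<beta> :: int
  assumes p: "odd p" "p \<ge> 3" and iso: "p dvd \<alpha>^2 + \<beta>^2 + 1"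
  obtains a b c d m :: int where
    "a^2 + b^2 + c^2 + d^2 = m * p" "1 \<le> m" "m \<le> 4" "0 < a^2 + b^2" "a^2 + b^2 < p"
    "p dvd c - (\<alpha> * a + \<beta> * b)" "p dvd d - (\<beta> * a - \<alpha> * b)"
proof -
  define A where "A = \<lfloor>sqrt (p / 2)\<rfloor>"
  define B where "B = \<lfloor>sqrt (2 * p)\<rfloor>"
  have A0: "A \<ge> 0" and B0: "B \<ge> 0" using p by (auto simp: A_def B_def)
  have sqA: "real_of_int A \<le> sqrt (p/2)" "sqrt (p/2) < real_of_int A + 1" unfolding A_def by linarith+
  have sqB: "real_of_int B \<le> sqrt (2*p)" "sqrt (2*p) < real_of_int B + 1" unfolding B_def by linarith+
  have "(real_of_int A)^2 \<le> (sqrt (p/2))^2" using sqA A0 by (intro power_mono) auto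
  then have "real_of_int (2 * A^2) \<le> p" using p by simp
  then have A1: "2 * A^2 \<le> p" by linarith
  \<comment> \<open>Parity of \<open>p\<close> makes the bound strict; it becomes
    \<open>a^2 + b^2 < p\<close> at the end.\<close>
  moreover have "2 * A^2 \<noteq> p" using p by auto
  ultimately have A1: "2 * A^2 < p" by linarith
  have "(sqrt (p/2))^2 < (real_of_int A + 1)^2" using sqA p by (intro power_strict_mono) auto
  then have "real_of_int p < real_of_int (2 * (A+1)^2)" using p by simp
  then have A2: "p < 2 * (A+1)^2" by linarith
  have "(real_of_int B)^2 \<le> (sqrt (2*p))^2" using sqB B0 by (intro power_mono) auto
  then have "real_of_int (B^2) \<le> real_of_int (2 * p)" using p by simp
  then have B1: "B^2 \<le> 2 * p" by linarith
  have "(sqrt (2*p))^2 < (real_of_int B + 1)^2" using sqB p by (intro power_strict_mono) auto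
  then have "real_of_int (2*p) < real_of_int ((B+1)^2)" using p by simp
  then have B2: "2 * p < (B+1)^2" by linarith
  \<comment> \<open>With this bound the congruences for \<open>a = b = 0\<close> force
    \<open>c = d = 0\<close>, so \<open>(a, b)\<close> cannot vanish.\<close>
  have Bp: "B < p"
  proof (rule ccontr)
    assume "\<not> B < p"
    then have "p * p \<le> B * B" using p by (intro mult_mono) auto
    moreover have "3 * p \<le> p * p" using p by (intro mult_right_mono) auto
    ultimately have "3 * p \<le> 2 * p" using B1 unfolding power2_eq_square by linarith
    then show False using p by simp
  qed
  define X where "X = ({0..A} \<times> {0..A}) \<times> ({0..B} \<times> {0..B})"
  define \<phi> where "\<phi> = (\<lambda>((a,b),(c,d)). ((c - (\<alpha> * a + \<beta> * b)) mod p, (d - (\<beta> * a - \<alpha> * b)) mod p))"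
  have "\<phi> ` X \<subseteq> {0..<p} \<times> {0..<p}" using p by (auto simp: \<phi>_def)
  then have "card (\<phi> ` X) \<le> card ({0..<p} \<times> {0..<p})" by (intro card_mono) auto
  also have "\<dots> = nat p * nat p" by (simp add: card_cartesian_product)
  finally have "int (card (\<phi> ` X)) \<le> int (nat p * nat p)" by (simp only: of_nat_le_iff)
  then have c1: "int (card (\<phi> ` X)) \<le> p * p" using p by simp
  have "card X = nat (A+1) * nat (A+1) * (nat (B+1) * nat (B+1))"
    unfolding X_def by (simp add: card_cartesian_product)
  then have c2: "int (card X) = (A+1)^2 * (B+1)^2" using A0 B0 by (simp add: power2_eq_square)
  have "p * (2 * p) < (2 * (A+1)^2) * (B+1)^2" using A2 B2 p by (intro mult_strict_mono) auto
  then have "p * p < (A+1)^2 * (B+1)^2" by simp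
  then have "card (\<phi> ` X) < card X" using c1 c2 by linarith
  then have "\<not> inj_on \<phi> X" by (rule pigeonhole)
  then obtain u v where uv: "u \<in> X" "v \<in> X" "u \<noteq> v" "\<phi> u = \<phi> v" by (meson inj_onI)
  obtain a1 b1 c1 d1 where u: "u = ((a1,b1),(c1,d1))" by (metis prod.exhaust)
  obtain a2 b2 c2 d2 where v: "v = ((a2,b2),(c2,d2))" by (metis prod.exhaust)
  define a b c d where "a = a1 - a2" "b = b1 - b2" "c = c1 - c2" "d = d1 - d2"
  note df = this
  have bd: "\<bar>a\<bar> \<le> A" "\<bar>b\<bar> \<le> A" "\<bar>c\<bar> \<le> B" "\<bar>d\<bar> \<le> B" using uv u v by (auto simp: X_def df)
  have sq: "a^2 \<le> A^2" "b^2 \<le> A^2" "c^2 \<le> B^2" "d^2 \<le> B^2" using bd A0 B0 by (auto simp: abs_le_square_iff[symmetric])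
  have "(c1 - (\<alpha> * a1 + \<beta> * b1)) mod p = (c2 - (\<alpha> * a2 + \<beta> * b2)) mod p"
    using uv(4) by (simp add: u v \<phi>_def)
  then have "p dvd (c1 - (\<alpha> * a1 + \<beta> * b1)) - (c2 - (\<alpha> * a2 + \<beta> * b2))" by (simp add: mod_eq_dvd_iff)
  also have "(c1 - (\<alpha> * a1 + \<beta> * b1)) - (c2 - (\<alpha> * a2 + \<beta> * b2)) = c - (\<alpha> * a + \<beta> * b)" by (simp add: df algebra_simps)
  finally have dc: "p dvd c - (\<alpha> * a + \<beta> * b)" .
  have "(d1 - (\<beta> * a1 - \<alpha> * b1)) mod p = (d2 - (\<beta> * a2 - \<alpha> * b2)) mod p"
    using uv(4) by (simp add: u v \<phi>_def)
  then have "p dvd (d1 - (\<beta> * a1 - \<alpha> * b1)) - (d2 - (\<beta> * a2 - \<alpha> * b2))" by (simp add: mod_eq_dvd_iff)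
  also have "(d1 - (\<beta> * a1 - \<alpha> * b1)) - (d2 - (\<beta> * a2 - \<alpha> * b2)) = d - (\<beta> * a - \<alpha> * b)" by (simp add: df algebra_simps)
  finally have dd: "p dvd d - (\<beta> * a - \<alpha> * b)" .
  have nz: "\<not> (a = 0 \<and> b = 0 \<and> c = 0 \<and> d = 0)" using uv u v by (auto simp: df)
  have s0: "0 < a^2 + b^2"
  proof (rule ccontr)
    assume "\<not> 0 < a^2 + b^2"
    then have ab: "a = 0" "b = 0" using sum_power2_gt_zero_iff[of a b] by auto
    then have "p dvd c" "p dvd d" using dc dd by auto
    then have "c = 0" "d = 0" using bd Bp by (auto intro!: dvd_small_eq_0[of p])
    then show False using nz ab by simp
  qed
  \<comment> \<open>Modulo \<open>p\<close> the squares \<open>c^2 + d^2\<close> equal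
    \<open>(\<alpha>^2 + \<beta>^2) * (a^2 + b^2)\<close>; the two differences of squares record
    this.\<close>
  have "p dvd (\<alpha>^2 + \<beta>^2 + 1) * (a^2 + b^2) + (c - (\<alpha> * a + \<beta> * b)) * (c + (\<alpha> * a + \<beta> * b)) + (d - (\<beta> * a - \<alpha> * b)) * (d + (\<beta> * a - \<alpha> * b))"
    using iso dc dd by (intro dvd_add) auto
  also have "\<dots> = a^2 + b^2 + c^2 + d^2" by (simp add: algebra_simps power2_eq_square)
  finally obtain m where m: "a^2 + b^2 + c^2 + d^2 = p * m" by (auto elim: dvdE)
  have pos: "p * m > 0" using s0 m zero_le_power2[of c] zero_le_power2[of d] by linarith
  have "p * m < p * 5" using m sq A1 B1 by linarith
  then have "m < 5" using p by simp
  moreover have "m > 0" using pos p by (simp add: zero_less_mult_iff)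
  ultimately show ?thesis using that[of a b c d m] m s0 sq A1 dc dd by (simp add: mult.commute)
qed

section \<open>Integer spheres under scaling of the radius by 2 and 3\<close>

definition int_sphere :: "int \<Rightarrow> (int \<times> int \<times> int) set" where
  "int_sphere l = {(x, y, z). x^2 + y^2 + z^2 = l^2}"

lemma finite_int_sphere: "finite (int_sphere l)"
proof (rule finite_subset)
  show "int_sphere l \<subseteq> {-\<bar>l\<bar>..\<bar>l\<bar>} \<times> {-\<bar>l\<bar>..\<bar>l\<bar>} \<times> {-\<bar>l\<bar>..\<bar>l\<bar>}"
  proof
    fix n assume "n \<in> int_sphere l"
    then obtain x y z where n: "n = (x, y, z)" and e: "x^2 + y^2 + z^2 = l^2" by (auto simp: int_sphere_def)
    have "x^2 \<le> l^2" "y^2 \<le> l^2" "z^2 \<le> l^2" using e zero_le_power2[of x] zero_le_power2[of y] zero_le_power2[of z] by linarith+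
    then have "\<bar>x\<bar> \<le> \<bar>l\<bar>" "\<bar>y\<bar> \<le> \<bar>l\<bar>" "\<bar>z\<bar> \<le> \<bar>l\<bar>" by (simp_all only: abs_le_square_iff)
    then show "n \<in> {-\<bar>l\<bar>..\<bar>l\<bar>} \<times> {-\<bar>l\<bar>..\<bar>l\<bar>} \<times> {-\<bar>l\<bar>..\<bar>l\<bar>}" by (auto simp: n)
  qed
qed auto

text \<open>\<open>\<not> dvd3 p n\<close> is primitivity of \<open>n\<close> at \<open>p\<close>.
  It distinguishes new points of radius \<open>p ^ Suc a\<close> from multiples of points of radius
  \<open>p ^ a\<close>.\<close>

definition dvd3 :: "int \<Rightarrow> int \<times> int \<times> int \<Rightarrow> bool" where
  "dvd3 q n \<longleftrightarrow> q dvd fst n \<and> q dvd fst (snd n) \<and> q dvd snd (snd n)"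

lemma dvd3_simp [simp]: "dvd3 q (x, y, z) \<longleftrightarrow> q dvd x \<and> q dvd y \<and> q dvd z"
  by (simp add: dvd3_def)

lemma even_triple_of_square_sum:
  fixes x y z l :: int
  assumes "x^2 + y^2 + z^2 = (2 * l)^2"
  shows "even x \<and> even y \<and> even z"
proof -
  have sq: "w^2 mod 4 = (if even w then 0 else 1)" for w :: int
  proof (cases "even w")
    case True then show ?thesis by (auto elim!: evenE simp: power2_eq_square)
  next
    case False
    then obtain t where "w = 2 * t + 1" by (auto elim!: oddE)
    then have "w^2 = 1 + 4 * (t^2 + t)" by (simp add: power2_eq_square algebra_simps)
    then have "w^2 mod 4 = 1 mod 4" by (simp only: mod_mult_self2)
    then show ?thesis using False by simp
  qed
  have "(x^2 + y^2 + z^2) mod 4 = 0" using assms by (simp add: power2_eq_square)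
  then have "(x^2 mod 4 + y^2 mod 4 + z^2 mod 4) mod 4 = 0" by (metis mod_add_eq mod_add_left_eq)
  then show ?thesis unfolding sq by (auto split: if_splits)
qed

text \<open>Squares are 0 or 1 modulo 4, so doubling the radius creates no points. Factors 2 in the
  multiplier \<open>m\<close> can therefore be cancelled for free.\<close>

lemma int_sphere_double: "int_sphere (2 * l) = (\<lambda>(x,y,z). (2*x, 2*y, 2*z)) ` int_sphere l"
proof (intro equalityI subsetI)
  fix n assume "n \<in> int_sphere (2 * l)"
  then obtain x y z where n: "n = (x,y,z)" and e: "x^2 + y^2 + z^2 = (2 * l)^2" by (auto simp: int_sphere_def)
  obtain x' y' z' where w: "x = 2 * x'" "y = 2 * y'" "z = 2 * z'" using even_triple_of_square_sum[OF e] by (auto elim!: evenE)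
  then have "(x',y',z') \<in> int_sphere l" using e by (simp add: int_sphere_def power_mult_distrib)
  then show "n \<in> (\<lambda>(x,y,z). (2*x, 2*y, 2*z)) ` int_sphere l" using n w by force
qed (auto simp: int_sphere_def power_mult_distrib)

lemma int_sphere_scale: "(x, y, z) \<in> int_sphere l \<Longrightarrow> (k * x, k * y, k * z) \<in> int_sphere (k * l)"
  by (simp add: int_sphere_def power_mult_distrib flip: distrib_left)

lemma sign_mod_3:
  fixes x :: int assumes "\<not> 3 dvd x"
  obtains v w where "v \<in> {1, -1}" "x = v + 3 * w"
proof -
  have "x mod 3 = 1 \<or> x mod 3 = 2" using assms by presburger
  then show ?thesis
  proof
    assume "x mod 3 = 1" then show ?thesis using that[of 1 "x div 3"] by (metis insertI1 mod_mult_div_eq)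
  next
    assume "x mod 3 = 2"
    then have "x = -1 + 3 * (x div 3 + 1)" by presburger
    then show ?thesis using that[of "-1" "x div 3 + 1"] by blast
  qed
qed

text \<open>The reflection in a sign vector \<open>v\<close> congruent to \<open>n\<close> modulo 3 makes \<open>n\<close> divisible by 3.\<close>

lemma int_sphere_triple:
  assumes "(x, y, z) \<in> int_sphere (3 * l)" "\<not> dvd3 3 (x, y, z)"
  obtains v1 v2 v3 x' y' z' where "v1 \<in> {1,-1}" "v2 \<in> {1,-1}" "v3 \<in> {1,-1}"
    "(x', y', z') \<in> int_sphere l"
    "(x, y, z) = (3 * x' - 2 * v1 * (v1 * x' + v2 * y' + v3 * z'), 3 * y' - 2 * v2 * (v1 * x' + v2 * y' + v3 * z'), 3 * z' - 2 * v3 * (v1 * x' + v2 * y' + v3 * z'))"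
proof -
  have e: "x^2 + y^2 + z^2 = 9 * l^2" using assms(1) by (simp add: int_sphere_def power_mult_distrib)
  have sq: "w^2 mod 3 = (if 3 dvd w then 0 else 1)" for w :: int
  proof (cases "3 dvd w")
    case True then show ?thesis by (auto simp: power2_eq_square)
  next
    case False
    then obtain v t where "v \<in> {1,-1}" "w = v + 3 * t" by (rule sign_mod_3)
    then have "w^2 = 1 + 3 * (2 * v * t + 3 * t^2)" by (auto simp: power2_eq_square algebra_simps)
    then have "w^2 mod 3 = 1 mod 3" by (simp only: mod_mult_self2)
    then show ?thesis using False by simp
  qed
  have "(x^2 + y^2 + z^2) mod 3 = 0" using e by simp
  then have "(x^2 mod 3 + y^2 mod 3 + z^2 mod 3) mod 3 = 0" by (metis mod_add_eq mod_add_left_eq)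
  then have nd: "\<not> 3 dvd x" "\<not> 3 dvd y" "\<not> 3 dvd z" using assms(2) unfolding sq by (auto split: if_splits)
  obtain v1 w1 where 1: "v1 \<in> {1,-1}" "x = v1 + 3 * w1" using sign_mod_3[OF nd(1)] .
  obtain v2 w2 where 2: "v2 \<in> {1,-1}" "y = v2 + 3 * w2" using sign_mod_3[OF nd(2)] .
  obtain v3 w3 where 3: "v3 \<in> {1,-1}" "z = v3 + 3 * w3" using sign_mod_3[OF nd(3)] .
  have v: "v1 * v1 = 1" "v2 * v2 = 1" "v3 * v3 = 1" using 1 2 3 by auto
  define s where "s = v1 * w1 + v2 * w2 + v3 * w3"
  have "x^2 + y^2 + z^2 = (v1 * v1 + v2 * v2 + v3 * v3) + 6 * s + 9 * (w1^2 + w2^2 + w3^2)"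
    unfolding 1(2) 2(2) 3(2) s_def by (simp add: power2_eq_square algebra_simps)
  then have "3 + 6 * s = 9 * (l^2 - (w1^2 + w2^2 + w3^2))" using e v by simp
  then obtain u where u: "3 + 6 * s = 9 * u" by metis
  then have "s mod 3 = 1" by presburger
  define q where "q = s div 3"
  have q: "s = 3 * q + 1" using \<open>s mod 3 = 1\<close> unfolding q_def by presburger
  \<comment> \<open>One third of the mirror image of \<open>(x, y, z)\<close> in the plane
    orthogonal to \<open>v\<close>; \<open>s mod 3 = 1\<close> makes it integral. A reflection is an
    involution, so \<open>(x, y, z)\<close> is recovered by the same formula.\<close>
  define x' y' z' where "x' = w1 - v1 * (1 + 2 * q)" "y' = w2 - v2 * (1 + 2 * q)" "z' = w3 - v3 * (1 + 2 * q)"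
  note df = this
  define r where "r = v1 * x' + v2 * y' + v3 * z'"
  have "r = s - (v1 * v1 + v2 * v2 + v3 * v3) * (1 + 2 * q)" by (simp add: r_def df s_def algebra_simps)
  then have r: "r = -2 - 3 * q" using v q by simp
  have X: "x = 3 * x' - 2 * v1 * r" "y = 3 * y' - 2 * v2 * r" "z = 3 * z' - 2 * v3 * r"
    unfolding 1(2) 2(2) 3(2) df r by (simp_all add: algebra_simps)
  have "x^2 + y^2 + z^2 = 9 * (x'^2 + y'^2 + z'^2) - 12 * r * (v1 * x' + v2 * y' + v3 * z') + 4 * (v1 * v1 + v2 * v2 + v3 * v3) * r * r"
    unfolding X by (simp add: power2_eq_square algebra_simps)
  then have "x'^2 + y'^2 + z'^2 = l^2" using v e by (simp flip: r_def)
  then have "(x', y', z') \<in> int_sphere l" by (simp add: int_sphere_def)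
  then show ?thesis by (rule that[OF 1(1) 2(1) 3(1)]) (simp only: X[unfolded r_def])
qed

text \<open>The factor is 1 + 8: the multiples of 3, and one image of the smaller sphere for each of
  the eight sign vectors.\<close>

lemma card_int_sphere_triple: "card (int_sphere (3 * l)) \<le> 9 * card (int_sphere l)"
proof -
  define S where "S = {1, -1 :: int}"
  define f where "f = (\<lambda>((v1, v2, v3), (x', y', z')). (3 * x' - 2 * v1 * (v1 * x' + v2 * y' + v3 * z') :: int, 3 * y' - 2 * v2 * (v1 * x' + v2 * y' + v3 * z') :: int, 3 * z' - 2 * v3 * (v1 * x' + v2 * y' + v3 * z') :: int))"
  define g where "g = (\<lambda>(x :: int, y :: int, z :: int). (3 * x, 3 * y, 3 * z))"
  have "int_sphere (3 * l) \<subseteq> g ` int_sphere l \<union> f ` ((S \<times> S \<times> S) \<times> int_sphere l)"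
  proof
    fix n assume n: "n \<in> int_sphere (3 * l)"
    obtain x y z where xyz: "n = (x, y, z)" by (metis prod.exhaust)
    show "n \<in> g ` int_sphere l \<union> f ` ((S \<times> S \<times> S) \<times> int_sphere l)"
    proof (cases "dvd3 3 n")
      case True
      then obtain x' y' z' where w: "x = 3 * x'" "y = 3 * y'" "z = 3 * z'" using xyz by (auto elim!: dvdE)
      then have "(x', y', z') \<in> int_sphere l" using n xyz by (simp add: int_sphere_def power_mult_distrib)
      then have "n \<in> g ` int_sphere l" using w xyz by (force simp: g_def)
      then show ?thesis by blast
    next
      case False
      obtain v1 v2 v3 x' y' z' where h: "v1 \<in> {1,-1}" "v2 \<in> {1,-1}" "v3 \<in> {1,-1}"
        "(x', y', z') \<in> int_sphere l"
        "(x, y, z) = (3 * x' - 2 * v1 * (v1 * x' + v2 * y' + v3 * z'), 3 * y' - 2 * v2 * (v1 * x' + v2 * y' + v3 * z'), 3 * z' - 2 * v3 * (v1 * x' + v2 * y' + v3 * z'))"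
        by (rule int_sphere_triple[OF n[unfolded xyz] False[unfolded xyz]])
      have "n = f ((v1, v2, v3), (x', y', z'))" using h(5) xyz by (simp add: f_def)
      moreover have "((v1, v2, v3), (x', y', z')) \<in> (S \<times> S \<times> S) \<times> int_sphere l"
        using h(1-4) unfolding S_def by blast
      ultimately have "n \<in> f ` ((S \<times> S \<times> S) \<times> int_sphere l)" by blast
      then show ?thesis by blast
    qed
  qed
  then have "card (int_sphere (3 * l)) \<le> card (g ` int_sphere l \<union> f ` ((S \<times> S \<times> S) \<times> int_sphere l))"
    by (intro card_mono) (auto simp: S_def finite_int_sphere)
  also have "\<dots> \<le> card (g ` int_sphere l) + card (f ` ((S \<times> S \<times> S) \<times> int_sphere l))" by (rule card_Un_le)
  also have "\<dots> \<le> card (int_sphere l) + card ((S \<times> S \<times> S) \<times> int_sphere l)"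
    by (intro add_mono card_image_le) (auto simp: S_def finite_int_sphere)
  also have "card ((S \<times> S \<times> S) \<times> int_sphere l) = 8 * card (int_sphere l)"
    by (simp add: card_cartesian_product S_def)
  finally show ?thesis by simp
qed

lemma card_int_sphere_dvd_le:
  assumes "d dvd l" "l \<noteq> 0" shows "card (int_sphere d) \<le> card (int_sphere l)"
proof -
  obtain k where k: "l = d * k" using assms by (auto elim: dvdE)
  then have k0: "k \<noteq> 0" using assms by auto
  show ?thesis
  proof (rule card_inj_on_le)
    show "inj_on (\<lambda>(x,y,z). (k * x, k * y, k * z)) (int_sphere d)" using k0 by (auto simp: inj_on_def)
    show "(\<lambda>(x,y,z). (k * x, k * y, k * z)) ` int_sphere d \<subseteq> int_sphere l"
      using int_sphere_scale[of _ _ _ d k] by (auto simp: k mult.commute)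
  qed (rule finite_int_sphere)
qed

section \<open>Isotropic vectors modulo a prime, and points of prime radius\<close>

lemma exists_isotropic_mod_prime:
  fixes p :: int
  assumes p: "prime p" "odd p"
  obtains \<alpha> \<beta> where "p dvd \<alpha>^2 + \<beta>^2 + 1"
proof -
  have p2: "p > 2" using odd_prime_ge_3[OF p] by simp
  obtain h where h: "p = 2 * h + 1" using p by (auto elim: oddE)
  have h0: "h > 0" using h p2 by linarith
  define S where "S = {0..h}"
  define f where "f = (\<lambda>x::int. x^2 mod p)"
  define g where "g = (\<lambda>x::int. (- 1 - x^2) mod p)"
  have sq: "x = y" if "x \<in> S" "y \<in> S" "p dvd x^2 - y^2" for x y
  proof -
    have "x^2 - y^2 = (x - y) * (x + y)" by (simp add: power2_eq_square algebra_simps)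
    then have "p dvd x - y \<or> p dvd x + y" using that p by (simp add: prime_dvd_mult_iff)
    then show ?thesis
    proof
      assume "p dvd x - y"
      moreover have "\<bar>x - y\<bar> < p" using that h by (auto simp: S_def)
      ultimately have "x - y = 0" by (rule dvd_small_eq_0)
      then show ?thesis by simp
    next
      assume "p dvd x + y"
      moreover have "\<bar>x + y\<bar> < p" using that h by (auto simp: S_def)
      ultimately have "x + y = 0" by (rule dvd_small_eq_0)
      then show ?thesis using that by (auto simp: S_def)
    qed
  qed
  have "inj_on f S"
  proof (rule inj_onI)
    fix x y assume "x \<in> S" "y \<in> S" "f x = f y"
    then show "x = y" using sq[of x y] by (simp add: f_def mod_eq_dvd_iff)
  qed
  moreover have "inj_on g S"
  proof (rule inj_onI)
    fix x y assume "x \<in> S" "y \<in> S" "g x = g y"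
    then show "x = y" using sq[of y x] by (simp add: g_def mod_eq_dvd_iff)
  qed
  ultimately have c: "card (f ` S) = nat h + 1" "card (g ` S) = nat h + 1"
    using h0 by (auto simp: card_image S_def)
  have sub: "f ` S \<union> g ` S \<subseteq> {0..<p}" using p2 by (auto simp: f_def g_def)
  \<comment> \<open>Both sets have \<open>(p + 1) / 2\<close> elements, one more in total than there
    are residues.\<close>
  have "f ` S \<inter> g ` S \<noteq> {}"
  proof
    assume "f ` S \<inter> g ` S = {}"
    then have "card (f ` S \<union> g ` S) = card (f ` S) + card (g ` S)"
      by (intro card_Un_disjoint) (auto simp: S_def)
    moreover have "card (f ` S \<union> g ` S) \<le> card {0..<p}" using sub by (intro card_mono) auto
    ultimately show False using c h h0 by simp
  qed
  then obtain x y where "f x = g y" by blast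
  then have "p dvd x^2 - (- 1 - y^2)" by (simp add: f_def g_def mod_eq_dvd_iff)
  then show ?thesis using that[of x y] by (simp add: algebra_simps)
qed

text \<open>One isotropic pair is rotated by points of the circle modulo \<open>p\<close>, in the
  rational parametrization \<open>((1 - t^2) / (1 + t^2), 2 * t / (1 + t^2))\<close>;
  \<open>u t\<close> is the inverse of \<open>1 + t^2\<close>. The bound on \<open>T\<close> makes
  \<open>1 + t^2\<close> a unit and keeps the parameters distinct modulo \<open>p\<close>.\<close>

lemma rotated_isotropic:
  fixes p :: int
  assumes p: "prime p" "odd p" and T: "int T * int T + 1 < p"
  obtains \<alpha> \<beta> :: "nat \<Rightarrow> int" where
    "\<And>t. t \<le> T \<Longrightarrow> p dvd (\<alpha> t)^2 + (\<beta> t)^2 + 1"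
    "\<And>s t. s \<le> T \<Longrightarrow> t \<le> T \<Longrightarrow> p dvd \<alpha> s - \<alpha> t \<Longrightarrow> p dvd \<beta> s - \<beta> t \<Longrightarrow> s = t"
proof -
  obtain \<alpha>0 \<beta>0 where iso: "p dvd \<alpha>0^2 + \<beta>0^2 + 1" using exists_isotropic_mod_prime[OF p] .
  have "\<exists>u. p dvd u * (1 + int t * int t) - 1" if "t \<le> T" for t
  proof -
    have "int t * int t \<le> int T * int T" using that by (intro mult_mono) auto
    then have "1 + int t * int t < p" using T by linarith
    moreover have "1 + int t * int t > 0" by (simp add: add_pos_nonneg)
    ultimately have "\<not> p dvd 1 + int t * int t" using zdvd_not_zless by blast
    then have "coprime (1 + int t * int t) p" using p by (metis coprime_commute prime_imp_coprime)
    then obtain u where "[(1 + int t * int t) * u = 1] (mod p)" using cong_solve_coprime_int by blast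
    then show ?thesis by (auto simp: cong_iff_dvd_diff mult.commute)
  qed
  then obtain u where u: "\<And>t. t \<le> T \<Longrightarrow> p dvd u t * (1 + int t * int t) - 1" by metis
  define c where "c = (\<lambda>t. u t * (1 - int t * int t))"
  define d where "d = (\<lambda>t. u t * (2 * int t))"
  define \<alpha> where "\<alpha> = (\<lambda>t. c t * \<alpha>0 - d t * \<beta>0)"
  define \<beta> where "\<beta> = (\<lambda>t. d t * \<alpha>0 + c t * \<beta>0)"
  show ?thesis
  proof (rule that)
    fix t assume t: "t \<le> T"
    let ?w = "u t * (1 + int t * int t)"
    have "(\<alpha> t)^2 + (\<beta> t)^2 + 1 = ?w^2 * (\<alpha>0^2 + \<beta>0^2 + 1) - (?w - 1) * (?w + 1)"
      by (simp add: \<alpha>_def \<beta>_def c_def d_def power2_eq_square algebra_simps)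
    then show "p dvd (\<alpha> t)^2 + (\<beta> t)^2 + 1" using iso u[OF t] by (metis dvd_diff dvd_mult dvd_mult2)
  next
    fix s t assume st: "s \<le> T" "t \<le> T" and da: "p dvd \<alpha> s - \<alpha> t" and db: "p dvd \<beta> s - \<beta> t"
    \<comment> \<open>The rotation is undone with the help of
      \<open>\<alpha>0^2 + \<beta>0^2 = -1\<close> modulo \<open>p\<close>.\<close>
    have "p dvd (c s - c t) * (\<alpha>0^2 + \<beta>0^2 + 1) - ((\<alpha> s - \<alpha> t) * \<alpha>0 + (\<beta> s - \<beta> t) * \<beta>0)"
      using iso da db by (intro dvd_diff dvd_add) auto
    also have "\<dots> = c s - c t" by (simp add: \<alpha>_def \<beta>_def power2_eq_square algebra_simps)
    finally have dc: "p dvd c s - c t" .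
    have "p dvd (d s - d t) * (\<alpha>0^2 + \<beta>0^2 + 1) - ((\<beta> s - \<beta> t) * \<alpha>0 - (\<alpha> s - \<alpha> t) * \<beta>0)"
      using iso da db by (intro dvd_diff dvd_add) auto
    also have "\<dots> = d s - d t" by (simp add: \<alpha>_def \<beta>_def power2_eq_square algebra_simps)
    finally have dd: "p dvd d s - d t" .
    \<comment> \<open>Since \<open>u t * (1 + t^2) = 1\<close>, the first coordinate
      \<open>c t\<close> is \<open>2 * u t - 1\<close> modulo \<open>p\<close>. It determines
      \<open>u t\<close>, and then \<open>d t = 2 * t * u t\<close> determines
      \<open>t\<close>.\<close>
    have "p dvd (c s - c t) + ((u s * (1 + int s * int s) - 1) - (u t * (1 + int t * int t) - 1))"
      by (rule dvd_add[OF dc dvd_diff[OF u[OF st(1)] u[OF st(2)]]])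
    also have "\<dots> = 2 * (u s - u t)" by (simp add: c_def algebra_simps)
    finally have du: "p dvd u s - u t" by (simp only: odd_dvd_double_iff[OF p(2)])
    have "p dvd (d s - d t) - 2 * int s * (u s - u t)" by (intro dvd_diff dd dvd_mult du)
    also have "\<dots> = 2 * (u t * (int s - int t))" by (simp add: d_def algebra_simps)
    finally have "p dvd u t * (int s - int t)" by (simp only: odd_dvd_double_iff[OF p(2)])
    moreover have "\<not> p dvd u t"
    proof
      assume "p dvd u t"
      then have "p dvd u t * (1 + int t * int t) - (u t * (1 + int t * int t) - 1)" by (intro dvd_diff dvd_mult2 u st)
      then have "p dvd 1" by simp
      then show False using p not_prime_unit by blast
    qed
    ultimately have ds: "p dvd int s - int t" using p by (simp add: prime_dvd_mult_iff)
    have "int T \<le> int T * int T" by (cases "T = 0") auto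
    then have "\<bar>int s - int t\<bar> < p" using st T by linarith
    with ds have "int s - int t = 0" by (rule dvd_small_eq_0)
    then show "s = t" by simp
  qed
qed

text \<open>The parameter \<open>t\<close> is readable from the point constructed for it: modulo
  \<open>p\<close> this is \<open>x * (1, \<alpha> t, \<beta> t)\<close> with a unit
  \<open>x\<close>, so the ratios of its coordinates return the isotropic pair. The
  \<open>T + 1\<close> points lie on four spheres, all of size comparable to that of radius
  \<open>p\<close>.\<close>

lemma many_points_prime:
  fixes p :: int
  assumes p: "prime p" "odd p" and T: "int T * int T + 1 < p"
  shows "T < 12 * card (int_sphere p)"
proof -
  have p3: "p \<ge> 3" using odd_prime_ge_3[OF p] .
  obtain \<alpha> \<beta> :: "nat \<Rightarrow> int" where iso: "\<And>t. t \<le> T \<Longrightarrow> p dvd (\<alpha> t)^2 + (\<beta> t)^2 + 1"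
    and inj: "\<And>s t. s \<le> T \<Longrightarrow> t \<le> T \<Longrightarrow> p dvd \<alpha> s - \<alpha> t \<Longrightarrow> p dvd \<beta> s - \<beta> t \<Longrightarrow> s = t"
    using rotated_isotropic[OF assms] by metis
  have "\<exists>x y z. (x, y, z) \<in> (\<Union>m\<in>{1..4}. int_sphere (m * p)) \<and> \<not> p dvd x \<and> p dvd y - x * \<alpha> t \<and> p dvd z - x * \<beta> t"
    if t: "t \<le> T" for t
  proof -
    obtain a b c d m :: int where h: "a^2 + b^2 + c^2 + d^2 = m * p" "1 \<le> m" "m \<le> 4" "0 < a^2 + b^2" "a^2 + b^2 < p"
      "p dvd c - (\<alpha> t * a + \<beta> t * b)" "p dvd d - (\<beta> t * a - \<alpha> t * b)"
      using small_quadruple_in_lattice[OF p(2) p3 iso[OF t]] by metis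
    \<comment> \<open>With \<open>q = a + b i + c j + d k\<close>, the triple
      \<open>(x, z, -y)\<close> is the vector \<open>q i q'\<close>, where \<open>q'\<close> is the
      conjugate of \<open>q\<close>; its length is the norm \<open>m * p\<close> of
      \<open>q\<close>.\<close>
    define x y z where "x = a^2 + b^2 - c^2 - d^2" "y = 2 * (a * c - b * d)" "z = 2 * (b * c + a * d)"
    note df = this
    have "x^2 + y^2 + z^2 = (a^2 + b^2 + c^2 + d^2)^2" by (simp add: df power2_eq_square algebra_simps)
    then have "(x, y, z) \<in> int_sphere (m * p)" using h by (simp add: int_sphere_def)
    then have 1: "(x, y, z) \<in> (\<Union>m\<in>{1..4}. int_sphere (m * p))" using h(2,3) by auto
    have xs: "x = 2 * (a^2 + b^2) - m * p" using h(1) by (simp add: df)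
    have "\<not> p dvd a^2 + b^2" using h(4,5) zdvd_not_zless by blast
    then have "\<not> p dvd 2 * (a^2 + b^2)" by (simp only: odd_dvd_double_iff[OF p(2)] not_False_eq_True)
    then have 2: "\<not> p dvd x" unfolding xs by (simp add: dvd_diff_left_iff dvd_diff_right_iff)
    have "p dvd 2 * a * (c - (\<alpha> t * a + \<beta> t * b)) - 2 * b * (d - (\<beta> t * a - \<alpha> t * b)) + \<alpha> t * m * p"
      using h by (intro dvd_add dvd_diff) auto
    also have "\<dots> = y - x * \<alpha> t" unfolding xs by (simp add: df power2_eq_square algebra_simps)
    finally have 3: "p dvd y - x * \<alpha> t" .
    have "p dvd 2 * b * (c - (\<alpha> t * a + \<beta> t * b)) + 2 * a * (d - (\<beta> t * a - \<alpha> t * b)) + \<beta> t * m * p"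
      using h by (intro dvd_add dvd_diff) auto
    also have "\<dots> = z - x * \<beta> t" unfolding xs by (simp add: df power2_eq_square algebra_simps)
    finally have 4: "p dvd z - x * \<beta> t" .
    show ?thesis using 1 2 3 4 by blast
  qed
  then obtain X Y Z where XYZ: "\<And>t. t \<le> T \<Longrightarrow> (X t, Y t, Z t) \<in> (\<Union>m\<in>{1..4}. int_sphere (m * p)) \<and> \<not> p dvd X t \<and> p dvd Y t - X t * \<alpha> t \<and> p dvd Z t - X t * \<beta> t"
    by metis
  have "inj_on (\<lambda>t. (X t, Y t, Z t)) {..T}"
  proof (rule inj_onI)
    fix s t assume st: "s \<in> {..T}" "t \<in> {..T}" and e: "(X s, Y s, Z s) = (X t, Y t, Z t)"
    have s: "p dvd Y t - X t * \<alpha> s" "p dvd Z t - X t * \<beta> s" using XYZ[of s] st e by auto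
    have t: "p dvd Y t - X t * \<alpha> t" "p dvd Z t - X t * \<beta> t" "\<not> p dvd X t" using XYZ[of t] st by auto
    have "p dvd (Y t - X t * \<alpha> t) - (Y t - X t * \<alpha> s)" by (intro dvd_diff s t)
    also have "\<dots> = X t * (\<alpha> s - \<alpha> t)" by (simp add: algebra_simps)
    finally have a: "p dvd \<alpha> s - \<alpha> t" using p t by (simp add: prime_dvd_mult_iff)
    have "p dvd (Z t - X t * \<beta> t) - (Z t - X t * \<beta> s)" by (intro dvd_diff s t)
    also have "\<dots> = X t * (\<beta> s - \<beta> t)" by (simp add: algebra_simps)
    finally have b: "p dvd \<beta> s - \<beta> t" using p t by (simp add: prime_dvd_mult_iff)
    show "s = t" using inj[OF _ _ a b] st by simp
  qed
  then have "card {..T} \<le> card (\<Union>m\<in>{1..4}. int_sphere (m * p))"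
    using XYZ by (intro card_inj_on_le[where f = "\<lambda>t. (X t, Y t, Z t)"]) (auto simp: finite_int_sphere)
  also have "\<dots> \<le> (\<Sum>m\<in>{1..4}. card (int_sphere (m * p)))" by (rule card_UN_le) auto
  also have "{1..4::int} = {1, 2, 3, 4}" by auto
  also have "(\<Sum>m\<in>\<dots>. card (int_sphere (m * p))) = card (int_sphere p) + card (int_sphere (2 * p)) + card (int_sphere (3 * p)) + card (int_sphere (2 * (2 * p)))"
    by (simp add: algebra_simps)
  \<comment> \<open>The multipliers 1, 2, 3, 4 contribute 1 + 1 + 9 + 1 = 12.\<close>
  also have "\<dots> \<le> card (int_sphere p) + card (int_sphere p) + 9 * card (int_sphere p) + card (int_sphere p)"
  proof -
    have d: "card (int_sphere (2 * l)) \<le> card (int_sphere l)" for l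
      unfolding int_sphere_double by (rule card_image_le) (rule finite_int_sphere)
    show ?thesis using d[of p] d[of "2 * p"] card_int_sphere_triple[of p] by linarith
  qed
  finally show ?thesis by simp
qed

section \<open>Primitive points whose radius is a power of a prime\<close>

lemma reduce_multiplier:
  fixes p :: int
  assumes p: "prime p" "p \<noteq> 2" "p \<noteq> 3" and m: "1 \<le> m" "m \<le> 4" and n: "n \<in> int_sphere (m * l)" "\<not> dvd3 p n"
  obtains n' where "n' \<in> int_sphere l" "\<not> dvd3 p n'"
proof -
  have half: "\<exists>n'\<in>int_sphere l. \<not> dvd3 p n'" if "n \<in> int_sphere (2 * l)" "\<not> dvd3 p n" for n l
    using that unfolding int_sphere_double by force
  consider "m = 1" | "m = 2" | "m = 3" | "m = 4" using m by linarith
  then have "\<exists>n'\<in>int_sphere l. \<not> dvd3 p n'"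
  proof cases
    case 1 then show ?thesis using n by auto
  next
    case 2 then show ?thesis using n half by auto
  next
    case 4
    then have "n \<in> int_sphere (2 * (2 * l))" using n by (simp add: algebra_simps)
    then show ?thesis using half n(2) by blast
  next
    case 3
    obtain x y z where xyz: "n = (x, y, z)" by (metis prod.exhaust)
    show ?thesis
    proof (cases "dvd3 3 n")
      case True
      then obtain x' y' z' where w: "x = 3 * x'" "y = 3 * y'" "z = 3 * z'" using xyz by (auto elim!: dvdE)
      then have "(x', y', z') \<in> int_sphere l" using n xyz 3 by (simp add: int_sphere_def power_mult_distrib)
      moreover have "\<not> dvd3 p (x', y', z')" using n(2) w xyz by auto
      ultimately show ?thesis by blast
    next
      case False
      have n3: "(x, y, z) \<in> int_sphere (3 * l)" using n 3 xyz by simp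
      obtain v1 v2 v3 x' y' z' where h: "(x', y', z') \<in> int_sphere l"
        "(x, y, z) = (3 * x' - 2 * v1 * (v1 * x' + v2 * y' + v3 * z'), 3 * y' - 2 * v2 * (v1 * x' + v2 * y' + v3 * z'), 3 * z' - 2 * v3 * (v1 * x' + v2 * y' + v3 * z'))"
        by (rule int_sphere_triple[OF n3 False[unfolded xyz]])
      \<comment> \<open>The given point is an integer linear combination of the new one, so a common
        factor \<open>p\<close> would be passed on to it.\<close>
      have "\<not> dvd3 p (x', y', z')"
      proof
        assume "dvd3 p (x', y', z')"
        then have "p dvd x'" "p dvd y'" "p dvd z'" "p dvd v1 * x' + v2 * y' + v3 * z'" by auto
        then have "dvd3 p (x, y, z)" unfolding h(2) by (auto intro!: dvd_diff)
        then show False using n(2) xyz by simp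
      qed
      then show ?thesis using h by blast
    qed
  qed
  then show ?thesis using that by blast
qed

text \<open>A permutation of coordinates brings a unit modulo \<open>p\<close> to the first place.
  If the linear form vanished at both \<open>(x, y, z)\<close> and \<open>(x, -y, -z)\<close>, so
  would the sum \<open>2 * w1 * x\<close> of its two values.\<close>

lemma int_sphere_arrange:
  fixes p :: int
  assumes p: "prime p" "odd p" and n: "n \<in> int_sphere l" "\<not> dvd3 p n" and w1: "\<not> p dvd w1"
  obtains x y z where "(x, y, z) \<in> int_sphere l" "\<not> p dvd w1 * x + w2 * y + w3 * z"
proof -
  obtain x0 y0 z0 where xyz: "n = (x0, y0, z0)" by (metis prod.exhaust)
  have "\<exists>x y z. (x, y, z) \<in> int_sphere l \<and> \<not> p dvd x"
  proof -
    consider "\<not> p dvd x0" | "\<not> p dvd y0" | "\<not> p dvd z0" using n xyz by auto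
    then show ?thesis
    proof cases
      case 1 then show ?thesis using n xyz by blast
    next
      case 2 
      have "(y0, x0, z0) \<in> int_sphere l" using n xyz by (simp add: int_sphere_def algebra_simps)
      then show ?thesis using 2 by blast
    next
      case 3
      have "(z0, y0, x0) \<in> int_sphere l" using n xyz by (simp add: int_sphere_def algebra_simps)
      then show ?thesis using 3 by blast
    qed
  qed
  then obtain x y z where h: "(x, y, z) \<in> int_sphere l" "\<not> p dvd x" by blast
  have h': "(x, -y, -z) \<in> int_sphere l" using h by (simp add: int_sphere_def)
  show ?thesis
  proof (cases "p dvd w1 * x + w2 * y + w3 * z \<and> p dvd w1 * x + w2 * (-y) + w3 * (-z)")
    case True
    then have "p dvd (w1 * x + w2 * y + w3 * z) + (w1 * x + w2 * (-y) + w3 * (-z))" by (metis dvd_add)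
    also have "\<dots> = 2 * (w1 * x)" by simp
    finally have "p dvd w1 * x" by (simp only: odd_dvd_double_iff[OF p(2)])
    then show ?thesis using p w1 h by (simp add: prime_dvd_mult_iff)
  next
    case False then show ?thesis using that h h' by blast
  qed
qed

text \<open>Conjugation by a quaternion of norm \<open>m * p\<close> is an integral matrix that
  multiplies lengths by \<open>m * p\<close>. A corner entry \<open>w\<close> is a unit modulo
  \<open>p\<close>, so the starting point can be arranged to make the first coordinate of its image
  a unit; then \<open>m\<close> is cancelled. The prime 3, where cancelling the multiplier 3 would
  interfere, has an explicit matrix.\<close>

lemma primitive_step:
  fixes p :: int
  assumes p: "prime p" "odd p" and n: "n \<in> int_sphere l" "\<not> dvd3 p n"
  obtains n' where "n' \<in> int_sphere (p * l)" "\<not> dvd3 p n'"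
proof (cases "p = 3")
  case True
  \<comment> \<open>The rows \<open>(1, 2, 2)\<close>, \<open>(2, 1, -2)\<close>,
    \<open>(2, -2, 1)\<close> form 3 times an orthogonal matrix.\<close>
  obtain x y z where h: "(x, y, z) \<in> int_sphere l" "\<not> p dvd 1 * x + 2 * y + 2 * z"
    using int_sphere_arrange[OF p n, of 1 2 2] p(1) by (metis not_prime_unit)
  have "(x + 2 * y + 2 * z)^2 + (2 * x + y - 2 * z)^2 + (2 * x - 2 * y + z)^2 = 9 * (x^2 + y^2 + z^2)"
    by (simp add: power2_eq_square algebra_simps)
  then have "(x + 2 * y + 2 * z, 2 * x + y - 2 * z, 2 * x - 2 * y + z) \<in> int_sphere (p * l)"
    using h True by (simp add: int_sphere_def power_mult_distrib)
  then show ?thesis using h(2) by (intro that) auto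
next
  case False
  have p3: "p \<ge> 3" using odd_prime_ge_3[OF p] .
  obtain \<alpha> \<beta> where iso: "p dvd \<alpha>^2 + \<beta>^2 + 1" using exists_isotropic_mod_prime[OF p] .
  obtain a b c d m :: int where q: "a^2 + b^2 + c^2 + d^2 = m * p" "1 \<le> m" "m \<le> 4" "0 < a^2 + b^2" "a^2 + b^2 < p"
    using small_quadruple_in_lattice[OF p(2) p3 iso] by metis
  define w where "w = a^2 + b^2 - c^2 - d^2"
  have xs: "w = 2 * (a^2 + b^2) - m * p" using q(1) by (simp add: w_def)
  have "\<not> p dvd a^2 + b^2" using q(4,5) zdvd_not_zless by blast
  then have "\<not> p dvd 2 * (a^2 + b^2)" by (simp only: odd_dvd_double_iff[OF p(2)] not_False_eq_True)
  then have w1: "\<not> p dvd w" unfolding xs by (simp add: dvd_diff_left_iff dvd_diff_right_iff)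
  obtain x y z where h: "(x, y, z) \<in> int_sphere l" "\<not> p dvd w * x + (2 * (b * c - a * d)) * y + (2 * (b * d + a * c)) * z"
    using int_sphere_arrange[OF p n w1] by metis
  \<comment> \<open>The Euler-Rodrigues matrix of the quaternion, cleared of its
    denominator.\<close>
  define x' where "x' = w * x + (2 * (b * c - a * d)) * y + (2 * (b * d + a * c)) * z"
  define y' where "y' = (2 * (b * c + a * d)) * x + (a^2 - b^2 + c^2 - d^2) * y + (2 * (c * d - a * b)) * z"
  define z' where "z' = (2 * (b * d - a * c)) * x + (2 * (c * d + a * b)) * y + (a^2 - b^2 - c^2 + d^2) * z"
  have "x'^2 + y'^2 + z'^2 = (a^2 + b^2 + c^2 + d^2)^2 * (x^2 + y^2 + z^2)"
    by (simp add: x'_def y'_def z'_def w_def power2_eq_square algebra_simps)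
  then have "(x', y', z') \<in> int_sphere (m * (p * l))" using h q(1) by (simp add: int_sphere_def power_mult_distrib)
  moreover have "\<not> dvd3 p (x', y', z')" using h by (simp add: x'_def)
  ultimately obtain n' where "n' \<in> int_sphere (p * l)" "\<not> dvd3 p n'"
    using reduce_multiplier[OF p(1) _ False q(2,3)] p(2) by (metis even_numeral)
  then show ?thesis using that by blast
qed

lemma primitive_prime_power:
  fixes p :: int
  assumes p: "prime p" "odd p"
  shows "\<exists>n\<in>int_sphere (p ^ a). \<not> dvd3 p n"
proof (induction a)
  case 0
  have "(1, 0, 0) \<in> int_sphere 1" "\<not> dvd3 p (1, 0, 0)" using p(1) not_prime_unit by (auto simp: int_sphere_def)
  then show ?case unfolding power_0 by blast
next
  case (Suc a)
  then show ?case using primitive_step[OF p] by (metis power_Suc)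
qed

text \<open>Multiplication by \<open>p\<close> embeds each sphere into the next, and its image
  contains no primitive point. Every step therefore adds at least one point.\<close>

lemma many_points_prime_power:
  fixes p :: int
  assumes p: "prime p" "odd p"
  shows "a < card (int_sphere (p ^ a))"
proof (induction a)
  case 0
  have "(1, 0, 0) \<in> int_sphere 1" by (simp add: int_sphere_def)
  then show ?case using finite_int_sphere[of 1] by (auto simp: card_gt_0_iff)
next
  case (Suc a)
  define f where "f = (\<lambda>(x::int,y::int,z::int). (p * x, p * y, p * z))"
  have p0: "p \<noteq> 0" using p by auto
  obtain n where n: "n \<in> int_sphere (p ^ Suc a)" "\<not> dvd3 p n" using primitive_prime_power[OF p] by blast
  have sub: "f ` int_sphere (p ^ a) \<subseteq> int_sphere (p ^ Suc a)" using int_sphere_scale by (force simp: f_def)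
  have "n \<notin> f ` int_sphere (p ^ a)" using n(2) by (auto simp: f_def)
  then have c: "card (insert n (f ` int_sphere (p ^ a))) = Suc (card (f ` int_sphere (p ^ a)))"
    by (simp add: finite_int_sphere)
  have "card (f ` int_sphere (p ^ a)) = card (int_sphere (p ^ a))"
    using p0 by (intro card_image) (auto simp: inj_on_def f_def)
  moreover have "card (insert n (f ` int_sphere (p ^ a))) \<le> card (int_sphere (p ^ Suc a))"
    using sub n by (intro card_mono finite_int_sphere) auto
  ultimately show ?case using Suc c by linarith
qed

text \<open>If there are fewer than \<open>M\<close> points, the counts for divisors bound both the
  prime factors of \<open>l\<close> and their multiplicities, hence \<open>l\<close> itself.\<close>

theorem card_int_sphere_odd_tendsto:
  "\<exists>L. \<forall>l::int. l \<ge> L \<and> odd l \<longrightarrow> M \<le> card (int_sphere l)"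
proof -
  \<comment> \<open>Chosen so that a prime \<open>p \<ge> P\<close> admits \<open>T = 12 * M\<close>
    in the count for prime radius.\<close>
  define P where "P = (12 * M) * (12 * M) + 2"
  have "M \<le> card (int_sphere l)" if l: "int ((P ^ M) ^ P) + 1 \<le> l \<and> odd l" for l
  proof (rule ccontr)
    have lpos: "l > 0" using l of_nat_0_le_iff[of "(P ^ M) ^ P"] by linarith
    define n where "n = nat l"
    have ln: "l = int n" using lpos by (simp add: n_def)
    then have n0: "n > 0" using lpos by simp
    have on: "odd n" using l unfolding ln by simp
    assume neg: "\<not> M \<le> card (int_sphere l)"
    have pf: "odd p" "prime (int p)" "p < P" "multiplicity p n < M" if "p \<in> prime_factors n" for p
    proof -
      have pp: "prime p" "p dvd n" using that by auto
      show op: "odd p" using pp on by auto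
      show pi: "prime (int p)" using pp by simp
      show "p < P"
      proof (rule ccontr)
        assume "\<not> p < P"
        then have "12 * M * (12 * M) + 1 < p" by (simp add: P_def)
        then have big: "int (12 * M) * int (12 * M) + 1 < int p"
          by (metis of_nat_1 of_nat_add of_nat_less_iff of_nat_mult)
        have "odd (int p)" using op by simp
        then have "12 * M < 12 * card (int_sphere (int p))" using big by (rule many_points_prime[OF pi])
        moreover have "card (int_sphere (int p)) \<le> card (int_sphere l)"
          using pp lpos by (intro card_int_sphere_dvd_le) (auto simp: ln)
        ultimately show False using neg by linarith
      qed
      show "multiplicity p n < M"
      proof (rule ccontr)
        assume "\<not> multiplicity p n < M"
        then have "p ^ M dvd n" by (intro multiplicity_dvd') auto
        then have "int p ^ M dvd l" unfolding ln by (metis of_nat_dvd_iff of_nat_power)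
        then have "card (int_sphere (int p ^ M)) \<le> card (int_sphere l)" using lpos by (intro card_int_sphere_dvd_le) auto
        then show False using many_points_prime_power[OF pi, of M] op neg by auto
      qed
    qed
    have "n = (\<Prod>p\<in>prime_factors n. p ^ multiplicity p n)" using n0 by (simp add: prime_factorization_nat)
    also have "\<dots> \<le> (\<Prod>p\<in>prime_factors n. P ^ M)"
    proof (intro prod_mono conjI)
      fix p assume a: "p \<in> prime_factors n"
      have "p ^ multiplicity p n \<le> P ^ multiplicity p n" using pf(3)[OF a] by (intro power_mono) auto
      also have "\<dots> \<le> P ^ M" using pf(4)[OF a] by (intro power_increasing) (auto simp: P_def)
      finally show "p ^ multiplicity p n \<le> P ^ M" .
    qed auto
    also have "\<dots> = (P ^ M) ^ card (prime_factors n)" by simp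
    also have "\<dots> \<le> (P ^ M) ^ P"
    proof (rule power_increasing)
      have "card (prime_factors n) \<le> card {..<P}" using pf(3) by (intro card_mono) auto
      then show "card (prime_factors n) \<le> P" by simp
      show "1 \<le> P ^ M" by (simp add: P_def)
    qed
    finally have "n \<le> (P ^ M) ^ P" .
    then have "int n \<le> int ((P ^ M) ^ P)" by (simp only: of_nat_le_iff)
    then show False using l ln by linarith
  qed
  then show ?thesis by blast
qed

section \<open>Interpolation by vector exponentials\<close>

text \<open>Elimination of a pivot \<open>y\<close> for one equation at a time. The solution is
  extended by 0 outside \<open>X\<close>, so that it can serve as a coefficient family on a larger
  index set.\<close>

lemma homogeneous_system_nontrivial:
  fixes c :: "'e \<Rightarrow> 'x \<Rightarrow> 'a::field"
  assumes "finite Q" "finite X" "card Q < card X"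
  shows "\<exists>a. (\<exists>x\<in>X. a x \<noteq> 0) \<and> (\<forall>x. x \<notin> X \<longrightarrow> a x = 0) \<and> (\<forall>e\<in>Q. (\<Sum>x\<in>X. a x * c e x) = 0)"
  using assms
proof (induction Q arbitrary: X c rule: finite_induct)
  case empty
  then obtain x where "x \<in> X" by fastforce
  then show ?case by (intro exI[of _ "\<lambda>y. if y = x then 1 else 0"]) auto
next
  case (insert e Q)
  show ?case
  proof (cases "\<forall>x\<in>X. c e x = 0")
    case True
    have "card Q < card X" using insert by simp
    then obtain a where "\<exists>x\<in>X. a x \<noteq> 0" "\<forall>x. x \<notin> X \<longrightarrow> a x = 0" "\<forall>e\<in>Q. (\<Sum>x\<in>X. a x * c e x) = 0"
      using insert.IH[OF insert.prems(1), of c] by blast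
    then show ?thesis using True by (intro exI[of _ a]) auto
  next
    case False
    then obtain y where y: "y \<in> X" "c e y \<noteq> 0" by blast
    define Y where "Y = X - {y}"
    have Y: "finite Y" "card Q < card Y" "y \<notin> Y" "X = insert y Y" using insert y by (auto simp: Y_def)
    obtain a where a: "\<exists>x\<in>Y. a x \<noteq> 0" "\<forall>x. x \<notin> Y \<longrightarrow> a x = 0"
      "\<forall>e'\<in>Q. (\<Sum>x\<in>Y. a x * (c e' x - c e' y * c e x / c e y)) = 0"
      using insert.IH[OF Y(1,2), of "\<lambda>e' x. c e' x - c e' y * c e x / c e y"] by blast
    define b where "b = a(y := - (\<Sum>x\<in>Y. a x * c e x) / c e y)"
    have sum: "(\<Sum>x\<in>X. b x * c e' x) = (\<Sum>x\<in>Y. a x * (c e' x - c e' y * c e x / c e y))" for e'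
    proof -
      have "(\<Sum>x\<in>X. b x * c e' x) = b y * c e' y + (\<Sum>x\<in>Y. a x * c e' x)"
        using Y by (auto simp: b_def intro!: sum.cong)
      also have "b y * c e' y = (\<Sum>x\<in>Y. - (a x * (c e' y * c e x / c e y)))"
        by (simp add: b_def sum_negf sum_distrib_left sum_distrib_right sum_divide_distrib mult_ac)
      finally show ?thesis by (simp add: sum.distrib[symmetric] right_diff_distrib)
    qed
    have "(\<Sum>x\<in>X. b x * c e x) = 0" unfolding sum using y by simp
    moreover have "\<forall>e'\<in>Q. (\<Sum>x\<in>X. b x * c e' x) = 0" unfolding sum using a by blast
    moreover have "\<exists>x\<in>X. b x \<noteq> 0" using a(1) Y by (auto simp: b_def)
    moreover have "\<forall>x. x \<notin> X \<longrightarrow> b x = 0" using a(2) y Y by (auto simp: b_def)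
    ultimately show ?thesis by blast
  qed
qed

text \<open>Bilinear, without conjugation: a vector \<open>f\<close> stands for a complex linear
  functional.\<close>

definition cdot :: "complex ^ 'd \<Rightarrow> complex ^ 'd \<Rightarrow> complex" where
  "cdot f w = (\<Sum>j\<in>UNIV. f $ j * w $ j)"

lemma cdot_0 [simp]: "cdot 0 w = 0" "cdot f 0 = 0"
  by (simp_all add: cdot_def)

lemma cdot_add_right: "cdot f (v + w) = cdot f v + cdot f w"
  by (simp add: cdot_def algebra_simps sum.distrib)

lemma cdot_scale_right: "cdot f (c *s w) = c * cdot f w"
  by (simp add: cdot_def algebra_simps sum_distrib_left)

lemma cdot_sum_right: "cdot f (\<Sum>n\<in>I. g n) = (\<Sum>n\<in>I. cdot f (g n))"
  by (induction I rule: infinite_finite_induct) (auto simp: cdot_add_right)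

lemma matrix_vector_cdot: "A *v f = (\<chi> j. cdot f (A $ j))"
  by (simp add: matrix_vector_mult_def cdot_def mult.commute)

lemma det_nz_of_cdot:
  fixes A :: "complex ^ 'd ^ 'd"
  shows "det A \<noteq> 0 \<longleftrightarrow> (\<forall>f. (\<forall>j. cdot f (A $ j) = 0) \<longrightarrow> f = 0)"
proof -
  have "det A \<noteq> 0 \<longleftrightarrow> invertible A" by (simp add: invertible_det_nz)
  also have "\<dots> \<longleftrightarrow> (\<exists>B. B ** A = mat 1)" by (rule invertible_left_inverse)
  also have "\<dots> \<longleftrightarrow> (\<forall>x. A *v x = 0 \<longrightarrow> x = 0)" by (rule matrix_left_invertible_ker)
  finally show ?thesis by (simp add: matrix_vector_cdot vec_eq_iff)
qed

text \<open>A maximal independent subset of the vectors is annihilated only by the zero functional.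
  It has at most \<open>CARD('d)\<close> elements, so it can be listed as rows of a square matrix,
  and the functional criterion for the determinant applies to that list.\<close>

lemma choose_det_nonzero:
  fixes w :: "'i \<Rightarrow> complex ^ 'd"
  assumes sep: "\<And>f. f \<noteq> 0 \<Longrightarrow> \<exists>n\<in>J. cdot f (w n) \<noteq> 0"
  obtains B :: "'d \<Rightarrow> 'i" where "\<And>j. B j \<in> J" "det (\<chi> j. w (B j)) \<noteq> 0"
proof -
  obtain b where b: "b \<subseteq> w ` J" "vec.independent b" "w ` J \<subseteq> vec.span b" "card b = vec.dim (w ` J)"
    using vec.basis_exists[of "w ` J"] by metis
  have fb: "finite b" using b(2) by (rule vec.finiteI_independent)
  have cb: "card b \<le> CARD('d)" using b(4) vec.dim_subset_UNIV[of "w ` J"] unfolding vec.dimension_def card_cart_basis by simp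
  have kill: "f = 0" if "\<And>x. x \<in> b \<Longrightarrow> cdot f x = 0" for f
  proof (rule ccontr)
    assume "f \<noteq> 0"
    then obtain n where n: "n \<in> J" "cdot f (w n) \<noteq> 0" using sep by blast
    have "cdot f x = 0" if "x \<in> vec.span b" for x
      using that
      by (induction rule: vec.span_induct_alt) (auto simp: cdot_add_right cdot_scale_right \<open>\<And>x. x \<in> b \<Longrightarrow> cdot f x = 0\<close>)
    then show False using n b by blast
  qed
  have "(1 :: complex ^ 'd) \<noteq> 0" by (simp add: vec_eq_iff)
  then have bne: "b \<noteq> {}" using kill[of 1] by auto
  obtain g :: "'d \<Rightarrow> complex ^ 'd" where g: "range g = b"
  proof -
    obtain h where h: "h ` b \<subseteq> (UNIV :: 'd set)" "inj_on h b"
      using card_le_inj[OF fb finite_class.finite_UNIV cb] by blast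
    \<comment> \<open>Indices outside the range of \<open>h\<close> repeat an arbitrary element of
      \<open>b\<close>; only \<open>range g = b\<close> matters.\<close>
    define g where "g = (\<lambda>j. if j \<in> h ` b then inv_into b h j else (SOME x. x \<in> b))"
    have "g j \<in> b" for j using bne by (auto simp: g_def inv_into_into some_in_eq)
    moreover have "x \<in> range g" if "x \<in> b" for x
      using that h by (intro image_eqI[of _ _ "h x"]) (auto simp: g_def)
    ultimately show ?thesis using that[of g] by blast
  qed
  have "\<forall>j. \<exists>n\<in>J. g j = w n" using b(1) g by blast
  then obtain B where B: "\<And>j. B j \<in> J" "\<And>j. g j = w (B j)" by metis
  have "det (\<chi> j. w (B j)) \<noteq> 0" unfolding det_nz_of_cdot
  proof (intro allI impI)
    fix f assume "\<forall>j. cdot f ((\<chi> j. w (B j)) $ j) = 0"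
    then have "cdot f (g j) = 0" for j by (simp add: B)
    then show "f = 0" using kill g by (metis rangeE)
  qed
  then show ?thesis using that B by blast
qed

lemma holomorphic_on_det:
  fixes M :: "complex \<Rightarrow> complex ^ 'd ^ 'd"
  assumes "\<And>i j. (\<lambda>z. M z $ i $ j) holomorphic_on S"
  shows "(\<lambda>z. det (M z)) holomorphic_on S"
  unfolding det_def by (intro holomorphic_intros assms)

lemma tendsto_det_complex:
  fixes M :: "'b \<Rightarrow> complex ^ 'd ^ 'd"
  assumes "\<And>i j. ((\<lambda>z. M z $ i $ j) \<longlongrightarrow> A $ i $ j) F"
  shows "((\<lambda>z. det (M z)) \<longlongrightarrow> det A) F"
  unfolding det_def by (intro tendsto_intros assms)

text \<open>Identity theorem. It brings a parameter found on the imaginary axis back to a real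
  position on the line.\<close>

lemma entire_nonzero_real_point:
  assumes h: "f holomorphic_on UNIV" and nz: "f z0 \<noteq> 0"
  obtains t :: real where "f (of_real t) \<noteq> 0"
proof -
  have "\<exists>t::real. f (of_real t) \<noteq> 0"
  proof (rule ccontr)
    assume "\<not> ?thesis"
    then have 0: "\<And>z. z \<in> range complex_of_real \<Longrightarrow> f z = 0" by auto
    have lim: "0 islimpt range complex_of_real"
      unfolding islimpt_approachable
    proof (intro allI impI)
      fix e :: real assume "e > 0"
      then show "\<exists>x'\<in>range complex_of_real. x' \<noteq> 0 \<and> dist x' 0 < e"
        by (intro bexI[of _ "complex_of_real (e/2)"] rangeI) auto
    qed
    have "f z0 = 0"
      by (rule analytic_continuation[OF h open_UNIV connected_UNIV subset_UNIV UNIV_I lim 0 UNIV_I])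
    then show False using nz by simp
  qed
  then show ?thesis using that by blast
qed

text \<open>The leading exponents of the kernel of the first points miss at most
  \<open>CARD('d) * card S\<close> indices, so their coefficient vectors still span. Along the negative
  imaginary axis the leading terms dominate, so the determinant of the values of the kernel at an
  additional point is not identically zero.\<close>

lemma exponential_interpolation:
  fixes th :: "'i \<Rightarrow> real" and w :: "'i \<Rightarrow> complex ^ 'd" and S :: "'k set"
  assumes "finite S" and I: "finite I" "inj_on th I"
    and "\<And>f. f \<noteq> 0 \<Longrightarrow> CARD('d) * card S \<le> card {n\<in>I. cdot f (w n) \<noteq> 0}"
  shows "\<exists>t. \<forall>f. (\<forall>n\<in>I. (\<Sum>s\<in>S. exp (\<i> * th n * of_real (t s)) * cdot (f s) (w n)) = 0) \<longrightarrow> (\<forall>s\<in>S. f s = 0)"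
  using assms(1,4)
proof (induction S rule: finite_induct)
  case empty
  then show ?case by simp
next
  case (insert q S)
  define E where "E = (\<lambda>n (x::complex). exp (\<i> * th n * x))"
  have "CARD('d) * card S \<le> card {n\<in>I. cdot f (w n) \<noteq> 0}" if "f \<noteq> 0" for f
    using insert.prems[OF that] insert.hyps by simp
  then obtain t :: "'k \<Rightarrow> real" where t: "\<And>f. (\<forall>n\<in>I. (\<Sum>s\<in>S. E n (t s) * cdot (f s) (w n)) = 0) \<Longrightarrow> (\<forall>s\<in>S. f s = 0)"
    using insert.IH unfolding E_def by auto
  \<comment> \<open>Coefficient families whose exponential sums vanish at all earlier points;
    \<open>J\<close> collects the leading indices of such families, normalized to leading
    coefficient 1.\<close>
  define K where "K = {a. \<forall>s\<in>S. (\<Sum>n\<in>I. (a n * E n (t s)) *s w n) = 0}"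
  define J where "J = {n\<in>I. \<exists>a\<in>K. a n = 1 \<and> (\<forall>m\<in>I. th m > th n \<longrightarrow> a m = 0)}"
  \<comment> \<open>More nonleading indices than the \<open>CARD('d) * card S\<close> scalar
    conditions would carry a nonzero element of \<open>K\<close> supported on them, and its own
    leading index would lie in \<open>J\<close>.\<close>
  have cJ: "card (I - J) \<le> CARD('d) * card S"
  proof (rule ccontr)
    assume "\<not> card (I - J) \<le> CARD('d) * card S"
    then have "card (S \<times> (UNIV :: 'd set)) < card (I - J)" using insert.hyps by (simp add: card_cartesian_product mult.commute)
    then obtain a where a: "\<exists>n\<in>I - J. a n \<noteq> 0" "\<forall>n. n \<notin> I - J \<longrightarrow> a n = 0"
      "\<forall>e\<in>S \<times> UNIV. (\<Sum>n\<in>I - J. a n * (E n (t (fst e)) * w n $ snd e)) = 0"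
      using homogeneous_system_nontrivial[of "S \<times> (UNIV :: 'd set)" "I - J" "\<lambda>e n. E n (t (fst e)) * w n $ snd e"]
        insert.hyps I by auto
    have aK: "(\<lambda>n. c * a n) \<in> K" for c
    proof -
      have "(\<Sum>n\<in>I. (c * a n * E n (t s)) *s w n) $ j = 0" if "s \<in> S" for s j
      proof -
        have "(\<Sum>n\<in>I. (c * a n * E n (t s)) *s w n) $ j = (\<Sum>n\<in>I. c * (a n * (E n (t s) * w n $ j)))"
          by (simp add: mult_ac)
        also have "\<dots> = c * (\<Sum>n\<in>I. a n * (E n (t s) * w n $ j))" by (simp add: sum_distrib_left)
        also have "(\<Sum>n\<in>I. a n * (E n (t s) * w n $ j)) = (\<Sum>n\<in>I - J. a n * (E n (t s) * w n $ j))"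
          using I a(2) by (intro sum.mono_neutral_right) auto
        also have "\<dots> = 0" using a(3) that by force
        finally show ?thesis by simp
      qed
      then show ?thesis by (simp add: K_def vec_eq_iff)
    qed
    define N where "N = {n\<in>I. a n \<noteq> 0}"
    have N: "finite N" "N \<noteq> {}" using I a by (auto simp: N_def)
    then obtain n where n: "n \<in> N" "\<And>m. m \<in> N \<Longrightarrow> th m \<le> th n"
      using Max_in[of "th ` N"] Max_ge[of "th ` N"] by fastforce
    have "n \<in> J" unfolding J_def
    proof (intro CollectI conjI bexI[OF _ aK[of "inverse (a n)"]] ballI impI)
      show "n \<in> I" "inverse (a n) * a n = 1" using n by (auto simp: N_def)
      fix m assume "m \<in> I" "th m > th n"
      then show "inverse (a n) * a m = 0" using n(2)[of m] by (auto simp: N_def)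
    qed
    moreover have "n \<notin> J" using a(2) n(1) by (auto simp: N_def)
    ultimately show False by blast
  qed
  have "\<exists>n\<in>J. cdot f (w n) \<noteq> 0" if "f \<noteq> 0" for f
  proof (rule ccontr)
    assume "\<not> ?thesis"
    then have "{n\<in>I. cdot f (w n) \<noteq> 0} \<subseteq> I - J" by blast
    then have "card {n\<in>I. cdot f (w n) \<noteq> 0} \<le> CARD('d) * card S" using cJ I card_mono[of "I - J"] by (meson finite_Diff le_trans)
    moreover have "CARD('d) * card (insert q S) \<le> card {n\<in>I. cdot f (w n) \<noteq> 0}" by (rule insert.prems[OF that])
    ultimately have "CARD('d) * card (insert q S) \<le> CARD('d) * card S" by linarith
    then show False using insert.hyps by simp
  qed
  then obtain B :: "'d \<Rightarrow> 'i" where B: "\<And>j. B j \<in> J" and dB: "det (\<chi> j. w (B j)) \<noteq> 0"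
    using choose_det_nonzero[of J w] by metis
  have "\<forall>j. \<exists>a\<in>K. a (B j) = 1 \<and> (\<forall>m\<in>I. th m > th (B j) \<longrightarrow> a m = 0)" using B by (auto simp: J_def)
  then obtain a where a: "\<And>j. a j \<in> K" "\<And>j. a j (B j) = 1" "\<And>j m. m \<in> I \<Longrightarrow> th m > th (B j) \<Longrightarrow> a j m = 0"
    by metis
  \<comment> \<open>Row \<open>j\<close> is the exponential sum of \<open>a j\<close> at the moving
    point \<open>z\<close>, divided by its leading exponential. At \<open>z = - \<i> * s\<close>
    each lower term is damped by the real factor \<open>exp ((th n - th (B j)) * s)\<close>, so the
    rows tend to the vectors \<open>w (B j)\<close>.\<close>
  define M where "M = (\<lambda>z. \<chi> j. \<Sum>n\<in>I. (a j n * exp (\<i> * of_real (th n - th (B j)) * z)) *s w n)"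
  have hol: "(\<lambda>z. det (M z)) holomorphic_on UNIV"
    by (rule holomorphic_on_det) (simp add: M_def, intro holomorphic_intros)
  have "((\<lambda>s. det (M (- \<i> * of_real s))) \<longlongrightarrow> det (\<chi> j. w (B j))) at_top"
  proof (rule tendsto_det_complex)
    fix j k
    have BI: "B j \<in> I" using B by (auto simp: J_def)
    have "((\<lambda>s. \<Sum>n\<in>I. a j n * exp (\<i> * of_real (th n - th (B j)) * (- \<i> * of_real s)) * w n $ k)
        \<longlongrightarrow> (\<Sum>n\<in>I. if n = B j then w n $ k else 0)) at_top"
    proof (rule tendsto_sum)
      fix n assume n: "n \<in> I"
      have ex: "exp (\<i> * of_real (th n - th (B j)) * (- \<i> * of_real s)) = complex_of_real (exp ((th n - th (B j)) * s))" for s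
        by (simp add: exp_of_real[symmetric] mult_ac flip: mult.assoc)
      consider "n = B j" | "n \<noteq> B j" "th n > th (B j)" | "n \<noteq> B j" "th n < th (B j)"
        using I(2) n BI by (metis inj_on_def linorder_neqE_linordered_idom)
      then show "((\<lambda>s. a j n * exp (\<i> * of_real (th n - th (B j)) * (- \<i> * of_real s)) * w n $ k)
        \<longlongrightarrow> (if n = B j then w n $ k else 0)) at_top"
      proof cases
        case 1 then show ?thesis using a(2) by simp
      next
        case 2 then show ?thesis using a(3) n by simp
      next
        case 3
        have "((\<lambda>s. exp ((th n - th (B j)) * s)) \<longlongrightarrow> 0) at_top"
          using 3 by (intro filterlim_compose[OF exp_at_bot] filterlim_tendsto_neg_mult_at_bot[OF tendsto_const _ filterlim_ident]) auto
        then have "((\<lambda>s. complex_of_real (exp ((th n - th (B j)) * s))) \<longlongrightarrow> 0) at_top"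
          using tendsto_of_real_iff[where c = 0] by fastforce
        then have "((\<lambda>s. a j n * complex_of_real (exp ((th n - th (B j)) * s)) * w n $ k) \<longlongrightarrow> a j n * 0 * w n $ k) at_top"
          by (intro tendsto_intros)
        then show ?thesis unfolding ex using 3 by simp
      qed
    qed
    then show "((\<lambda>s. M (- \<i> * of_real s) $ j $ k) \<longlongrightarrow> (\<chi> j. w (B j)) $ j $ k) at_top"
      using I BI by (simp add: M_def sum.delta)
  qed
  then have "eventually (\<lambda>s. det (M (- \<i> * of_real s)) \<noteq> 0) at_top" using dB by (rule tendsto_imp_eventually_ne)
  then obtain s where "det (M (- \<i> * complex_of_real s)) \<noteq> 0"
    unfolding eventually_at_top_linorder by blast
  then obtain u :: real where u: "det (M (of_real u)) \<noteq> 0" by (rule entire_nonzero_real_point[OF hol])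
  show ?case
  proof (intro exI[of _ "t(q := u)"] allI impI)
    fix f assume H: "\<forall>n\<in>I. (\<Sum>s\<in>insert q S. exp (\<i> * th n * of_real ((t(q := u)) s)) * cdot (f s) (w n)) = 0"
    have ts: "(\<Sum>s\<in>S. E n ((t(q := u)) s) * cdot (f s) (w n)) = (\<Sum>s\<in>S. E n (t s) * cdot (f s) (w n))" for n
      using insert.hyps by (intro sum.cong) auto
    have H': "E n u * cdot (f q) (w n) + (\<Sum>s\<in>S. E n (t s) * cdot (f s) (w n)) = 0" if "n \<in> I" for n
    proof -
      have "(\<Sum>s\<in>insert q S. E n ((t(q := u)) s) * cdot (f s) (w n)) = 0" using H that by (simp add: E_def)
      then have "E n ((t(q := u)) q) * cdot (f q) (w n) + (\<Sum>s\<in>S. E n ((t(q := u)) s) * cdot (f s) (w n)) = 0"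
        unfolding sum.insert[OF insert.hyps] .
      then show ?thesis unfolding ts by simp
    qed
    \<comment> \<open>Combining the equations with coefficients \<open>a j\<close> from
      \<open>K\<close> cancels the earlier points and leaves \<open>f q\<close> orthogonal to every
      row of the nonsingular matrix.\<close>
    have fq: "f q = 0"
    proof -
      have "cdot (f q) (M (of_real u) $ j) = 0" for j
      proof -
        have "cdot (f q) (M (of_real u) $ j) = (\<Sum>n\<in>I. a j n * exp (\<i> * of_real (th n - th (B j)) * of_real u) * cdot (f q) (w n))"
          by (simp add: M_def cdot_sum_right cdot_scale_right)
        also have "\<dots> = (\<Sum>n\<in>I. exp (- (\<i> * th (B j) * of_real u)) * (a j n * (E n u * cdot (f q) (w n))))"
          by (intro sum.cong refl) (simp add: E_def mult_ac exp_add[symmetric] algebra_simps flip: exp_add)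
        also have "\<dots> = exp (- (\<i> * th (B j) * of_real u)) * (\<Sum>n\<in>I. a j n * (E n u * cdot (f q) (w n)))"
          by (simp add: sum_distrib_left)
        also have "(\<Sum>n\<in>I. a j n * (E n u * cdot (f q) (w n))) = (\<Sum>n\<in>I. a j n * - (\<Sum>s\<in>S. E n (t s) * cdot (f s) (w n)))"
          using H' by (intro sum.cong refl arg_cong2[where f = "(*)"]) (simp add: eq_neg_iff_add_eq_0)
        also have "\<dots> = - (\<Sum>s\<in>S. cdot (f s) (\<Sum>n\<in>I. (a j n * E n (t s)) *s w n))"
          by (simp add: cdot_sum_right cdot_scale_right sum_negf sum_distrib_left mult_ac)
             (subst sum.swap, simp)
        also have "\<dots> = 0" using a(1)[of j] by (simp add: K_def)
        finally show ?thesis by simp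
      qed
      then show ?thesis using u unfolding det_nz_of_cdot by blast
    qed
    moreover have "\<forall>s\<in>S. f s = 0" using H' fq by (intro t) simp
    ultimately show "\<forall>s\<in>insert q S. f s = 0" by simp
  qed
qed

section \<open>Separation of trace-free tensors by Beltrami modes\<close>

text \<open>\<open>beltrami0 l x y z u1 u2 u3\<close>: the vector \<open>u\<close> has no component in the polarization line of
  the frequency \<open>(x, y, z)\<close>, i.e. \<open>l\<^sup>2 u - (n \<bullet> u) n = \<i> l (n \<times> u)\<close>.\<close>

definition beltrami0 :: "complex \<Rightarrow> complex \<Rightarrow> complex \<Rightarrow> complex \<Rightarrow> complex \<Rightarrow> complex \<Rightarrow> complex \<Rightarrow> bool" where
  "beltrami0 l x y z u1 u2 u3 \<longleftrightarrow>
     l^2 * u1 - (x * u1 + y * u2 + z * u3) * x = \<i> * l * (y * u3 - z * u2) \<and>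
     l^2 * u2 - (x * u1 + y * u2 + z * u3) * y = \<i> * l * (z * u1 - x * u3) \<and>
     l^2 * u3 - (x * u1 + y * u2 + z * u3) * z = \<i> * l * (x * u2 - y * u1)"

lemma beltrami0_add:
  "beltrami0 l x y z u1 u2 u3 \<Longrightarrow> beltrami0 l x y z v1 v2 v3 \<Longrightarrow> beltrami0 l x y z (u1 + v1) (u2 + v2) (u3 + v3)"
  unfolding beltrami0_def by (simp add: algebra_simps)

lemma beltrami0_scale:
  assumes "beltrami0 l x y z u1 u2 u3" shows "beltrami0 l x y z (c * u1) (c * u2) (c * u3)"
proof -
  have e: "l^2 * (c * u) - (x * (c * u1) + y * (c * u2) + z * (c * u3)) * w = c * (l^2 * u - (x * u1 + y * u2 + z * u3) * w)"
    "\<i> * l * (a * (c * u) - b * (c * u')) = c * (\<i> * l * (a * u - b * u'))" for u w a b u'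
    by (simp_all add: algebra_simps)
  show ?thesis using assms unfolding beltrami0_def e by simp
qed

lemma beltrami0_diff:
  assumes "beltrami0 l x y z u1 u2 u3" "beltrami0 l x y z v1 v2 v3"
  shows "beltrami0 l x y z (u1 - v1) (u2 - v2) (u3 - v3)"
  using beltrami0_add[OF assms(1) beltrami0_scale[OF assms(2), of "-1"]] by simp

lemma beltrami0_cycle: "beltrami0 l x y z u1 u2 u3 \<longleftrightarrow> beltrami0 l y z x u2 u3 u1"
  unfolding beltrami0_def by (auto simp: algebra_simps)

text \<open>Covariance under a quarter turn about the first axis. Together with the cyclic shift it
  generates the rotation group of the cube; rotations, unlike reflections, preserve the cross
  product.\<close>

lemma beltrami0_quarter: "beltrami0 l x y z u1 u2 u3 \<longleftrightarrow> beltrami0 l x (-z) y u1 (-u3) u2"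
  unfolding beltrami0_def by (auto simp: algebra_simps)

lemma of_int_eq_i_times:
  assumes "complex_of_int P = \<i> * complex_of_int Q" shows "Q = 0"
proof -
  have "Im (complex_of_int P) = Im (\<i> * complex_of_int Q)" using assms by simp
  then show ?thesis by simp
qed

text \<open>After division by \<open>c\<close> an integer equals \<open>\<i>\<close> times an
  integer, so both vanish. The imaginary side says that \<open>u\<close> is parallel to the
  frequency.\<close>

lemma beltrami0_real:
  fixes l x y z u1 u2 u3 :: int
  assumes b: "beltrami0 (of_int l) (of_int x) (of_int y) (of_int z) (c * of_int u1) (c * of_int u2) (c * of_int u3)"
    and c: "c \<noteq> 0" and l: "l \<noteq> 0"
  shows "y * u3 = z * u2 \<and> z * u1 = x * u3 \<and> x * u2 = y * u1"
proof -
  have "beltrami0 (of_int l) (of_int x) (of_int y) (of_int z) (of_int u1) (of_int u2) (of_int u3)"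
    using beltrami0_scale[OF b, of "inverse c"] c by (simp flip: mult.assoc)
  then have
    "complex_of_int (l^2 * u1 - (x * u1 + y * u2 + z * u3) * x) = \<i> * complex_of_int (l * (y * u3 - z * u2))"
    "complex_of_int (l^2 * u2 - (x * u1 + y * u2 + z * u3) * y) = \<i> * complex_of_int (l * (z * u1 - x * u3))"
    "complex_of_int (l^2 * u3 - (x * u1 + y * u2 + z * u3) * z) = \<i> * complex_of_int (l * (x * u2 - y * u1))"
    by (simp_all add: beltrami0_def mult.assoc)
  then have "l * (y * u3 - z * u2) = 0" "l * (z * u1 - x * u3) = 0" "l * (x * u2 - y * u1) = 0"
    by (auto dest!: of_int_eq_i_times simp del: of_int_mult of_int_diff of_int_add)
  then show ?thesis using l by simp
qed

section \<open>Matrices invisible to a set of frequencies with cube symmetry\<close>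

definition annihilates :: "int \<Rightarrow> (int \<times> int \<times> int) set \<Rightarrow> complex \<Rightarrow> complex \<Rightarrow> complex \<Rightarrow> complex \<Rightarrow> complex \<Rightarrow> complex \<Rightarrow> complex \<Rightarrow> complex \<Rightarrow> complex \<Rightarrow> bool" where
  "annihilates l U m11 m12 m13 m21 m22 m23 m31 m32 m33 \<longleftrightarrow>
     (\<forall>(x, y, z) \<in> U. beltrami0 (of_int l) (of_int x) (of_int y) (of_int z)
        (m11 * of_int x + m12 * of_int y + m13 * of_int z)
        (m21 * of_int x + m22 * of_int y + m23 * of_int z)
        (m31 * of_int x + m32 * of_int y + m33 * of_int z))"

definition cube_invariant :: "(int \<times> int \<times> int) set \<Rightarrow> bool" where
  "cube_invariant U \<longleftrightarrow> (\<forall>(x, y, z) \<in> U. (y, z, x) \<in> U \<and> (x, -z, y) \<in> U)"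

definition off_axis :: "int \<times> int \<times> int \<Rightarrow> bool" where
  "off_axis = (\<lambda>(x, y, z). (x \<noteq> 0 \<and> y \<noteq> 0) \<or> (y \<noteq> 0 \<and> z \<noteq> 0) \<or> (z \<noteq> 0 \<and> x \<noteq> 0))"

text \<open>Conjugation of the matrix by the cyclic permutation. It transports results about the
  index pair 2, 3 to the other pairs.\<close>

lemma annihilates_cycle:
  assumes "cube_invariant U" "annihilates l U m11 m12 m13 m21 m22 m23 m31 m32 m33"
  shows "annihilates l U m22 m23 m21 m32 m33 m31 m12 m13 m11"
  unfolding annihilates_def
proof clarify
  fix x y z assume "(x, y, z) \<in> U"
  then have "(z, x, y) \<in> U" using assms(1) unfolding cube_invariant_def by blast
  then have "beltrami0 (of_int l) (of_int z) (of_int x) (of_int y)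
        (m11 * of_int z + m12 * of_int x + m13 * of_int y)
        (m21 * of_int z + m22 * of_int x + m23 * of_int y)
        (m31 * of_int z + m32 * of_int x + m33 * of_int y)"
    using assms(2) unfolding annihilates_def by blast
  then show "beltrami0 (of_int l) (of_int x) (of_int y) (of_int z)
        (m22 * of_int x + m23 * of_int y + m21 * of_int z)
        (m32 * of_int x + m33 * of_int y + m31 * of_int z)
        (m12 * of_int x + m13 * of_int y + m11 * of_int z)"
    unfolding beltrami0_cycle[of _ "of_int z"] by (simp add: algebra_simps)
qed

text \<open>Average over the four-group formed by the identity and the half turns about the axes.
  Conjugation multiplies each off-diagonal entry by a nontrivial character; the trivial character
  isolates the diagonal, and one other character isolates \<open>m23\<close> and
  \<open>m32\<close>.\<close>

lemma annihilates_offdiag_diag: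
  assumes inv: "cube_invariant U" and an: "annihilates l U m11 m12 m13 m21 m22 m23 m31 m32 m33"
    and n: "(x, y, z) \<in> U"
  shows "beltrami0 (of_int l) (of_int x) (of_int y) (of_int z) (m11 * of_int x) (m22 * of_int y) (m33 * of_int z)" (is ?A)
    and "beltrami0 (of_int l) (of_int x) (of_int y) (of_int z) 0 (m23 * of_int z) (m32 * of_int y)" (is ?B)
proof -
  have R: "(x, -y, -z) \<in> U" if "(x, y, z) \<in> U" for x y z
  proof -
    have "(x, -z, y) \<in> U" using that inv unfolding cube_invariant_def by blast
    then show ?thesis using inv unfolding cube_invariant_def by blast
  qed
  have C: "(y, z, x) \<in> U" if "(x, y, z) \<in> U" for x y z using that inv unfolding cube_invariant_def by blast
  have D: "(x, -y, -z) \<in> U" "(-x, y, -z) \<in> U" "(-x, -y, z) \<in> U"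
    using R[OF n] C[OF C[OF R[OF C[OF n]]]] C[OF R[OF C[OF C[OF n]]]] by auto
  have neg: "beltrami0 l x (-y) (-z) u1 u2 u3 \<Longrightarrow> beltrami0 l x y z u1 (-u2) (-u3)"
    "beltrami0 l (-x) y (-z) u1 u2 u3 \<Longrightarrow> beltrami0 l x y z (-u1) u2 (-u3)"
    "beltrami0 l (-x) (-y) z u1 u2 u3 \<Longrightarrow> beltrami0 l x y z (-u1) (-u2) u3" for l x y z u1 u2 u3
    unfolding beltrami0_def by (auto simp: algebra_simps)
  let ?b = "beltrami0 (of_int l) (of_int x) (of_int y) (of_int z)"
  note an' = an[unfolded annihilates_def, THEN bspec]
  have 0: "?b (m11 * of_int x + m12 * of_int y + m13 * of_int z) (m21 * of_int x + m22 * of_int y + m23 * of_int z) (m31 * of_int x + m32 * of_int y + m33 * of_int z)"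
    using an'[OF n] by simp
  have 1: "?b (m11 * of_int x - m12 * of_int y - m13 * of_int z) (- m21 * of_int x + m22 * of_int y + m23 * of_int z) (- m31 * of_int x + m32 * of_int y + m33 * of_int z)"
    using neg(1)[OF an'[OF D(1), simplified]] by (simp add: algebra_simps)
  have 2: "?b (m11 * of_int x - m12 * of_int y + m13 * of_int z) (- m21 * of_int x + m22 * of_int y - m23 * of_int z) (m31 * of_int x - m32 * of_int y + m33 * of_int z)"
    using neg(2)[OF an'[OF D(2), simplified]] by (simp add: algebra_simps)
  have 3: "?b (m11 * of_int x + m12 * of_int y - m13 * of_int z) (m21 * of_int x + m22 * of_int y - m23 * of_int z) (- m31 * of_int x - m32 * of_int y + m33 * of_int z)"
    using neg(3)[OF an'[OF D(3), simplified]] by (simp add: algebra_simps)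
  show ?A using beltrami0_scale[OF beltrami0_add[OF beltrami0_add[OF 0 1] beltrami0_add[OF 2 3]], of "1/4"]
    by (simp add: algebra_simps)
  show ?B using beltrami0_scale[OF beltrami0_diff[OF beltrami0_add[OF 0 1] beltrami0_add[OF 2 3]], of "1/4"]
    by (simp add: algebra_simps)
qed

context
  fixes U :: "(int \<times> int \<times> int) set" and l x y z :: int
  assumes inv: "cube_invariant U" and l: "odd l" and n: "(x, y, z) \<in> U" "off_axis (x, y, z)" "(x, y, z) \<in> int_sphere l"
begin

text \<open>The quarter turn exchanges \<open>m23\<close> and \<open>m32\<close> up to sign, so
  their difference and sum can be tested separately. Unless they vanish, the integer vectors
  \<open>(0, z, -y)\<close> and \<open>(0, z, y)\<close>, respectively, have to be parallel to the
  frequency.\<close>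

lemma annihilates_23:
  assumes an: "annihilates l U m11 m12 m13 m21 m22 m23 m31 m32 m33"
  shows "m23 = 0 \<and> m32 = 0"
proof -
  let ?b = "beltrami0 (of_int l) (of_int x) (of_int y) (of_int z)"
  have l0: "l \<noteq> 0" using l by auto
  have 1: "?b 0 (m23 * of_int z) (m32 * of_int y)" by (rule annihilates_offdiag_diag(2)[OF inv an n(1)])
  have "(x, -z, y) \<in> U" using n inv unfolding cube_invariant_def by blast
  from annihilates_offdiag_diag(2)[OF inv an this]
  have "?b 0 (- (m32 * of_int z)) (- (m23 * of_int y))"
    unfolding beltrami0_quarter[of _ "of_int x" "of_int y" "of_int z"] by simp
  note 2 = beltrami0_scale[OF this, of "-1"]
  have 3: "?b ((m23 - m32) * of_int 0) ((m23 - m32) * of_int z) ((m23 - m32) * of_int (- y))"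
    using beltrami0_diff[OF 1 2] by (simp add: algebra_simps)
  have 4: "?b ((m23 + m32) * of_int 0) ((m23 + m32) * of_int z) ((m23 + m32) * of_int y)"
    using beltrami0_add[OF 1 2] by (simp add: algebra_simps)
  have "m23 - m32 = 0"
  proof (rule ccontr)
    assume "m23 - m32 \<noteq> 0"
    from beltrami0_real[OF 3 this l0] have "y * (- y) = z * z" by blast
    then have "y * y + z * z = 0" by linarith
    then have "y = 0 \<and> z = 0" by (simp only: sum_squares_eq_zero_iff)
    then show False using n(2) by (simp add: off_axis_def)
  qed
  moreover have "m23 + m32 = 0"
  proof (rule ccontr)
    assume "m23 + m32 \<noteq> 0"
    from beltrami0_real[OF 4 this l0] have e: "y * y = z * z" "x * y = 0" "x * z = 0" by simp_all
    show False
    proof (cases "x = 0")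
      case True
      then have "l^2 = 2 * (y * y)" using n(3) e by (simp add: int_sphere_def power2_eq_square)
      then have "even (l^2)" by simp
      then show False using l by simp
    next
      case False
      then show False using e n(2) by (simp add: off_axis_def)
    qed
  qed
  ultimately have "m23 = m32" "m32 + m32 = 0" by auto
  then show ?thesis by (simp flip: mult_2)
qed

text \<open>Comparison of the diagonal part with its quarter turn leaves \<open>m22 - m33\<close>
  times the vector \<open>(0, y, -z)\<close>, which is not parallel to an off-axis
  frequency.\<close>

lemma annihilates_diag:
  assumes an: "annihilates l U m11 m12 m13 m21 m22 m23 m31 m32 m33"
  shows "m22 = m33"
proof -
  let ?b = "beltrami0 (of_int l) (of_int x) (of_int y) (of_int z)"
  have l0: "l \<noteq> 0" using l by auto
  have 1: "?b (m11 * of_int x) (m22 * of_int y) (m33 * of_int z)" by (rule annihilates_offdiag_diag(1)[OF inv an n(1)])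
  have "(x, -z, y) \<in> U" using n inv unfolding cube_invariant_def by blast
  from annihilates_offdiag_diag(1)[OF inv an this]
  have 2: "?b (m11 * of_int x) (m33 * of_int y) (m22 * of_int z)"
    unfolding beltrami0_quarter[of _ "of_int x" "of_int y" "of_int z"] by simp
  have 3: "?b ((m22 - m33) * of_int 0) ((m22 - m33) * of_int y) ((m22 - m33) * of_int (- z))"
    using beltrami0_diff[OF 1 2] by (simp add: algebra_simps)
  show ?thesis
  proof (rule ccontr)
    assume "m22 \<noteq> m33"
    then have "m22 - m33 \<noteq> 0" by simp
    from beltrami0_real[OF 3 this l0] have "- (y * z) = z * y" "x * z = 0" "x * y = 0" by simp_all
    then show False using n(2) by (auto simp: off_axis_def)
  qed
qed

text \<open>Only multiples of the identity remain. These really are invisible, since a frequency is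
  orthogonal to its own polarizations; the trace condition removes them.\<close>

lemma annihilates_tracefree:
  assumes an: "annihilates l U m11 m12 m13 m21 m22 m23 m31 m32 m33" and tr: "m11 + m22 + m33 = 0"
  shows "m11 = 0 \<and> m12 = 0 \<and> m13 = 0 \<and> m21 = 0 \<and> m22 = 0 \<and> m23 = 0 \<and> m31 = 0 \<and> m32 = 0 \<and> m33 = 0"
proof -
  note c1 = annihilates_cycle[OF inv an]
  note c2 = annihilates_cycle[OF inv c1]
  have "m22 = m33" "m33 = m11" using annihilates_diag[OF an] annihilates_diag[OF c1] by auto
  then have "3 * m11 = 0" using tr by simp
  then show ?thesis using \<open>m22 = m33\<close> \<open>m33 = m11\<close> annihilates_23[OF an] annihilates_23[OF c1] annihilates_23[OF c2] by simp
qed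

end

text \<open>For \<open>n = (x, y, z)\<close> of length \<open>l\<close> this is
  \<open>l^2 e1 - x n + \<i> l (n \<times> e1)\<close>, a vector \<open>P\<close> with
  \<open>\<i> n \<times> P = l P\<close>: the amplitude of a curl eigenfield with phase
  \<open>exp (\<i> (n \<bullet> v))\<close>. It vanishes exactly when \<open>n\<close> lies on the
  first axis.\<close>

definition polarization :: "int \<Rightarrow> int \<times> int \<times> int \<Rightarrow> complex ^ 3" where
  "polarization l = (\<lambda>(x, y, z). vector [of_int (l^2 - x^2),
     - of_int (x * y) + \<i> * of_int (l * z), - of_int (x * z) - \<i> * of_int (l * y)])"

definition vec_of_triple :: "int \<times> int \<times> int \<Rightarrow> real ^ 3" where
  "vec_of_triple = (\<lambda>(x, y, z). vector [of_int x, of_int y, of_int z])"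

definition mode_tensor :: "int \<Rightarrow> int \<times> int \<times> int \<Rightarrow> complex ^ (3 \<times> 3)" where
  "mode_tensor l n = (\<chi> p. polarization l n $ fst p * of_real (vec_of_triple n $ snd p))"

lemma sum_UNIV_prod: "(\<Sum>p\<in>UNIV. g p) = (\<Sum>i\<in>UNIV. \<Sum>j\<in>UNIV. g (i, j))"
  by (simp add: sum.cartesian_product)

text \<open>With \<open>v = f n\<close> and \<open>P\<close> the polarization of \<open>n\<close>,
  the hypothesis is the single equation \<open>P \<bullet> v = 0\<close>, the first of the three to
  be proved. The defect vector \<open>(z1, z2, z3)\<close> is orthogonal to \<open>n\<close> and an
  eigenvector of \<open>n \<times>\<close>; the space of such vectors is a line, and off the axis
  the first coordinate is injective on it.\<close>

lemma cdot_mode_tensor_eq_0: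
  fixes f :: "complex ^ (3 \<times> 3)"
  assumes l: "(x, y, z) \<in> int_sphere l" "off_axis (x, y, z)" and 0: "cdot f (mode_tensor l (x, y, z)) = 0"
  shows "beltrami0 (of_int l) (of_int x) (of_int y) (of_int z)
        (f $ (1,1) * of_int x + f $ (1,2) * of_int y + f $ (1,3) * of_int z)
        (f $ (2,1) * of_int x + f $ (2,2) * of_int y + f $ (2,3) * of_int z)
        (f $ (3,1) * of_int x + f $ (3,2) * of_int y + f $ (3,3) * of_int z)"
proof -
  define v1 v2 v3 X Y Z L where
    "v1 = f $ (1,1) * of_int x + f $ (1,2) * of_int y + f $ (1,3) * of_int z"
    "v2 = f $ (2,1) * of_int x + f $ (2,2) * of_int y + f $ (2,3) * of_int z"
    "v3 = f $ (3,1) * of_int x + f $ (3,2) * of_int y + f $ (3,3) * of_int z"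
    "X = complex_of_int x" "Y = complex_of_int y" "Z = complex_of_int z" "L = complex_of_int l"
  note df = this
  have "cdot f (mode_tensor l (x, y, z)) = (L^2 - X^2) * v1 + (- X * Y + \<i> * L * Z) * v2 + (- X * Z - \<i> * L * Y) * v3"
    by (simp add: cdot_def mode_tensor_def polarization_def vec_of_triple_def sum_UNIV_prod sum_3 df algebra_simps)
  then have e: "(L^2 - X^2) * v1 + (- X * Y + \<i> * L * Z) * v2 + (- X * Z - \<i> * L * Y) * v3 = 0" using 0 by simp
  have sph: "X^2 + Y^2 + Z^2 = L^2"
    using arg_cong[OF l(1)[unfolded int_sphere_def, simplified], of complex_of_int] by (simp add: df)
  define s z1 z2 z3 where "s = X * v1 + Y * v2 + Z * v3"
    "z1 = L^2 * v1 - s * X - \<i> * L * (Y * v3 - Z * v2)"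
    "z2 = L^2 * v2 - s * Y - \<i> * L * (Z * v1 - X * v3)"
    "z3 = L^2 * v3 - s * Z - \<i> * L * (X * v2 - Y * v1)"
  note dz = this
  have z1: "z1 = 0" using e by (simp add: dz algebra_simps power2_eq_square)
  have "X * z1 + Y * z2 + Z * z3 = s * (L^2 - (X^2 + Y^2 + Z^2))"
    by (simp add: dz algebra_simps power2_eq_square)
  then have p1: "Y * z2 + Z * z3 = 0" using z1 sph by simp
  \<comment> \<open>First component of the eigenvector equation
    \<open>n \<times> z = \<i> L z\<close> for the defect.\<close>
  have "Y * z3 - Z * z2 - \<i> * L * z1 = \<i> * L * X * (s - s) + \<i> * L * v1 * (Y^2 + Z^2 + X^2 - L^2)"
    by (simp add: dz algebra_simps power2_eq_square)
  moreover have "Y^2 + Z^2 + X^2 - L^2 = 0" using sph by (simp add: algebra_simps)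
  ultimately have p2: "Y * z3 - Z * z2 = 0" using z1 by simp
  have "(Y^2 + Z^2) * z2 = Y * (Y * z2 + Z * z3) - Z * (Y * z3 - Z * z2)"
    by (simp add: algebra_simps power2_eq_square)
  then have q2: "(Y^2 + Z^2) * z2 = 0" using p1 p2 by simp
  have "(Y^2 + Z^2) * z3 = Z * (Y * z2 + Z * z3) + Y * (Y * z3 - Z * z2)"
    by (simp add: algebra_simps power2_eq_square)
  then have q3: "(Y^2 + Z^2) * z3 = 0" using p1 p2 by simp
  have "y^2 + z^2 \<noteq> 0" using l(2) by (auto simp: off_axis_def sum_power2_eq_zero_iff)
  moreover have "Y^2 + Z^2 = of_int (y^2 + z^2)" by (simp add: df)
  ultimately have "Y^2 + Z^2 \<noteq> 0" by (simp only: of_int_eq_0_iff not_False_eq_True)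
  then have "z2 = 0" "z3 = 0" using q2 q3 by auto
  then have "beltrami0 L X Y Z v1 v2 v3" using z1 unfolding dz beltrami0_def by auto
  then show ?thesis unfolding df .
qed

section \<open>Orbits of frequencies and counting of visible frequencies\<close>

definition cube_orbit :: "int \<times> int \<times> int \<Rightarrow> (int \<times> int \<times> int) set" where
  "cube_orbit = (\<lambda>(x, y, z). {(u, v, w).
     (\<bar>u\<bar> = \<bar>x\<bar> \<and> \<bar>v\<bar> = \<bar>y\<bar> \<and> \<bar>w\<bar> = \<bar>z\<bar>) \<or> (\<bar>u\<bar> = \<bar>y\<bar> \<and> \<bar>v\<bar> = \<bar>z\<bar> \<and> \<bar>w\<bar> = \<bar>x\<bar>) \<or>
     (\<bar>u\<bar> = \<bar>z\<bar> \<and> \<bar>v\<bar> = \<bar>x\<bar> \<and> \<bar>w\<bar> = \<bar>y\<bar>) \<or> (\<bar>u\<bar> = \<bar>x\<bar> \<and> \<bar>v\<bar> = \<bar>z\<bar> \<and> \<bar>w\<bar> = \<bar>y\<bar>) \<or>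
     (\<bar>u\<bar> = \<bar>z\<bar> \<and> \<bar>v\<bar> = \<bar>y\<bar> \<and> \<bar>w\<bar> = \<bar>x\<bar>) \<or> (\<bar>u\<bar> = \<bar>y\<bar> \<and> \<bar>v\<bar> = \<bar>x\<bar> \<and> \<bar>w\<bar> = \<bar>z\<bar>)})"

lemma cube_orbit_self: "n \<in> cube_orbit n"
  by (cases n) (simp add: cube_orbit_def)

lemma cube_invariant_orbit: "cube_invariant (cube_orbit n)"
  by (cases n) (auto simp: cube_invariant_def cube_orbit_def)

lemma cube_orbit_sphere:
  assumes "n \<in> int_sphere l" "m \<in> cube_orbit n" shows "m \<in> int_sphere l"
proof -
  have e: "u^2 = v^2" if "\<bar>u\<bar> = \<bar>v\<bar>" for u v :: int using that by (metis power2_abs)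
  obtain x y z where n: "n = (x, y, z)" by (metis prod.exhaust)
  obtain u v w where m: "m = (u, v, w)" by (metis prod.exhaust)
  have "u^2 + v^2 + w^2 = x^2 + y^2 + z^2"
    using assms(2) unfolding n m cube_orbit_def by (auto dest!: e)
  then show ?thesis using assms(1) by (simp add: n m int_sphere_def)
qed

lemma cube_orbit_off_axis: "off_axis n \<Longrightarrow> m \<in> cube_orbit n \<Longrightarrow> off_axis m"
  by (cases n; cases m) (auto simp: cube_orbit_def off_axis_def)

definition signed_entries :: "int \<times> int \<times> int \<Rightarrow> int set" where
  "signed_entries = (\<lambda>(x, y, z). {t. \<bar>t\<bar> = \<bar>x\<bar> \<or> \<bar>t\<bar> = \<bar>y\<bar> \<or> \<bar>t\<bar> = \<bar>z\<bar>})"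

text \<open>Bounds the number of frequencies whose orbits can share the point \<open>m\<close>: each
  of their three coordinates is one of at most six signed entries.\<close>

lemma cube_orbit_sym: "m \<in> cube_orbit n \<Longrightarrow> n \<in> signed_entries m \<times> signed_entries m \<times> signed_entries m"
  by (cases n; cases m) (simp add: cube_orbit_def signed_entries_def, metis)

lemma card_signed_entries: "finite (signed_entries m)" "card (signed_entries m) \<le> 6"
proof -
  obtain x y z where m: "m = (x, y, z)" by (metis prod.exhaust)
  have e: "signed_entries m = set [x, -x, y, -y, z, -z]" by (auto simp: m signed_entries_def abs_eq_iff)
  show "finite (signed_entries m)" unfolding e by simp
  show "card (signed_entries m) \<le> 6" unfolding e by (rule order_trans[OF card_length]) simp
qed

definition off_axis_sphere :: "int \<Rightarrow> (int \<times> int \<times> int) set" where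
  "off_axis_sphere l = {n \<in> int_sphere l. off_axis n}"

lemma finite_off_axis_sphere: "finite (off_axis_sphere l)"
  by (simp add: off_axis_sphere_def finite_int_sphere)

lemma card_off_axis_sphere: "card (int_sphere l) \<le> card (off_axis_sphere l) + 6"
proof -
  define A where "A = set [(l, 0, 0), (-l, 0, 0), (0, l, 0), (0, -l, 0), (0, 0, l), (0, 0, -l :: int)]"
  have "int_sphere l \<subseteq> off_axis_sphere l \<union> A"
    by (auto simp: off_axis_sphere_def int_sphere_def off_axis_def A_def power2_eq_iff)
  then have "card (int_sphere l) \<le> card (off_axis_sphere l \<union> A)"
    by (intro card_mono) (auto simp: finite_off_axis_sphere A_def)
  also have "\<dots> \<le> card (off_axis_sphere l) + card A" by (rule card_Un_le)
  also have "card A \<le> 6" unfolding A_def by (rule order_trans[OF card_length]) simp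
  finally show ?thesis by simp
qed

text \<open>Each off-axis orbit contains a frequency seen by \<open>f\<close>, for otherwise
  \<open>f\<close> would annihilate an invariant set. Sending a frequency to such an orbit point has
  fibres of size at most \<open>6 ^ 3\<close>.\<close>

lemma misses_lower_bound:
  fixes f :: "complex ^ (3 \<times> 3)"
  assumes l: "odd l" and f: "f \<noteq> 0" and tr: "f $ (1,1) + f $ (2,2) + f $ (3,3) = 0"
  shows "card (off_axis_sphere l) \<le> 216 * card {n \<in> off_axis_sphere l. cdot f (mode_tensor l n) \<noteq> 0}"
proof -
  define Y where "Y = {n \<in> off_axis_sphere l. cdot f (mode_tensor l n) \<noteq> 0}"
  define C where "C = (\<lambda>m. signed_entries m \<times> signed_entries m \<times> signed_entries m)"
  have "off_axis_sphere l \<subseteq> (\<Union>m\<in>Y. C m)"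
  proof
    fix n assume n: "n \<in> off_axis_sphere l"
    obtain x y z where xyz: "n = (x, y, z)" by (metis prod.exhaust)
    have "\<exists>m\<in>cube_orbit n. cdot f (mode_tensor l m) \<noteq> 0"
    proof (rule ccontr)
      assume neg: "\<not> ?thesis"
      have "annihilates l (cube_orbit n) (f $ (1,1)) (f $ (1,2)) (f $ (1,3)) (f $ (2,1)) (f $ (2,2)) (f $ (2,3)) (f $ (3,1)) (f $ (3,2)) (f $ (3,3))"
        unfolding annihilates_def
      proof clarify
        fix u v w assume m: "(u, v, w) \<in> cube_orbit n"
        show "beltrami0 (of_int l) (of_int u) (of_int v) (of_int w)
          (f $ (1,1) * of_int u + f $ (1,2) * of_int v + f $ (1,3) * of_int w)
          (f $ (2,1) * of_int u + f $ (2,2) * of_int v + f $ (2,3) * of_int w)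
          (f $ (3,1) * of_int u + f $ (3,2) * of_int v + f $ (3,3) * of_int w)"
          using cube_orbit_sphere[OF _ m] cube_orbit_off_axis[OF _ m] n m neg
          by (intro cdot_mode_tensor_eq_0) (auto simp: off_axis_sphere_def)
      qed
      from annihilates_tracefree[OF cube_invariant_orbit l _ _ _ this tr, of x y z]
      have "f $ p = 0" for p
        using n cube_orbit_self[of n] exhaust_3[of "fst p"] exhaust_3[of "snd p"] unfolding xyz off_axis_sphere_def
        by (cases p) auto
      then show False using f by (simp add: vec_eq_iff)
    qed
    then obtain m where m: "m \<in> cube_orbit n" "cdot f (mode_tensor l m) \<noteq> 0" by blast
    have "m \<in> Y" using m n cube_orbit_sphere[OF _ m(1)] cube_orbit_off_axis[OF _ m(1)]
      by (auto simp: Y_def off_axis_sphere_def)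
    moreover have "n \<in> C m" using cube_orbit_sym[OF m(1)] by (simp add: C_def)
    ultimately show "n \<in> (\<Union>m\<in>Y. C m)" by blast
  qed
  moreover have fY: "finite Y" by (simp add: Y_def finite_off_axis_sphere)
  ultimately have "card (off_axis_sphere l) \<le> card (\<Union>m\<in>Y. C m)"
    by (intro card_mono) (auto simp: C_def card_signed_entries)
  also have "\<dots> \<le> (\<Sum>m\<in>Y. card (C m))" using fY by (rule card_UN_le)
  also have "\<dots> \<le> (\<Sum>m\<in>Y. 216)"
  proof (rule sum_mono)
    fix m
    have "card (C m) = card (signed_entries m) * (card (signed_entries m) * card (signed_entries m))"
      by (simp add: C_def card_cartesian_product)
    also have "\<dots> \<le> 6 * (6 * 6)" by (intro mult_mono card_signed_entries) auto
    finally show "card (C m) \<le> 216" by simp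
  qed
  finally show ?thesis by (simp add: Y_def mult.commute)
qed

section \<open>The torus and its covering map\<close>

lemma circ_add: "circ a + circ b = circ (a + b)"
  by (rule plus_circle.abs_eq)

lemma circ_rep: "circ (rep_circle x) = x"
  by (rule Quotient_abs_rep[OF Quotient_circle])

lemma circ_periodic: "circ (a + 2 * pi * of_int k) = circ a"
  by (auto simp: circ_eq_iff intro!: exI[of _ "-k"])

lemma bdd_below_circle_dists: "bdd_below {\<bar>a - b\<bar> | a b. circ a = x \<and> circ b = y}"
  by (rule bdd_belowI[of _ 0]) auto

lemma dist_circ_le: "dist (circ a) (circ b) \<le> \<bar>a - b\<bar>"
  unfolding dist_circle_def by (rule cInf_lower[OF _ bdd_below_circle_dists]) blast

text \<open>The infimum may be nearly attained at another lift of \<open>circ a\<close>; translating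
  both lifts by a common period returns to \<open>a\<close>.\<close>

lemma dist_circle_lift:
  assumes "dist (circ a) y < e" obtains b where "circ b = y" "\<bar>a - b\<bar> < e"
proof -
  have "{\<bar>a' - b\<bar> | a' b. circ a' = circ a \<and> circ b = y} \<noteq> {}" using circ_surj[of y] by blast
  from cInf_lessD[OF this assms[unfolded dist_circle_def]]
  obtain a' b' where h: "circ a' = circ a" "circ b' = y" "\<bar>a' - b'\<bar> < e" by blast
  from h(1) obtain n :: int where n: "a = a' + of_int n * (2 * pi)" unfolding circ_eq_iff by blast
  show ?thesis
  proof (rule that[of "b' + of_int n * (2 * pi)"])
    show "circ (b' + of_int n * (2 * pi)) = y" using circ_periodic[of b' n] h(2) by (simp add: mult.commute)
    show "\<bar>a - (b' + of_int n * (2 * pi))\<bar> < e" using n h(3) by simp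
  qed
qed

lemma tproj_add: "tproj v + tproj w = tproj (v + w)"
  by (simp add: tproj_def vec_eq_iff circ_add)

lemma tprojs_add: "tprojs v + tprojs w = tprojs (v + w)"
  by (simp add: tprojs_def vec_eq_iff tproj_add)

lemma tproj_surj: "\<exists>v. tproj v = p"
  by (rule exI[of _ "\<chi> i. rep_circle (p $ i)"]) (simp add: tproj_def vec_eq_iff circ_rep)

lemma tprojs_surj: "\<exists>u. tprojs u = x"
proof -
  have "\<forall>l. \<exists>v. tproj v = x $ l" using tproj_surj by blast
  then obtain f where "\<forall>l. tproj (f l) = x $ l" by metis
  then show ?thesis by (intro exI[of _ "\<chi> l. f l"]) (simp add: tprojs_def vec_eq_iff)
qed

lemma tprojs_nth: "tprojs u $ l = tproj (u $ l)"
  by (simp add: tprojs_def)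

lemma dist_tproj_le: "dist (tproj v) (tproj w) \<le> dist v w"
  unfolding dist_vec_def tproj_def by (intro L2_set_mono) (auto simp: dist_real_def intro: dist_circ_le)

lemma dist_tprojs_le: "dist (tprojs v) (tprojs w) \<le> dist v w"
  unfolding dist_vec_def[of "tprojs v" "tprojs w"] dist_vec_def[of v w] tprojs_nth by (intro L2_set_mono) (auto intro: dist_tproj_le)

lemma continuous_on_1_lipschitz:
  assumes "\<And>x y. dist (f x) (f y) \<le> dist x y" shows "continuous_on S f"
  unfolding continuous_on_iff using assms by (meson le_less_trans)

lemma continuous_on_tproj: "continuous_on S tproj"
  by (rule continuous_on_1_lipschitz) (rule dist_tproj_le)

lemma continuous_on_tprojs: "continuous_on S tprojs"
  by (rule continuous_on_1_lipschitz) (rule dist_tprojs_le)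

definition period_box :: "(real ^ 3) set" where
  "period_box = cbox 0 (\<chi> i. 2 * pi)"

lemma mem_period_box: "v \<in> period_box \<longleftrightarrow> (\<forall>i. 0 \<le> v $ i \<and> v $ i \<le> 2 * pi)"
  by (auto simp: period_box_def mem_box_cart)

lemma circ_in_period: obtains a where "circ a = x" "0 \<le> a" "a \<le> 2 * pi"
proof -
  obtain b where b: "circ b = x" using circ_surj by blast
  define k where "k = - \<lfloor>b / (2 * pi)\<rfloor>"
  have "circ (b + 2 * pi * of_int k) = x" using b circ_periodic by simp
  moreover have "of_int \<lfloor>b / (2 * pi)\<rfloor> \<le> b / (2 * pi)" "b / (2 * pi) \<le> of_int \<lfloor>b / (2 * pi)\<rfloor> + 1" by linarith+
  then have "of_int \<lfloor>b / (2 * pi)\<rfloor> * (2 * pi) \<le> b" "b \<le> (of_int \<lfloor>b / (2 * pi)\<rfloor> + 1) * (2 * pi)"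
    by (simp_all only: pos_le_divide_eq pos_divide_le_eq pi_gt_zero zero_less_mult_iff zero_less_numeral simp_thms)
  then have "0 \<le> b + 2 * pi * of_int k" "b + 2 * pi * of_int k \<le> 2 * pi"
    by (simp_all add: k_def algebra_simps)
  ultimately show ?thesis using that by blast
qed

lemma tproj_period_box: "tproj ` period_box = UNIV"
proof -
  have "p \<in> tproj ` period_box" for p
  proof -
    have "\<forall>i. \<exists>a. circ a = p $ i \<and> 0 \<le> a \<and> a \<le> 2 * pi" using circ_in_period by metis
    then obtain f where f: "\<And>i. circ (f i) = p $ i \<and> 0 \<le> f i \<and> f i \<le> 2 * pi" by metis
    show ?thesis
      by (rule image_eqI[of _ _ "\<chi> i. f i"]) (use f in \<open>auto simp: mem_period_box tproj_def vec_eq_iff\<close>)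
  qed
  then show ?thesis by blast
qed

lemma compact_torus: "compact (UNIV :: torus3 set)"
  unfolding tproj_period_box[symmetric]
  by (rule compact_continuous_image[OF continuous_on_tproj]) (simp add: period_box_def)

lemma dist_torus_lift:
  assumes "\<And>i. dist (tproj v $ i) (q $ i) < e"
  obtains w where "tproj w = q" "dist v w \<le> 3 * e"
proof -
  have "\<forall>i. \<exists>b. circ b = q $ i \<and> \<bar>v $ i - b\<bar> < e"
    using assms dist_circle_lift by (simp add: tproj_def) metis
  then obtain f where f: "\<And>i. circ (f i) = q $ i \<and> \<bar>v $ i - f i\<bar> < e" by metis
  have "dist v (\<chi> i. f i) \<le> (\<Sum>i\<in>UNIV. \<bar>v $ i - f i\<bar>)"
    unfolding dist_vec_def by (rule order_trans[OF L2_set_le_sum]) (auto simp: dist_real_def)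
  also have "\<dots> \<le> (\<Sum>i\<in>(UNIV::3 set). e)" by (rule sum_mono) (use f less_imp_le in blast)
  finally show ?thesis using f by (intro that[of "\<chi> i. f i"]) (auto simp: tproj_def vec_eq_iff)
qed

text \<open>Nearby torus points have nearby lifts. Lifting coordinate by coordinate loses at most
  the factor 3, which the choice \<open>d / 4\<close> absorbs.\<close>

lemma continuous_on_torus:
  assumes "continuous_on UNIV (\<lambda>v. g (tproj v))" shows "continuous_on UNIV (g :: torus3 \<Rightarrow> 'b::metric_space)"
  unfolding continuous_on_iff
proof (intro ballI allI impI)
  fix p and e :: real assume e: "e > 0"
  obtain v where v: "tproj v = p" using tproj_surj by blast
  obtain d where d: "d > 0" "\<And>w. dist w v < d \<Longrightarrow> dist (g (tproj w)) (g (tproj v)) < e"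
    using assms e unfolding continuous_on_iff by (metis UNIV_I)
  show "\<exists>d>0. \<forall>q\<in>UNIV. dist q p < d \<longrightarrow> dist (g q) (g p) < e"
  proof (intro exI[of _ "d / 4"] conjI ballI impI)
    fix q assume q: "dist q p < d / 4"
    have "dist (tproj v $ i) (q $ i) < d / 4" for i
      using dist_vec_nth_le[of p i q] q v by (simp add: dist_commute)
    then obtain w where w: "tproj w = q" "dist v w \<le> 3 * (d / 4)" by (rule dist_torus_lift)
    then show "dist (g q) (g p) < e" using d(2)[of w] d(1) v by (simp add: dist_commute)
  qed (use d in auto)
qed

definition periodic3 :: "(real ^ 3 \<Rightarrow> 'b) \<Rightarrow> bool" where
  "periodic3 G \<longleftrightarrow> (\<forall>v k. G (v + (\<chi> i. 2 * pi * of_int (k i))) = G v)"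

lemma periodic3_tproj: "periodic3 (\<lambda>v. g (tproj v))"
proof -
  have "tproj (v + (\<chi> i. 2 * pi * of_int (k i))) = tproj v" for v k
    by (simp add: tproj_def vec_eq_iff circ_periodic)
  then show ?thesis by (simp add: periodic3_def)
qed

text \<open>Evaluation at chosen representatives; for periodic \<open>G\<close> the choice is
  immaterial.\<close>

definition descend :: "(real ^ 3 \<Rightarrow> 'b) \<Rightarrow> torus3 \<Rightarrow> 'b" where
  "descend G p = G (\<chi> i. rep_circle (p $ i))"

lemma descend_tproj:
  assumes "periodic3 G" shows "descend G (tproj v) = G v"
proof -
  have "\<forall>i. \<exists>n::int. rep_circle (circ (v $ i)) = v $ i + of_int n * (2 * pi)"
    unfolding circ_eq_iff[symmetric] by (simp add: circ_rep)
  then obtain k :: "3 \<Rightarrow> int" where k: "\<And>i. rep_circle (circ (v $ i)) = v $ i + of_int (k i) * (2 * pi)" by metis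
  have "(\<chi> i. rep_circle (tproj v $ i)) = v + (\<chi> i. 2 * pi * of_int (k i))"
    by (simp add: vec_eq_iff tproj_def k mult.commute)
  then show ?thesis using assms by (simp add: descend_def periodic3_def)
qed

lemma open_Conf: "open (Conf :: (torus3 ^ 'k) set)"
proof -
  have "open {x :: torus3 ^ 'k. i \<noteq> j \<longrightarrow> x $ i \<noteq> x $ j}" for i j
    by (cases "i = j") (auto intro!: open_Collect_neq continuous_intros)
  then have "open (\<Inter>i. \<Inter>j. {x :: torus3 ^ 'k. i \<noteq> j \<longrightarrow> x $ i \<noteq> x $ j})"
    by (intro open_INT) auto
  also have "(\<Inter>i. \<Inter>j. {x :: torus3 ^ 'k. i \<noteq> j \<longrightarrow> x $ i \<noteq> x $ j}) = Conf" by (auto simp: Conf_def)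
  finally show ?thesis .
qed

section \<open>Multivariate power series\<close>

text \<open>Absolute convergence in each variable makes the product series over multi-indices
  converge unconditionally, as analyticity demands.\<close>

lemma has_sum_prod_PiE:
  fixes f :: "'a \<Rightarrow> nat \<Rightarrow> complex"
  assumes A: "finite A" and s: "\<And>x. x \<in> A \<Longrightarrow> (f x has_sum s x) UNIV" and abs: "\<And>x. x \<in> A \<Longrightarrow> (\<lambda>n. norm (f x n)) summable_on UNIV"
  shows "((\<lambda>g. \<Prod>x\<in>A. f x (g x)) has_sum (\<Prod>x\<in>A. s x)) (A \<rightarrow>\<^sub>E UNIV)"
proof -
  have "Infinite_Set_Sum.abs_summable_on (\<lambda>g. \<Prod>x\<in>A. f x (g x)) (A \<rightarrow>\<^sub>E UNIV)"
  proof (rule abs_summable_on_prod_PiE[OF A])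
    fix x assume "x \<in> A"
    then show "Infinite_Set_Sum.abs_summable_on (f x) UNIV" by (rule abs_summable_equivalent[THEN iffD1, OF abs])
  qed simp
  then have "(\<lambda>g. \<Prod>x\<in>A. f x (g x)) summable_on (A \<rightarrow>\<^sub>E UNIV)"
    by (rule abs_summable_summable[OF abs_summable_equivalent[THEN iffD2]])
  moreover have "infsum (\<lambda>g. \<Prod>x\<in>A. f x (g x)) (A \<rightarrow>\<^sub>E UNIV) = (\<Prod>x\<in>A. infsum (f x) UNIV)"
    using A abs by (intro infsum_prod_PiE_abs) auto
  moreover have "(\<Prod>x\<in>A. infsum (f x) UNIV) = (\<Prod>x\<in>A. s x)" using s by (intro prod.cong) (auto simp: infsumI)
  ultimately show ?thesis by (metis has_sum_infsum)
qed

lemma exp_has_sum: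
  fixes z :: complex
  shows "((\<lambda>n. z ^ n / fact n) has_sum exp z) UNIV" "(\<lambda>n. norm (z ^ n / fact n)) summable_on UNIV"
proof -
  have s: "summable (\<lambda>n. norm (z ^ n / fact n))"
    using summable_norm_exp[of z] by (simp add: scaleR_conv_of_real field_simps)
  have e: "(\<lambda>n. z ^ n / fact n) sums exp z" using exp_converges[of z] by (simp add: scaleR_conv_of_real field_simps)
  show "((\<lambda>n. z ^ n / fact n) has_sum exp z) UNIV" by (rule norm_summable_imp_has_sum[OF s e])
  show "(\<lambda>n. norm (z ^ n / fact n)) summable_on UNIV"
    using s by (intro norm_summable_imp_summable_on) simp
qed

text \<open>The cosine is the real part of \<open>z\<close> times a product of exponentials in the
  separate coordinates of \<open>h\<close>, so its expansion is a product of exponential series.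
  These converge everywhere; the radius 1 is an arbitrary choice.\<close>

lemma real_analytic_at_cos:
  fixes m :: "'a::euclidean_space" and b :: "'b::euclidean_space"
  shows "real_analytic_at (\<lambda>v. cos (m \<bullet> v + \<theta>) *\<^sub>R b) x"
proof -
  define z where "z = exp (\<i> * of_real (m \<bullet> x + \<theta>))"
  define c where "c = (\<lambda>\<alpha>. Re (z * (\<Prod>e\<in>Basis. (\<i> * of_real (m \<bullet> e)) ^ \<alpha> e / fact (\<alpha> e))) *\<^sub>R b)"
  show ?thesis unfolding real_analytic_at_def
  proof (intro exI[of _ c] exI[of _ 1] conjI allI impI)
    fix h :: 'a
    have "((\<lambda>\<alpha>. \<Prod>e\<in>Basis. (\<i> * of_real (m \<bullet> e) * of_real (h \<bullet> e)) ^ \<alpha> e / fact (\<alpha> e)) has_sum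
        (\<Prod>e\<in>Basis. exp (\<i> * of_real (m \<bullet> e) * of_real (h \<bullet> e)))) (Basis \<rightarrow>\<^sub>E UNIV)"
      by (intro has_sum_prod_PiE exp_has_sum) simp
    then have "((\<lambda>\<alpha>. Re (z * (\<Prod>e\<in>Basis. (\<i> * of_real (m \<bullet> e) * of_real (h \<bullet> e)) ^ \<alpha> e / fact (\<alpha> e)))) has_sum
        Re (z * (\<Prod>e\<in>Basis. exp (\<i> * of_real (m \<bullet> e) * of_real (h \<bullet> e))))) (Basis \<rightarrow>\<^sub>E UNIV)"
      by (intro has_sum_Re has_sum_cmult_right)
    also have "z * (\<Prod>e\<in>Basis. exp (\<i> * of_real (m \<bullet> e) * of_real (h \<bullet> e))) = exp (\<i> * of_real (m \<bullet> (x + h) + \<theta>))"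
    proof -
      have "m \<bullet> h = (\<Sum>e\<in>Basis. (m \<bullet> e) * (h \<bullet> e))" by (rule euclidean_inner)
      then show ?thesis
        by (simp add: z_def exp_sum[symmetric] exp_add[symmetric] inner_add_right sum_distrib_left algebra_simps)
    qed
    also have "Re \<dots> = cos (m \<bullet> (x + h) + \<theta>)" by (simp add: Re_exp)
    finally have 1: "((\<lambda>\<alpha>. Re (z * (\<Prod>e\<in>Basis. (\<i> * of_real (m \<bullet> e) * of_real (h \<bullet> e)) ^ \<alpha> e / fact (\<alpha> e))) *\<^sub>R b) has_sum
        cos (m \<bullet> (x + h) + \<theta>) *\<^sub>R b) (Basis \<rightarrow>\<^sub>E UNIV)"
      using has_sum_bounded_linear[OF bounded_linear_scaleR_left[of b]] by (simp add: o_def)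
    have "Re (z * (\<Prod>e\<in>Basis. (\<i> * of_real (m \<bullet> e) * of_real (h \<bullet> e)) ^ \<alpha> e / fact (\<alpha> e))) *\<^sub>R b = (\<Prod>e\<in>Basis. (h \<bullet> e) ^ \<alpha> e) *\<^sub>R c \<alpha>" for \<alpha>
    proof -
      have "(\<Prod>e\<in>Basis. (\<i> * of_real (m \<bullet> e) * of_real (h \<bullet> e)) ^ \<alpha> e / fact (\<alpha> e)) =
        (\<Prod>e\<in>Basis. complex_of_real ((h \<bullet> e) ^ \<alpha> e) * ((\<i> * of_real (m \<bullet> e)) ^ \<alpha> e / fact (\<alpha> e)))"
        by (intro prod.cong refl) (simp add: power_mult_distrib)
      also have "\<dots> = complex_of_real (\<Prod>e\<in>Basis. (h \<bullet> e) ^ \<alpha> e) * (\<Prod>e\<in>Basis. (\<i> * of_real (m \<bullet> e)) ^ \<alpha> e / fact (\<alpha> e))"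
        by (simp only: prod.distrib of_real_prod)
      finally have eq: "(\<Prod>e\<in>Basis. (\<i> * of_real (m \<bullet> e) * of_real (h \<bullet> e)) ^ \<alpha> e / fact (\<alpha> e)) =
        complex_of_real (\<Prod>e\<in>Basis. (h \<bullet> e) ^ \<alpha> e) * (\<Prod>e\<in>Basis. (\<i> * of_real (m \<bullet> e)) ^ \<alpha> e / fact (\<alpha> e))" .
      have re: "Re (z * (complex_of_real P * Q)) = P * Re (z * Q)" for P Q by (simp add: algebra_simps)
      show ?thesis unfolding c_def eq re by simp
    qed
    with 1 show "((\<lambda>\<alpha>. (\<Prod>e\<in>Basis. (h \<bullet> e) ^ \<alpha> e) *\<^sub>R c \<alpha>) has_sum cos (m \<bullet> (x + h) + \<theta>) *\<^sub>R b) (Basis \<rightarrow>\<^sub>E UNIV)"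
      by simp
  qed simp
qed

lemma real_analytic_at_add:
  assumes "real_analytic_at f x" "real_analytic_at g x" shows "real_analytic_at (\<lambda>v. f v + g v) x"
proof -
  from assms(1) obtain c r where c: "r > 0" "\<And>h. norm h < r \<Longrightarrow> ((\<lambda>\<alpha>. (\<Prod>b\<in>Basis. (h \<bullet> b) ^ \<alpha> b) *\<^sub>R c \<alpha>) has_sum f (x + h)) (Basis \<rightarrow>\<^sub>E UNIV)"
    unfolding real_analytic_at_def by blast
  from assms(2) obtain d s where d: "s > 0" "\<And>h. norm h < s \<Longrightarrow> ((\<lambda>\<alpha>. (\<Prod>b\<in>Basis. (h \<bullet> b) ^ \<alpha> b) *\<^sub>R d \<alpha>) has_sum g (x + h)) (Basis \<rightarrow>\<^sub>E UNIV)"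
    unfolding real_analytic_at_def by blast
  show ?thesis unfolding real_analytic_at_def
    by (intro exI[of _ "\<lambda>\<alpha>. c \<alpha> + d \<alpha>"] exI[of _ "min r s"]) (use c d in \<open>auto simp: scaleR_add_right intro!: has_sum_add\<close>)
qed

lemma real_analytic_at_scaleR:
  assumes "real_analytic_at f x" shows "real_analytic_at (\<lambda>v. a *\<^sub>R f v) x"
proof -
  from assms obtain c r where c: "r > 0" "\<And>h. norm h < r \<Longrightarrow> ((\<lambda>\<alpha>. (\<Prod>b\<in>Basis. (h \<bullet> b) ^ \<alpha> b) *\<^sub>R c \<alpha>) has_sum f (x + h)) (Basis \<rightarrow>\<^sub>E UNIV)"
    unfolding real_analytic_at_def by blast
  have "((\<lambda>\<alpha>. (\<Prod>b\<in>Basis. (h \<bullet> b) ^ \<alpha> b) *\<^sub>R (a *\<^sub>R c \<alpha>)) has_sum a *\<^sub>R f (x + h)) (Basis \<rightarrow>\<^sub>E UNIV)" if "norm h < r" for h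
    using has_sum_bounded_linear[OF bounded_linear_scaleR_right[of a] c(2)[OF that]]
    by (simp add: o_def mult.commute)
  then show ?thesis unfolding real_analytic_at_def using c(1)
    by (intro exI[of _ "\<lambda>\<alpha>. a *\<^sub>R c \<alpha>"] exI[of _ r]) simp
qed

lemma real_analytic_at_sum:
  assumes "finite A" "\<And>i. i \<in> A \<Longrightarrow> real_analytic_at (f i) x"
  shows "real_analytic_at (\<lambda>v. \<Sum>i\<in>A. f i v) (x :: 'a::euclidean_space)"
  using assms
proof (induction A rule: finite_induct)
  case empty
  show ?case using real_analytic_at_scaleR[of _ x 0, OF real_analytic_at_cos[of 0 0 _ x]] by simp
next
  case (insert a A)
  then show ?case by (simp add: real_analytic_at_add)
qed

section \<open>Absolute convergence and local estimates for analytic functions\<close>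

lemma summable_on_finite_sum:
  fixes f :: "'j \<Rightarrow> 'i \<Rightarrow> real"
  assumes "finite B" "\<And>b. b \<in> B \<Longrightarrow> f b summable_on A" shows "(\<lambda>x. \<Sum>b\<in>B. f b x) summable_on A"
  using assms by (induction B rule: finite_induct) (simp_all add: summable_on_add)

text \<open>In finite dimension unconditional convergence is absolute: this holds for real series,
  hence for every coordinate.\<close>

lemma has_sum_imp_norm_summable:
  fixes g :: "'i \<Rightarrow> 'b::euclidean_space"
  assumes "(g has_sum s) A" shows "(\<lambda>x. norm (g x)) summable_on A"
proof (rule summable_on_comparison_test)
  have "(\<lambda>x. \<bar>g x \<bullet> b\<bar>) summable_on A" for b
  proof -
    have "((\<lambda>x. g x \<bullet> b) has_sum s \<bullet> b) A"
      using has_sum_bounded_linear[OF bounded_linear_inner_left[of b] assms] by (simp add: o_def)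
    then have "(\<lambda>x. g x \<bullet> b) summable_on A" by (rule has_sum_imp_summable)
    then show ?thesis by (subst (asm) summable_on_iff_abs_summable_on_real) simp
  qed
  then show "(\<lambda>x. \<Sum>b\<in>Basis. \<bar>g x \<bullet> b\<bar>) summable_on A" by (intro summable_on_finite_sum) auto
  show "norm (g x) \<le> (\<Sum>b\<in>Basis. \<bar>g x \<bullet> b\<bar>)" for x by (rule norm_le_l1)
qed auto

text \<open>For arguments of size at most 1/2 the power maps have Lipschitz constant 1 uniformly in
  \<open>n\<close>. This allows monomials of all degrees to be estimated by one constant.\<close>

lemma abs_power_diff_le:
  fixes x y :: real
  assumes "\<bar>x\<bar> \<le> 1/2" "\<bar>y\<bar> \<le> 1/2" shows "\<bar>x ^ n - y ^ n\<bar> \<le> \<bar>x - y\<bar>"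
proof (induction n)
  case (Suc n)
  show ?case
  proof (cases "n = 0")
    case False
    have "\<bar>y ^ n\<bar> \<le> (1/2) ^ n" unfolding power_abs using assms by (intro power_mono) auto
    also have "\<dots> \<le> (1/2) ^ 1" using False by (intro power_decreasing) auto
    finally have y: "\<bar>y ^ n\<bar> \<le> 1/2" by simp
    have "x ^ Suc n - y ^ Suc n = x * (x ^ n - y ^ n) + (x - y) * y ^ n" by (simp add: algebra_simps)
    also have "\<bar>\<dots>\<bar> \<le> \<bar>x\<bar> * \<bar>x ^ n - y ^ n\<bar> + \<bar>x - y\<bar> * \<bar>y ^ n\<bar>" by (metis abs_mult abs_triangle_ineq)
    also have "\<dots> \<le> (1/2) * \<bar>x - y\<bar> + \<bar>x - y\<bar> * (1/2)" using assms y Suc by (intro add_mono mult_mono) auto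
    finally show ?thesis by simp
  qed simp
qed simp

lemma has_sum_diff':
  fixes f :: "'i \<Rightarrow> 'b::real_normed_vector"
  assumes "(f has_sum a) A" "(g has_sum b) A" shows "((\<lambda>x. f x - g x) has_sum (a - b)) A"
  using has_sum_add[OF assms(1), of "\<lambda>x. - g x" "- b"] assms(2) by (simp add: has_sum_uminus)

lemma real_analytic_at_norm_bound:
  fixes f :: "'a::euclidean_space \<Rightarrow> 'b::euclidean_space"
  assumes "real_analytic_at f x"
  obtains c R K where "R > 0" "K \<ge> 0"
    "((\<lambda>\<alpha>. (\<Prod>b\<in>Basis. R ^ \<alpha> b) * norm (c \<alpha>)) has_sum K) (Basis \<rightarrow>\<^sub>E UNIV)"
    "\<And>z. (\<forall>b\<in>Basis. \<bar>z \<bullet> b\<bar> \<le> 1) \<Longrightarrow> ((\<lambda>\<alpha>. (\<Prod>b\<in>Basis. (z \<bullet> b) ^ \<alpha> b) *\<^sub>R ((\<Prod>b\<in>Basis. R ^ \<alpha> b) *\<^sub>R c \<alpha>)) has_sum f (x + R *\<^sub>R z)) (Basis \<rightarrow>\<^sub>E UNIV)"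
proof -
  from assms obtain c r where c: "r > 0" "\<And>h. norm h < r \<Longrightarrow> ((\<lambda>\<alpha>. (\<Prod>b\<in>Basis. (h \<bullet> b) ^ \<alpha> b) *\<^sub>R c \<alpha>) has_sum f (x + h)) (Basis \<rightarrow>\<^sub>E UNIV)"
    unfolding real_analytic_at_def by blast
  define R where "R = r / (2 * DIM('a))"
  have R: "R > 0" using c by (simp add: R_def)
  have small: "norm (R *\<^sub>R z) < r" if "\<forall>b\<in>Basis. \<bar>z \<bullet> b\<bar> \<le> 1" for z :: 'a
  proof -
    have "norm (R *\<^sub>R z) = R * norm z" using R by simp
    also have "\<dots> \<le> R * (\<Sum>b\<in>Basis. \<bar>z \<bullet> b\<bar>)" using R by (intro mult_left_mono norm_le_l1) auto
    also have "\<dots> \<le> R * (\<Sum>b\<in>(Basis::'a set). 1)" using R that by (intro mult_left_mono sum_mono) auto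
    also have "\<dots> = r / 2" by (simp add: R_def)
    finally show ?thesis using c by simp
  qed
  have main: "((\<lambda>\<alpha>. (\<Prod>b\<in>Basis. (z \<bullet> b) ^ \<alpha> b) *\<^sub>R ((\<Prod>b\<in>Basis. R ^ \<alpha> b) *\<^sub>R c \<alpha>)) has_sum f (x + R *\<^sub>R z)) (Basis \<rightarrow>\<^sub>E UNIV)"
    if "\<forall>b\<in>Basis. \<bar>z \<bullet> b\<bar> \<le> 1" for z
    using c(2)[OF small[OF that]] by (simp add: power_mult_distrib prod.distrib mult.commute)
  \<comment> \<open>At the corner of the cube all monomials are positive powers of \<open>R\<close>,
    so absolute convergence there bounds the whole cube.\<close>
  have "((\<lambda>\<alpha>. (\<Prod>b\<in>Basis. R ^ \<alpha> b) *\<^sub>R c \<alpha>) has_sum f (x + R *\<^sub>R (\<Sum>b\<in>Basis. b))) (Basis \<rightarrow>\<^sub>E UNIV)"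
    using main[of "\<Sum>b\<in>Basis. b"] by (simp add: inner_sum_left inner_Basis sum.delta)
  from has_sum_imp_norm_summable[OF this]
  have "(\<lambda>\<alpha>. (\<Prod>b\<in>(Basis::'a set). R ^ \<alpha> b) * norm (c \<alpha>)) summable_on (Basis \<rightarrow>\<^sub>E UNIV)"
    using R by (simp add: abs_prod power_abs)
  then obtain K where K: "((\<lambda>\<alpha>. (\<Prod>b\<in>(Basis::'a set). R ^ \<alpha> b) * norm (c \<alpha>)) has_sum K) (Basis \<rightarrow>\<^sub>E UNIV)"
    unfolding summable_on_def by blast
  then have K0: "K \<ge> 0" by (rule has_sum_nonneg) (use R in \<open>auto intro!: mult_nonneg_nonneg prod_nonneg\<close>)
  show ?thesis by (rule that[OF R K0 K main])
qed

lemma has_sum_norm_le: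
  fixes f :: "'i \<Rightarrow> 'b::euclidean_space"
  assumes "(f has_sum s) A" "(g has_sum t) A" "\<And>x. x \<in> A \<Longrightarrow> norm (f x) \<le> g x"
  shows "norm s \<le> t"
  using norm_infsum_le[OF assms] by simp

text \<open>On the half-size cube each rescaled monomial is 1-Lipschitz for the sum of coordinate
  differences, and the coefficients have total weight \<open>K\<close>.\<close>

lemma real_analytic_at_lipschitz:
  fixes f :: "'a::euclidean_space \<Rightarrow> 'b::euclidean_space"
  assumes "real_analytic_at f x"
  obtains \<delta> C where "\<delta> > 0" "C \<ge> 0" "\<And>h h'. norm h < \<delta> \<Longrightarrow> norm h' < \<delta> \<Longrightarrow> norm (f (x + h) - f (x + h')) \<le> C * norm (h - h')"
proof -
  obtain c R K where h: "R > 0" "K \<ge> 0"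
    "((\<lambda>\<alpha>. (\<Prod>b\<in>Basis. R ^ \<alpha> b) * norm (c \<alpha>)) has_sum K) (Basis \<rightarrow>\<^sub>E UNIV)"
    "\<And>z. (\<forall>b\<in>Basis. \<bar>z \<bullet> b\<bar> \<le> 1) \<Longrightarrow> ((\<lambda>\<alpha>. (\<Prod>b\<in>Basis. (z \<bullet> b) ^ \<alpha> b) *\<^sub>R ((\<Prod>b\<in>Basis. R ^ \<alpha> b) *\<^sub>R c \<alpha>)) has_sum f (x + R *\<^sub>R z)) (Basis \<rightarrow>\<^sub>E UNIV)"
    by (rule real_analytic_at_norm_bound[OF assms], rule that)
  show ?thesis
  proof (rule that[of "R / 2" "DIM('a) / R * K"])
    fix u v :: 'a assume uv: "norm u < R / 2" "norm v < R / 2"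
    define z w where "z = u /\<^sub>R R" "w = v /\<^sub>R R"
    have zw: "\<bar>z \<bullet> b\<bar> \<le> 1/2" "\<bar>w \<bullet> b\<bar> \<le> 1/2" if "b \<in> Basis" for b
      using uv Basis_le_norm[OF that, of u] Basis_le_norm[OF that, of v] h(1) by (auto simp: z_w_def abs_mult field_simps)
    then have zw1: "\<forall>b\<in>Basis. \<bar>z \<bullet> b\<bar> \<le> 1" "\<forall>b\<in>Basis. \<bar>w \<bullet> b\<bar> \<le> 1" by force+
    have e: "u = R *\<^sub>R z" "v = R *\<^sub>R w" using h(1) by (auto simp: z_w_def)
    let ?a = "\<lambda>\<alpha>. (\<Prod>b\<in>Basis. R ^ \<alpha> b) *\<^sub>R c \<alpha>"
    have "((\<lambda>\<alpha>. (\<Prod>b\<in>Basis. (z \<bullet> b) ^ \<alpha> b) *\<^sub>R ?a \<alpha> - (\<Prod>b\<in>Basis. (w \<bullet> b) ^ \<alpha> b) *\<^sub>R ?a \<alpha>) has_sum (f (x + u) - f (x + v))) (Basis \<rightarrow>\<^sub>E UNIV)"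
      unfolding e by (intro has_sum_diff' h(4) zw1)
    moreover have "((\<lambda>\<alpha>. (\<Sum>b\<in>Basis. \<bar>z \<bullet> b - w \<bullet> b\<bar>) * ((\<Prod>b\<in>Basis. R ^ \<alpha> b) * norm (c \<alpha>))) has_sum (\<Sum>b\<in>Basis. \<bar>z \<bullet> b - w \<bullet> b\<bar>) * K) (Basis \<rightarrow>\<^sub>E UNIV)"
      by (rule has_sum_cmult_right[OF h(3)])
    moreover have "norm ((\<Prod>b\<in>Basis. (z \<bullet> b) ^ \<alpha> b) *\<^sub>R ?a \<alpha> - (\<Prod>b\<in>Basis. (w \<bullet> b) ^ \<alpha> b) *\<^sub>R ?a \<alpha>)
        \<le> (\<Sum>b\<in>Basis. \<bar>z \<bullet> b - w \<bullet> b\<bar>) * ((\<Prod>b\<in>Basis. R ^ \<alpha> b) * norm (c \<alpha>))" for \<alpha>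
    proof -
      have le1: "\<bar>s ^ n\<bar> \<le> 1" if "\<bar>s\<bar> \<le> 1/2" for s :: real and n using that by (simp add: power_abs power_le_one)
      have "\<bar>(\<Prod>b\<in>Basis. (z \<bullet> b) ^ \<alpha> b) - (\<Prod>b\<in>Basis. (w \<bullet> b) ^ \<alpha> b)\<bar> \<le> (\<Sum>b\<in>Basis. \<bar>(z \<bullet> b) ^ \<alpha> b - (w \<bullet> b) ^ \<alpha> b\<bar>)"
        using norm_prod_diff[of Basis "\<lambda>b. (z \<bullet> b) ^ \<alpha> b" "\<lambda>b. (w \<bullet> b) ^ \<alpha> b"] le1 zw by (simp add: le1 zw)
      also have "\<dots> \<le> (\<Sum>b\<in>Basis. \<bar>z \<bullet> b - w \<bullet> b\<bar>)" using zw by (intro sum_mono abs_power_diff_le)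
      finally have d: "\<bar>(\<Prod>b\<in>Basis. (z \<bullet> b) ^ \<alpha> b) - (\<Prod>b\<in>Basis. (w \<bullet> b) ^ \<alpha> b)\<bar> \<le> (\<Sum>b\<in>Basis. \<bar>z \<bullet> b - w \<bullet> b\<bar>)" .
      have "norm ((\<Prod>b\<in>Basis. (z \<bullet> b) ^ \<alpha> b) *\<^sub>R ?a \<alpha> - (\<Prod>b\<in>Basis. (w \<bullet> b) ^ \<alpha> b) *\<^sub>R ?a \<alpha>)
        = \<bar>(\<Prod>b\<in>Basis. (z \<bullet> b) ^ \<alpha> b) - (\<Prod>b\<in>Basis. (w \<bullet> b) ^ \<alpha> b)\<bar> * norm (?a \<alpha>)"
        by (simp only: scaleR_left_diff_distrib[symmetric] norm_scaleR)
      also have "norm (?a \<alpha>) = (\<Prod>b\<in>(Basis::'a set). R ^ \<alpha> b) * norm (c \<alpha>)" using h(1) by (simp add: abs_prod power_abs)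
      finally show ?thesis using d h(1) by (auto intro!: mult_right_mono mult_nonneg_nonneg prod_nonneg)
    qed
    ultimately have "norm (f (x + u) - f (x + v)) \<le> (\<Sum>b\<in>Basis. \<bar>z \<bullet> b - w \<bullet> b\<bar>) * K"
      by (rule has_sum_norm_le)
    also have "\<dots> \<le> (\<Sum>b\<in>(Basis::'a set). norm (u - v) / R) * K"
    proof (intro mult_right_mono sum_mono h(2))
      fix b :: 'a assume b: "b \<in> Basis"
      have "\<bar>z \<bullet> b - w \<bullet> b\<bar> = \<bar>(u - v) \<bullet> b\<bar> / R" using h(1) by (simp add: z_w_def inner_diff_left abs_mult field_simps flip: right_diff_distrib)
      also have "\<dots> \<le> norm (u - v) / R" using h(1) Basis_le_norm[OF b] by (intro divide_right_mono) auto
      finally show "\<bar>z \<bullet> b - w \<bullet> b\<bar> \<le> norm (u - v) / R" .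
    qed
    finally show "norm (f (x + u) - f (x + v)) \<le> DIM('a) / R * K * norm (u - v)" by (simp add: mult_ac)
  qed (use h in auto)
qed

text \<open>The terms of degree at most 1, indexed by \<open>A\<close>, form a differentiable
  function \<open>g\<close>; all others carry at least \<open>t^2\<close>, so the remainder is
  quadratic in \<open>norm (y - x)\<close>.\<close>

lemma real_analytic_at_differentiable:
  fixes f :: "'a::euclidean_space \<Rightarrow> 'b::euclidean_space"
  assumes "real_analytic_at f x" shows "f differentiable (at x)"
proof -
  obtain c R K where h: "R > 0" "K \<ge> 0"
    "((\<lambda>\<alpha>. (\<Prod>b\<in>Basis. R ^ \<alpha> b) * norm (c \<alpha>)) has_sum K) (Basis \<rightarrow>\<^sub>E UNIV)"
    "\<And>z. (\<forall>b\<in>Basis. \<bar>z \<bullet> b\<bar> \<le> 1) \<Longrightarrow> ((\<lambda>\<alpha>. (\<Prod>b\<in>Basis. (z \<bullet> b) ^ \<alpha> b) *\<^sub>R ((\<Prod>b\<in>Basis. R ^ \<alpha> b) *\<^sub>R c \<alpha>)) has_sum f (x + R *\<^sub>R z)) (Basis \<rightarrow>\<^sub>E UNIV)"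
    by (rule real_analytic_at_norm_bound[OF assms], rule that)
  let ?a = "\<lambda>\<alpha>. (\<Prod>b\<in>Basis. R ^ \<alpha> b) *\<^sub>R c \<alpha>"
  define A where "A = {\<alpha> \<in> Basis \<rightarrow>\<^sub>E UNIV. (\<Sum>b\<in>(Basis::'a set). \<alpha> b) \<le> (1::nat)}"
  have finA: "finite A"
  proof (rule finite_subset)
    show "A \<subseteq> Basis \<rightarrow>\<^sub>E {..1}"
    proof
      fix \<alpha> assume "\<alpha> \<in> A"
      then have a: "\<alpha> \<in> Basis \<rightarrow>\<^sub>E UNIV" "(\<Sum>b\<in>(Basis::'a set). \<alpha> b) \<le> 1" by (auto simp: A_def)
      have "\<alpha> b \<le> 1" if "b \<in> Basis" for b using member_le_sum[of b Basis \<alpha>] that a by simp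
      then show "\<alpha> \<in> Basis \<rightarrow>\<^sub>E {..1}" using a by (auto simp: PiE_def)
    qed
  qed (intro finite_PiE; simp)
  define g where "g = (\<lambda>y. \<Sum>\<alpha>\<in>A. (\<Prod>b\<in>Basis. (((y - x) /\<^sub>R R) \<bullet> b) ^ \<alpha> b) *\<^sub>R ?a \<alpha>)"
  have gd: "g differentiable (at x)" unfolding g_def
    by (intro differentiable_sum finA ballI differentiable_scaleR differentiable_const)
      (auto intro!: derivative_eq_intros simp: differentiable_def)
  have bound: "norm (f y - g y) \<le> K / R^2 * (norm (y - x))^2" if y: "norm (y - x) < R" for y
  proof -
    define z where "z = (y - x) /\<^sub>R R"
    define t where "t = norm (y - x) / R"
    have t: "0 \<le> t" "t \<le> 1" using y h(1) by (auto simp: t_def)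
    have zt: "\<bar>z \<bullet> b\<bar> \<le> t" if "b \<in> Basis" for b
    proof -
      have "\<bar>z \<bullet> b\<bar> = \<bar>(y - x) \<bullet> b\<bar> / R"
        unfolding z_def inner_scaleR_left using h(1) by (simp add: abs_mult divide_inverse mult.commute)
      then show ?thesis using Basis_le_norm[OF that, of "y - x"] h(1) by (simp add: t_def divide_right_mono)
    qed
    have yz: "y = x + R *\<^sub>R z" using h(1) by (simp add: z_def)
    have 1: "((\<lambda>\<alpha>. (\<Prod>b\<in>Basis. (z \<bullet> b) ^ \<alpha> b) *\<^sub>R ?a \<alpha>) has_sum f y) (Basis \<rightarrow>\<^sub>E UNIV)"
      unfolding yz by (rule h(4)) (use zt t in fastforce)
    have 2: "((\<lambda>\<alpha>. if \<alpha> \<in> A then (\<Prod>b\<in>Basis. (z \<bullet> b) ^ \<alpha> b) *\<^sub>R ?a \<alpha> else 0) has_sum g y) (Basis \<rightarrow>\<^sub>E UNIV)"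
    proof -
      have "((\<lambda>\<alpha>. (\<Prod>b\<in>Basis. (z \<bullet> b) ^ \<alpha> b) *\<^sub>R ?a \<alpha>) has_sum g y) A"
        unfolding g_def z_def[symmetric] using finA by (rule has_sum_finite)
      then show ?thesis by (rule has_sum_cong_neutral[THEN iffD1, rotated -1]) (auto simp: A_def)
    qed
    have "norm (f y - g y) \<le> t^2 * K"
    proof (rule has_sum_norm_le[OF has_sum_diff'[OF 1 2] has_sum_cmult_right[OF h(3)]])
      fix \<alpha> :: "'a \<Rightarrow> nat" assume \<alpha>: "\<alpha> \<in> Basis \<rightarrow>\<^sub>E UNIV"
      show "norm ((\<Prod>b\<in>Basis. (z \<bullet> b) ^ \<alpha> b) *\<^sub>R ?a \<alpha> - (if \<alpha> \<in> A then (\<Prod>b\<in>Basis. (z \<bullet> b) ^ \<alpha> b) *\<^sub>R ?a \<alpha> else 0)) \<le> t\<^sup>2 * ((\<Prod>b\<in>Basis. R ^ \<alpha> b) * norm (c \<alpha>))"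
      proof (cases "\<alpha> \<in> A")
        case True
        then show ?thesis using h(1) by (auto intro!: mult_nonneg_nonneg prod_nonneg)
      next
        case False
        then have s2: "2 \<le> (\<Sum>b\<in>(Basis::'a set). \<alpha> b)" using \<alpha> by (auto simp: A_def)
        have "\<bar>\<Prod>b\<in>Basis. (z \<bullet> b) ^ \<alpha> b\<bar> = (\<Prod>b\<in>Basis. \<bar>z \<bullet> b\<bar> ^ \<alpha> b)" by (simp add: abs_prod power_abs)
        also have "\<dots> \<le> (\<Prod>b\<in>(Basis::'a set). t ^ \<alpha> b)" using zt by (intro prod_mono) (auto intro: power_mono)
        also have "\<dots> = t ^ (\<Sum>b\<in>(Basis::'a set). \<alpha> b)" by (simp add: power_sum)
        also have "\<dots> \<le> t^2" using s2 t by (rule power_decreasing)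
        finally have "\<bar>\<Prod>b\<in>Basis. (z \<bullet> b) ^ \<alpha> b\<bar> \<le> t^2" .
        moreover have "norm (?a \<alpha>) = (\<Prod>b\<in>(Basis::'a set). R ^ \<alpha> b) * norm (c \<alpha>)" using h(1) by (simp add: abs_prod power_abs)
        ultimately show ?thesis using False h(1)
          by (simp only: if_False diff_zero norm_scaleR[of "prod _ _" "_ *\<^sub>R _"]) (auto intro!: mult_right_mono mult_nonneg_nonneg prod_nonneg)
      qed
    qed
    then show ?thesis by (simp add: t_def power_divide mult.commute)
  qed
  have "((\<lambda>y. f y - g y) has_derivative (\<lambda>h. 0)) (at x)"
  proof (rule has_derivativeI_sandwich[of R])
    show "((\<lambda>y. K / R^2 * norm (y - x)) \<longlongrightarrow> 0) (at x)"
    proof -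
      have "((\<lambda>y. K / R^2 * norm (y - x)) \<longlongrightarrow> K / R^2 * norm (x - x)) (at x)" by (intro tendsto_intros)
      then show ?thesis by simp
    qed
    fix y assume y: "y \<noteq> x" "dist y x < R"
    have "f x - g x = 0" using bound[of x] h(1) by simp
    then have "norm (f y - g y - (f x - g x) - 0) / norm (y - x) \<le> (K / R^2 * (norm (y - x))^2) / norm (y - x)"
      using bound[of y] y by (intro divide_right_mono) (auto simp: dist_norm)
    also have "\<dots> = K / R^2 * norm (y - x)" using y by (simp add: power2_eq_square)
    finally show "norm (f y - g y - (f x - g x) - 0) / norm (y - x) \<le> K / R^2 * norm (y - x)" .
  qed (use h(1) in auto)
  then have "(\<lambda>y. f y - g y) differentiable (at x)" by (auto simp: differentiable_def)
  from differentiable_add[OF this gd] show ?thesis by simp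
qed

section \<open>Trigonometric polynomials\<close>

inductive trig_poly :: "'a::euclidean_space set \<Rightarrow> ('a \<Rightarrow> real) \<Rightarrow> bool" for M where
  trig_poly_cos: "m \<in> M \<Longrightarrow> trig_poly M (\<lambda>x. a * cos (m \<bullet> x + \<theta>))"
| trig_poly_add: "trig_poly M f \<Longrightarrow> trig_poly M g \<Longrightarrow> trig_poly M (\<lambda>x. f x + g x)"

lemma trig_poly_continuous: "trig_poly M f \<Longrightarrow> continuous_on S f"
  by (induction rule: trig_poly.induct) (auto intro!: continuous_intros)

lemma trig_poly_shift:
  assumes "trig_poly M f" shows "trig_poly M (\<lambda>x. f (u + x))"
  using assms
proof (induction rule: trig_poly.induct)
  case (trig_poly_cos m a \<theta>)
  have "m \<bullet> (u + x) + \<theta> = m \<bullet> x + (m \<bullet> u + \<theta>)" for x by (simp add: inner_add_right)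
  then show ?case using trig_poly_cos by (simp only:) (rule trig_poly.intros)
next
  case (trig_poly_add f g)
  then show ?case by (intro trig_poly.intros)
qed

context
  fixes M :: "'a::euclidean_space set"
  assumes M0: "0 \<in> M" and Ma: "\<And>m n. m \<in> M \<Longrightarrow> n \<in> M \<Longrightarrow> m + n \<in> M"
    and Md: "\<And>m n. m \<in> M \<Longrightarrow> n \<in> M \<Longrightarrow> m - n \<in> M"
begin

lemma trig_poly_const: "trig_poly M (\<lambda>x. c)"
  using trig_poly_cos[OF M0, of c 0] by simp

lemma trig_poly_mult:
  assumes "trig_poly M f" "trig_poly M g" shows "trig_poly M (\<lambda>x. f x * g x)"
  using assms(1)
proof (induction rule: trig_poly.induct)
  case (trig_poly_cos m a \<theta>)
  note m = trig_poly_cos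
  show ?case using assms(2)
  proof (induction rule: trig_poly.induct)
    case (trig_poly_cos n b \<phi>)
    have "a * cos (m \<bullet> x + \<theta>) * (b * cos (n \<bullet> x + \<phi>)) =
      (a * b / 2) * cos ((m - n) \<bullet> x + (\<theta> - \<phi>)) + (a * b / 2) * cos ((m + n) \<bullet> x + (\<theta> + \<phi>))" for x
    proof -
      have "cos (m \<bullet> x + \<theta>) * cos (n \<bullet> x + \<phi>) = (cos (m \<bullet> x + \<theta> - (n \<bullet> x + \<phi>)) + cos (m \<bullet> x + \<theta> + (n \<bullet> x + \<phi>))) / 2"
        by (rule cos_times_cos)
      moreover have "m \<bullet> x + \<theta> - (n \<bullet> x + \<phi>) = (m - n) \<bullet> x + (\<theta> - \<phi>)" "m \<bullet> x + \<theta> + (n \<bullet> x + \<phi>) = (m + n) \<bullet> x + (\<theta> + \<phi>)"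
        by (simp_all add: inner_diff_left inner_add_left)
      ultimately show ?thesis by (simp add: algebra_simps add_divide_distrib)
    qed
    then show ?case using m trig_poly_cos by (simp only:) (intro trig_poly.intros Ma Md)
  next
    case (trig_poly_add f g)
    then show ?case by (simp only: distrib_left) (rule trig_poly.intros)
  qed
next
  case (trig_poly_add f g)
  then show ?case by (simp only: distrib_right) (rule trig_poly.intros)
qed

lemma trig_poly_sum: "(\<And>i. i \<in> I \<Longrightarrow> trig_poly M (f i)) \<Longrightarrow> trig_poly M (\<lambda>x. \<Sum>i\<in>I. f i x)"
  by (induction I rule: infinite_finite_induct) (auto intro: trig_poly_const trig_poly_add)

lemma trig_poly_prod: "(\<And>i. i \<in> I \<Longrightarrow> trig_poly M (f i)) \<Longrightarrow> trig_poly M (\<lambda>x. \<Prod>i\<in>I. f i x)"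
  by (induction I rule: infinite_finite_induct) (auto intro: trig_poly_const trig_poly_mult)

lemma trig_poly_det:
  fixes A :: "'a \<Rightarrow> real ^ 'n ^ 'n"
  assumes "\<And>i j. trig_poly M (\<lambda>x. A x $ i $ j)" shows "trig_poly M (\<lambda>x. det (A x))"
  unfolding det_def by (intro trig_poly_sum trig_poly_mult trig_poly_const trig_poly_prod assms)

end

lemma trig_poly_real_analytic:
  assumes "trig_poly M f" shows "real_analytic_at f x"
  using assms
proof (induction rule: trig_poly.induct)
  case (trig_poly_cos m a \<theta>)
  show ?case using real_analytic_at_cos[of m \<theta> a x] by (simp add: mult.commute)
next
  case (trig_poly_add f g)
  then show ?case by (intro real_analytic_at_add)
qed

section \<open>Fourier analysis of periodic functions\<close>

definition int_vecs :: "(real ^ 3) set" where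
  "int_vecs = {n. \<forall>i. n $ i \<in> \<int>}"

lemma int_vecs_0: "0 \<in> int_vecs" by (simp add: int_vecs_def)
lemma int_vecs_add: "m \<in> int_vecs \<Longrightarrow> n \<in> int_vecs \<Longrightarrow> m + n \<in> int_vecs" by (simp add: int_vecs_def)
lemma int_vecs_diff: "m \<in> int_vecs \<Longrightarrow> n \<in> int_vecs \<Longrightarrow> m - n \<in> int_vecs" by (simp add: int_vecs_def)
lemma int_vecs_uminus: "n \<in> int_vecs \<Longrightarrow> - n \<in> int_vecs" by (simp add: int_vecs_def)

lemma inner_real3: "(x :: real ^ 3) \<bullet> y = x $ 1 * y $ 1 + x $ 2 * y $ 2 + x $ 3 * y $ 3"
  by (simp add: inner_vec_def sum_3)

lemma periodic3_cos:
  assumes "n \<in> int_vecs" shows "periodic3 (\<lambda>v. cos (n \<bullet> v + \<theta>))"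
  unfolding periodic3_def
proof (intro allI)
  fix v k
  obtain a b c :: int where n: "n $ 1 = of_int a" "n $ 2 = of_int b" "n $ 3 = of_int c"
    using assms unfolding int_vecs_def by (metis (mono_tags, lifting) Ints_cases mem_Collect_eq)
  have "n \<bullet> (v + (\<chi> i. 2 * pi * of_int (k i))) + \<theta> = (n \<bullet> v + \<theta>) + 2 * pi * of_int (a * k 1 + b * k 2 + c * k 3)"
    by (simp add: inner_real3 n algebra_simps)
  then show "cos (n \<bullet> (v + (\<chi> i. 2 * pi * of_int (k i))) + \<theta>) = cos (n \<bullet> v + \<theta>)"
    by (simp only: cos_add[of "_ + _" "2 * pi * _"] cos_int_2pin sin_int_2pin mult_1_right mult_zero_right diff_zero)
qed

lemma periodic3_mult: "periodic3 f \<Longrightarrow> periodic3 g \<Longrightarrow> periodic3 (\<lambda>v. f v * g v :: real)"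
  by (simp add: periodic3_def)

lemma periodic3_axis:
  assumes "periodic3 f" shows "f (v + axis j (2 * pi)) = f v"
proof -
  have "axis j (2 * pi) = (\<chi> i. 2 * pi * of_int (if i = j then 1 else 0))" by (simp add: vec_eq_iff axis_def)
  then show ?thesis using assms by (simp only: periodic3_def)
qed

lemma axis_zero: "axis j (0::real) = 0"
  by (simp add: vec_eq_iff axis_def)

section \<open>Integration by parts over a period box\<close>

definition slab :: "3 \<Rightarrow> real \<Rightarrow> real \<Rightarrow> (real ^ 3) set" where
  "slab j s t = cbox (\<chi> i. if i = j then s else 0) (\<chi> i. if i = j then t else 2 * pi)"

lemma mem_slab: "x \<in> slab j s t \<longleftrightarrow> s \<le> x $ j \<and> x $ j \<le> t \<and> (\<forall>i. i \<noteq> j \<longrightarrow> 0 \<le> x $ i \<and> x $ i \<le> 2 * pi)"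
  unfolding slab_def mem_box_cart by (auto split: if_splits)

lemma slab_full: "slab j 0 (2 * pi) = period_box"
proof -
  have "(\<chi> i. if i = j then 0 else 0) = (0 :: real ^ 3)" "(\<chi> i. if i = j then 2 * pi else 2 * pi) = (\<chi> i. 2 * pi)"
    by (simp_all add: vec_eq_iff)
  then show ?thesis by (simp only: slab_def period_box_def)
qed

lemma slab_combine:
  fixes f :: "real ^ 3 \<Rightarrow> real"
  assumes f: "continuous_on UNIV f" and st: "s \<le> r" "r \<le> t"
  shows "integral (slab j s t) f = integral (slab j s r) f + integral (slab j r t) f"
proof -
  let ?a = "(\<chi> i. if i = j then s else 0) :: real ^ 3" and ?b = "(\<chi> i. if i = j then t else 2 * pi) :: real ^ 3"
  have int: "f integrable_on slab j s' t'" for s' t'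
    unfolding slab_def by (rule integrable_continuous[OF continuous_on_subset[OF f]]) simp
  have 1: "cbox ?a ?b \<inter> {x. x $ j \<le> r} = slab j s r"
    unfolding slab_def[of j s t, symmetric] set_eq_iff Int_iff mem_Collect_eq mem_slab using st by auto
  have 2: "cbox ?a ?b \<inter> {x. x $ j \<ge> r} = slab j r t"
    unfolding slab_def[of j s t, symmetric] set_eq_iff Int_iff mem_Collect_eq mem_slab using st by auto
  have ax: "x \<bullet> axis j 1 = x $ j" for x :: "real ^ 3" by (simp add: inner_axis)
  have "(f has_integral (integral (slab j s r) f + integral (slab j r t) f)) (cbox ?a ?b)"
    by (rule has_integral_split[where k = "axis j 1" and c = r])
       (use int in \<open>auto simp: ax 1 2 axis_in_Basis_iff intro!: integrable_integral\<close>)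
  then show ?thesis unfolding slab_def[of j s t] by (rule integral_unique)
qed

lemma slab_shift:
  fixes f :: "real ^ 3 \<Rightarrow> real"
  shows "integral (slab j s t) (\<lambda>x. f (x + axis j h)) = integral (slab j (s + h) (t + h)) f"
proof -
  have "integral (cbox ((\<chi> i. if i = j then s + h else 0) - axis j h) ((\<chi> i. if i = j then t + h else 2 * pi) - axis j h)) (\<lambda>x. f (x + axis j h)) =
     integral (slab j (s + h) (t + h)) f"
    unfolding slab_def by (rule integral_shift_cbox)
  also have "(\<chi> i. if i = j then s + h else 0) - axis j h = (\<chi> i. if i = j then s else 0)" by (simp add: vec_eq_iff axis_def)
  also have "(\<chi> i. if i = j then t + h else 2 * pi) - axis j h = (\<chi> i. if i = j then t else 2 * pi)" by (simp add: vec_eq_iff axis_def)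
  finally show ?thesis by (simp add: slab_def)
qed

text \<open>The shifted box is cut at \<open>2 * pi\<close>, and the protruding slab is moved back
  by one period.\<close>

lemma integral_period_shift:
  fixes f :: "real ^ 3 \<Rightarrow> real"
  assumes f: "continuous_on UNIV f" "periodic3 f" and h: "0 \<le> h" "h \<le> 2 * pi"
  shows "integral period_box (\<lambda>x. f (x + axis j h)) = integral period_box f"
proof -
  have "integral period_box (\<lambda>x. f (x + axis j h)) = integral (slab j h (2 * pi + h)) f"
    unfolding slab_full[of j, symmetric] slab_shift by simp
  also have "\<dots> = integral (slab j h (2 * pi)) f + integral (slab j (2 * pi) (2 * pi + h)) f"
    using f h by (intro slab_combine) auto
  also have "integral (slab j (2 * pi) (2 * pi + h)) f = integral (slab j 0 h) (\<lambda>x. f (x + axis j (2 * pi)))"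
    unfolding slab_shift by (simp add: add.commute)
  also have "\<dots> = integral (slab j 0 h) f" by (simp add: periodic3_axis[OF f(2)])
  also have "integral (slab j h (2 * pi)) f + \<dots> = integral (slab j 0 (2 * pi)) f"
    using slab_combine[OF f(1) h, of j] by simp
  finally show ?thesis by (simp add: slab_full)
qed

lemma integrable_period: "continuous_on UNIV f \<Longrightarrow> (f :: real ^ 3 \<Rightarrow> real) integrable_on period_box"
  unfolding period_box_def by (rule integrable_continuous[OF continuous_on_subset]) auto

text \<open>\<open>f'\<close> is the partial derivative of \<open>f\<close> in direction
  \<open>j\<close>; neither its continuity nor its integrability is assumed. The Lipschitz bound for
  steps up to 1 is the domination required to pass to the limit in difference quotients.\<close>

definition tame :: "3 \<Rightarrow> (real ^ 3 \<Rightarrow> real) \<Rightarrow> (real ^ 3 \<Rightarrow> real) \<Rightarrow> bool" where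
  "tame j f f' \<longleftrightarrow> continuous_on UNIV f \<and> periodic3 f \<and>
     (\<forall>x. ((\<lambda>t. f (x + axis j t)) has_real_derivative f' x) (at 0)) \<and>
     (\<exists>L. \<forall>x\<in>period_box. \<forall>h. 0 < h \<and> h \<le> 1 \<longrightarrow> \<bar>f (x + axis j h) - f x\<bar> \<le> L * h)"

text \<open>The difference quotients have integral zero by periodicity and converge boundedly.\<close>

lemma tame_integral_derivative:
  assumes "tame j f f'" shows "f' integrable_on period_box" "integral period_box f' = 0"
proof -
  have f: "continuous_on UNIV f" "periodic3 f" and d: "\<And>x. ((\<lambda>t. f (x + axis j t)) has_real_derivative f' x) (at 0)"
    using assms unfolding tame_def by blast+
  obtain L where L: "\<And>x h. x \<in> period_box \<Longrightarrow> 0 < h \<Longrightarrow> h \<le> 1 \<Longrightarrow> \<bar>f (x + axis j h) - f x\<bar> \<le> L * h"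
    using assms unfolding tame_def by blast
  define h where "h = (\<lambda>k. inverse (real (Suc k)))"
  have h: "0 < h k" "h k \<le> 1" for k by (simp_all add: h_def inverse_le_1_iff)
  define F where "F = (\<lambda>k x. (f (x + axis j (h k)) - f x) / h k)"
  have cs: "continuous_on UNIV (\<lambda>x. f (x + axis j t))" for t
    by (rule continuous_on_compose2[OF f(1)]) (intro continuous_intros, simp)
  have i: "F k integrable_on period_box" for k
    unfolding F_def by (intro integrable_period continuous_on_divide continuous_on_diff cs f continuous_on_const) (use h in \<open>auto simp: less_imp_neq[symmetric]\<close>)
  have le: "norm (F k x) \<le> L" if "x \<in> period_box" for k x
    using L[OF that h(1)[of k] h(2)[of k]] h(1)[of k] by (simp add: F_def abs_divide field_simps)
  have "h \<longlonglongrightarrow> 0" unfolding h_def by (rule LIMSEQ_inverse_real_of_nat)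
  then have "filterlim h (at 0) sequentially" using h(1) by (auto simp: filterlim_at less_imp_neq[symmetric])
  then have lim: "(\<lambda>k. F k x) \<longlonglongrightarrow> f' x" for x
    using filterlim_compose[OF d[of x, unfolded has_field_derivative_iff]] by (simp add: F_def axis_zero)
  have K: "(\<lambda>x::real^3. L) integrable_on period_box" by (intro integrable_period continuous_intros)
  note dc = dominated_convergence[OF i K le lim]
  show "f' integrable_on period_box" by (rule dc(1))
  have "integral period_box (F k) = 0" for k
  proof -
    have "integral period_box (F k) = integral period_box (\<lambda>x. f (x + axis j (h k)) - f x) / h k"
      unfolding F_def by simp
    also have "integral period_box (\<lambda>x. f (x + axis j (h k)) - f x) = integral period_box (\<lambda>x. f (x + axis j (h k))) - integral period_box f"
      by (intro integral_diff integrable_period cs f)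
    also have "integral period_box (\<lambda>x. f (x + axis j (h k))) = integral period_box f"
      using h(1)[of k] h(2)[of k] pi_gt3 by (intro integral_period_shift f) linarith+
    finally show ?thesis by simp
  qed
  then have "(\<lambda>k. 0) \<longlonglongrightarrow> integral period_box f'" using dc(2) by simp
  then show "integral period_box f' = 0" using LIMSEQ_unique tendsto_const by blast
qed

lemma abs_cos_diff_le: "\<bar>cos s - cos t\<bar> \<le> \<bar>s - t\<bar>" for s t :: real
proof -
  have "\<bar>cos s - cos t\<bar> = 2 * \<bar>sin ((s + t) / 2)\<bar> * \<bar>sin ((t - s) / 2)\<bar>" by (simp add: cos_diff_cos abs_mult)
  also have "\<dots> \<le> 2 * 1 * \<bar>(t - s) / 2\<bar>" by (intro mult_mono abs_sin_x_le_abs_x) auto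
  finally show ?thesis by simp
qed

lemma inner_axis_real: "n \<bullet> axis j (t::real) = n $ j * t"
  by (simp add: inner_axis)

lemma tame_mult_cos:
  assumes f: "tame j f f'" and n: "n \<in> int_vecs"
  shows "tame j (\<lambda>x. f x * cos (n \<bullet> x + \<theta>)) (\<lambda>x. f' x * cos (n \<bullet> x + \<theta>) - n $ j * (f x * sin (n \<bullet> x + \<theta>)))"
  unfolding tame_def
proof (intro conjI allI)
  have c: "continuous_on UNIV f" using f unfolding tame_def by blast
  show "continuous_on UNIV (\<lambda>x. f x * cos (n \<bullet> x + \<theta>))" by (intro continuous_intros c)
  show "periodic3 (\<lambda>x. f x * cos (n \<bullet> x + \<theta>))"
    using f unfolding tame_def by (intro periodic3_mult periodic3_cos n) blast
  show "((\<lambda>t. f (x + axis j t) * cos (n \<bullet> (x + axis j t) + \<theta>)) has_real_derivative f' x * cos (n \<bullet> x + \<theta>) - n $ j * (f x * sin (n \<bullet> x + \<theta>))) (at 0)" for x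
  proof -
    have d: "((\<lambda>t. f (x + axis j t)) has_real_derivative f' x) (at 0)" using f unfolding tame_def by blast
    have "((\<lambda>t. cos (n \<bullet> (x + axis j t) + \<theta>)) has_real_derivative - (sin (n \<bullet> x + \<theta>) * n $ j)) (at 0)"
      unfolding inner_add_right inner_axis_real by (auto intro!: derivative_eq_intros)
    from DERIV_mult[OF d this] show ?thesis by (simp add: axis_zero algebra_simps)
  qed
  obtain L where L: "\<And>x h. x \<in> period_box \<Longrightarrow> 0 < h \<Longrightarrow> h \<le> 1 \<Longrightarrow> \<bar>f (x + axis j h) - f x\<bar> \<le> L * h"
    using f unfolding tame_def by blast
  have "compact (f ` period_box)"
    by (intro compact_continuous_image continuous_on_subset[OF c]) (auto simp: period_box_def)
  then obtain B where B: "\<And>x. x \<in> period_box \<Longrightarrow> \<bar>f x\<bar> \<le> B"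
    by (metis compact_imp_bounded bounded_iff image_eqI real_norm_def)
  show "\<exists>L. \<forall>x\<in>period_box. \<forall>h. 0 < h \<and> h \<le> 1 \<longrightarrow> \<bar>f (x + axis j h) * cos (n \<bullet> (x + axis j h) + \<theta>) - f x * cos (n \<bullet> x + \<theta>)\<bar> \<le> L * h"
  proof (intro exI[of _ "L + B * \<bar>n $ j\<bar>"] ballI allI impI)
    fix x h assume x: "x \<in> period_box" and h: "0 < h \<and> h \<le> (1::real)"
    let ?u = "n \<bullet> (x + axis j h) + \<theta>" and ?v = "n \<bullet> x + \<theta>"
    have "\<bar>cos ?u - cos ?v\<bar> \<le> \<bar>?u - ?v\<bar>" by (rule abs_cos_diff_le)
    also have "\<dots> = \<bar>n $ j\<bar> * h" using h by (simp add: inner_add_right inner_axis_real abs_mult)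
    finally have 1: "\<bar>cos ?u - cos ?v\<bar> \<le> \<bar>n $ j\<bar> * h" .
    have "f (x + axis j h) * cos ?u - f x * cos ?v = (f (x + axis j h) - f x) * cos ?u + f x * (cos ?u - cos ?v)"
      by (simp add: algebra_simps)
    also have "\<bar>\<dots>\<bar> \<le> \<bar>f (x + axis j h) - f x\<bar> * \<bar>cos ?u\<bar> + \<bar>f x\<bar> * \<bar>cos ?u - cos ?v\<bar>"
      by (rule order_trans[OF abs_triangle_ineq]) (simp add: abs_mult)
    also have "\<dots> \<le> (L * h) * 1 + B * (\<bar>n $ j\<bar> * h)"
    proof (intro add_mono mult_mono)
      show "0 \<le> L * h" using L[OF x, of h] h by (smt (verit))
      show "0 \<le> B" using B[OF x] by linarith
    qed (use L[OF x, of h] h B[OF x] 1 in auto)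
    finally show "\<bar>f (x + axis j h) * cos ?u - f x * cos ?v\<bar> \<le> (L + B * \<bar>n $ j\<bar>) * h" by (simp add: algebra_simps)
  qed
qed

lemma tame_const: "tame j (\<lambda>x. c) (\<lambda>x. 0)"
proof -
  have "\<exists>L. \<forall>x\<in>period_box. \<forall>h. 0 < h \<and> h \<le> (1::real) \<longrightarrow> \<bar>c - c\<bar> \<le> L * h" by (rule exI[of _ 0]) simp
  then show ?thesis by (simp add: tame_def periodic3_def)
qed

text \<open>Real form of a Fourier coefficient: \<open>\<theta> = 0\<close> gives the cosine part
  and \<open>\<theta> = - pi / 2\<close> the sine part. Multiplication by \<open>\<i>\<close>
  becomes a quarter-period shift of \<open>\<theta>\<close>.\<close>

definition fcoeff :: "(real ^ 3 \<Rightarrow> real) \<Rightarrow> real ^ 3 \<Rightarrow> real \<Rightarrow> real" where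
  "fcoeff f n \<theta> = integral period_box (\<lambda>x. f x * cos (n \<bullet> x + \<theta>))"

lemma fcoeff_integrable: "continuous_on UNIV f \<Longrightarrow> (\<lambda>x. f x * cos (n \<bullet> x + \<theta>)) integrable_on period_box"
  by (intro integrable_period continuous_intros)

text \<open>The derivative of \<open>f * cos\<close> integrates to zero, and the sine it produces is
  a cosine of shifted phase.\<close>

lemma tame_fcoeff:
  assumes f: "tame j f f'" and n: "n \<in> int_vecs"
  shows "(\<lambda>x. f' x * cos (n \<bullet> x + \<theta>)) integrable_on period_box" "fcoeff f' n \<theta> = n $ j * fcoeff f n (\<theta> - pi / 2)"
proof -
  have c: "continuous_on UNIV f" using f unfolding tame_def by blast
  let ?s = "\<lambda>x. n $ j * (f x * sin (n \<bullet> x + \<theta>))"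
  have s: "?s integrable_on period_box" by (intro integrable_period continuous_intros c)
  note t = tame_integral_derivative[OF tame_mult_cos[OF f n, of \<theta>]]
  have e: "(\<lambda>x. (f' x * cos (n \<bullet> x + \<theta>) - ?s x) + ?s x) = (\<lambda>x. f' x * cos (n \<bullet> x + \<theta>))" by simp
  show "(\<lambda>x. f' x * cos (n \<bullet> x + \<theta>)) integrable_on period_box"
    using integrable_add[OF t(1) s] unfolding e .
  have "fcoeff f' n \<theta> = integral period_box (\<lambda>x. (f' x * cos (n \<bullet> x + \<theta>) - ?s x) + ?s x)" unfolding e fcoeff_def ..
  also have "\<dots> = integral period_box ?s" using integral_add[OF t(1) s] t(2) by simp
  also have "\<dots> = n $ j * integral period_box (\<lambda>x. f x * sin (n \<bullet> x + \<theta>))" by simp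
  also have "(\<lambda>x. f x * sin (n \<bullet> x + \<theta>)) = (\<lambda>x. f x * cos (n \<bullet> x + (\<theta> - pi / 2)))"
    by (simp add: fun_eq_iff cos_diff algebra_simps cos_add sin_add)
  finally show "fcoeff f' n \<theta> = n $ j * fcoeff f n (\<theta> - pi / 2)" by (simp add: fcoeff_def)
qed

section \<open>Orthogonality, density and uniqueness of Fourier coefficients\<close>

definition box_volume :: real where
  "box_volume = integral period_box (\<lambda>x. 1)"

lemma box_volume_pos: "box_volume > 0"
proof -
  have "box_volume \<noteq> 0"
  proof
    assume 0: "box_volume = 0"
    have ne: "box (0 :: real ^ 3) (\<chi> i. 2 * pi) \<noteq> {}" by (simp add: interval_ne_empty_cart)
    have "(\<forall>x\<in>cbox 0 (\<chi> i. 2 * pi) :: (real ^ 3) set. (1::real) = 0)"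
      using 0 integral_cbox_eq_0_iff[OF continuous_on_const ne, of "1::real"] unfolding box_volume_def period_box_def by simp
    then show False using ne box_subset_cbox by fastforce
  qed
  moreover have "box_volume \<ge> 0" unfolding box_volume_def by (rule integral_nonneg) (auto intro: integrable_period)
  ultimately show ?thesis by simp
qed

text \<open>For \<open>n \<noteq> 0\<close>, integration by parts against the constant 1 turns the
  coefficient of its zero derivative into \<open>n $ j\<close> times the integral.\<close>

lemma integral_cos:
  assumes "n \<in> int_vecs"
  shows "integral period_box (\<lambda>x. cos (n \<bullet> x + \<theta>)) = (if n = 0 then box_volume * cos \<theta> else 0)"
proof (cases "n = 0")
  case True
  have "integral period_box (\<lambda>x. cos \<theta> * 1) = cos \<theta> * box_volume" unfolding box_volume_def by (rule integral_mult_right)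
  then show ?thesis using True by simp
next
  case False
  then obtain j where j: "n $ j \<noteq> 0" by (auto simp: vec_eq_iff)
  have "n $ j * fcoeff (\<lambda>x. 1) n ((\<theta> + pi / 2) - pi / 2) = fcoeff (\<lambda>x. 0) n (\<theta> + pi / 2)"
    by (rule tame_fcoeff(2)[OF tame_const assms, symmetric])
  then have "fcoeff (\<lambda>x. 1) n \<theta> = 0" using j by (simp add: fcoeff_def)
  then show ?thesis using False by (simp add: fcoeff_def)
qed

lemma fcoeff_cos:
  assumes "n \<in> int_vecs" "m \<in> int_vecs"
  shows "fcoeff (\<lambda>x. cos (n \<bullet> x + \<phi>)) m \<theta> = box_volume / 2 * ((if n = m then cos (\<phi> - \<theta>) else 0) + (if n = - m then cos (\<phi> + \<theta>) else 0))"
proof -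
  have e: "cos (n \<bullet> x + \<phi>) * cos (m \<bullet> x + \<theta>) = (1/2) * cos ((n - m) \<bullet> x + (\<phi> - \<theta>)) + (1/2) * cos ((n + m) \<bullet> x + (\<phi> + \<theta>))" for x
    unfolding cos_times_cos by (simp add: inner_diff_left inner_add_left algebra_simps add_divide_distrib)
  have "fcoeff (\<lambda>x. cos (n \<bullet> x + \<phi>)) m \<theta> = (1/2) * integral period_box (\<lambda>x. cos ((n - m) \<bullet> x + (\<phi> - \<theta>))) + (1/2) * integral period_box (\<lambda>x. cos ((n + m) \<bullet> x + (\<phi> + \<theta>)))"
    unfolding fcoeff_def e by (subst integral_add) (auto intro!: integrable_period continuous_intros)
  also have "\<dots> = box_volume / 2 * ((if n = m then cos (\<phi> - \<theta>) else 0) + (if n = - m then cos (\<phi> + \<theta>) else 0))"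
    unfolding integral_cos[OF int_vecs_diff[OF assms]] integral_cos[OF int_vecs_add[OF assms]] eq_neg_iff_add_eq_0[of n m] right_minus_eq
    by (simp add: distrib_left)
  finally show ?thesis .
qed

lemma trig_poly_dense:
  fixes f :: "real ^ 3 \<Rightarrow> real"
  assumes f: "continuous_on UNIV f" "periodic3 f" and e: "e > 0"
  obtains T where "trig_poly int_vecs T" "\<And>x. \<bar>f x - T x\<bar> < e"
proof -
  note ring = int_vecs_0 int_vecs_add int_vecs_diff
  define R where "R = {g :: torus3 \<Rightarrow> real. trig_poly int_vecs (\<lambda>v. g (tproj v))}"
  interpret function_ring_on R UNIV
  proof
    show "compact (UNIV :: torus3 set)" by (rule compact_torus)
  next
    fix g assume "g \<in> R"
    then show "continuous_on UNIV g" by (intro continuous_on_torus trig_poly_continuous) (simp add: R_def)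
  next
    fix g h assume "g \<in> R" "h \<in> R"
    then show "(\<lambda>x. g x + h x) \<in> R" "(\<lambda>x. g x * h x) \<in> R"
      using trig_poly_mult[OF ring] by (auto simp: R_def intro: trig_poly_add)
  next
    fix c show "(\<lambda>_. c) \<in> R" using trig_poly_const[OF ring] by (simp add: R_def)
  next
    fix p q :: torus3 assume "p \<noteq> q"
    then obtain i where i: "p $ i \<noteq> q $ i" by (auto simp: vec_eq_iff)
    obtain a where a: "tproj a = p" using tproj_surj by blast
    obtain b where b: "tproj b = q" using tproj_surj by blast
    define n :: "real ^ 3" where "n = axis i 1"
    have n: "n \<in> int_vecs" by (simp add: n_def int_vecs_def axis_def)
    have nv: "n \<bullet> v = v $ i" for v by (simp add: n_def inner_axis')
    \<comment> \<open>This cosine has value 1 exactly where the \<open>i\<close>-th coordinate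
      agrees with that of \<open>q\<close>, so it separates \<open>p\<close> from
      \<open>q\<close>.\<close>
    define g where "g = descend (\<lambda>v. 1 * cos (n \<bullet> v + (- b $ i)))"
    have gt: "g (tproj v) = 1 * cos (n \<bullet> v + (- b $ i))" for v
      unfolding g_def by (rule descend_tproj) (use periodic3_cos[OF n, of "- b $ i"] in simp)
    have "g \<in> R" unfolding R_def mem_Collect_eq gt using n by (rule trig_poly_cos)
    moreover have "g p \<noteq> g q"
    proof
      assume "g p = g q"
      then have "cos (a $ i - b $ i) = 1" using gt[of a] gt[of b] by (simp add: a b nv)
      then obtain k :: int where "a $ i - b $ i = of_int k * (2 * pi)" unfolding cos_one_2pi_int by (auto simp: mult.assoc)
      then have "circ (b $ i) = circ (a $ i)" unfolding circ_eq_iff by (intro exI[of _ k]) simp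
      then show False using i a b by (auto simp: tproj_def)
    qed
    ultimately show "\<exists>f\<in>R. f p \<noteq> f q" by blast
  qed
  have "continuous_on UNIV (descend f)"
    by (rule continuous_on_torus) (simp add: descend_tproj[OF f(2)] f(1))
  then obtain F where F: "F \<in> UNIV \<rightarrow> R" "LIM n sequentially. F n :> uniformly_on UNIV (descend f)"
    using Stone_Weierstrass by blast
  then obtain N :: nat where N: "\<And>p. dist (F N p) (descend f p) < e"
    using e unfolding uniform_limit_iff eventually_sequentially by blast
  show ?thesis
  proof (rule that[of "\<lambda>v. F N (tproj v)"])
    show "trig_poly int_vecs (\<lambda>v. F N (tproj v))" using F(1) by (auto simp: R_def)
    show "\<bar>f x - F N (tproj x)\<bar> < e" for x
      using N[of "tproj x"] by (simp add: descend_tproj[OF f(2)] dist_real_def abs_minus_commute)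
  qed
qed

text \<open>\<open>f\<close> is orthogonal to every trigonometric polynomial. Subtracting a uniform
  approximation bounds the integral of \<open>f * f\<close> by an arbitrarily small multiple of that
  of \<open>\<bar>f\<bar>\<close>.\<close>

lemma fcoeff_unique:
  fixes f :: "real ^ 3 \<Rightarrow> real"
  assumes f: "continuous_on UNIV f" "periodic3 f" and z: "\<And>n \<theta>. n \<in> int_vecs \<Longrightarrow> fcoeff f n \<theta> = 0"
  shows "f x = 0"
proof -
  have orth: "integral period_box (\<lambda>x. f x * T x) = 0" if "trig_poly int_vecs T" for T
    using that
  proof (induction rule: trig_poly.induct)
    case (trig_poly_cos m a \<theta>)
    have "integral period_box (\<lambda>x. f x * (a * cos (m \<bullet> x + \<theta>))) = a * fcoeff f m \<theta>"
      unfolding fcoeff_def by (subst integral_mult_right[symmetric]) (simp add: mult.left_commute)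
    then show ?case using z trig_poly_cos by simp
  next
    case (trig_poly_add S T)
    have c: "continuous_on UNIV S" "continuous_on UNIV T" using trig_poly_add by (auto intro: trig_poly_continuous)
    have "integral period_box (\<lambda>x. f x * (S x + T x)) = integral period_box (\<lambda>x. f x * S x) + integral period_box (\<lambda>x. f x * T x)"
      unfolding distrib_left by (intro integral_add integrable_period continuous_on_mult f(1) c)
    then show ?case using trig_poly_add by simp
  qed
  have i2: "(\<lambda>x. f x * f x) integrable_on period_box" by (intro integrable_period continuous_intros f)
  have le: "integral period_box (\<lambda>x. f x * f x) \<le> e * integral period_box (\<lambda>x. \<bar>f x\<bar>)" if e: "e > 0" for e
  proof -
    obtain T where T: "trig_poly int_vecs T" "\<And>x. \<bar>f x - T x\<bar> < e" using trig_poly_dense[OF f e] by blast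
    have Tc: "continuous_on UNIV T" using T(1) by (rule trig_poly_continuous)
    have "integral period_box (\<lambda>x. f x * f x) = integral period_box (\<lambda>x. f x * f x) - integral period_box (\<lambda>x. f x * T x)"
      using orth[OF T(1)] by simp
    also have "\<dots> = integral period_box (\<lambda>x. f x * f x - f x * T x)"
      by (intro integral_diff[symmetric] integrable_period continuous_intros f Tc)
    also have "\<dots> \<le> integral period_box (\<lambda>x. e * \<bar>f x\<bar>)"
    proof (intro integral_le integrable_period continuous_intros f Tc)
      fix x
      have "f x * f x - f x * T x \<le> \<bar>f x * (f x - T x)\<bar>" by (simp add: right_diff_distrib)
      also have "\<dots> \<le> \<bar>f x\<bar> * e" unfolding abs_mult using T(2)[of x] by (intro mult_left_mono) auto
      finally show "f x * f x - f x * T x \<le> e * \<bar>f x\<bar>" by (simp add: mult.commute)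
    qed
    also have "\<dots> = e * integral period_box (\<lambda>x. \<bar>f x\<bar>)" by simp
    finally show ?thesis .
  qed
  have "integral period_box (\<lambda>x. f x * f x) \<le> 0"
  proof (rule field_le_epsilon)
    fix e :: real assume e: "e > 0"
    define A where "A = integral period_box (\<lambda>x. \<bar>f x\<bar>)"
    have A: "A \<ge> 0" unfolding A_def by (intro integral_nonneg integrable_period continuous_intros f) auto
    have "integral period_box (\<lambda>x. f x * f x) \<le> (e / (A + 1)) * A" unfolding A_def
      using e A by (intro le) (simp add: A_def)
    also have "\<dots> \<le> e" using e A by (simp add: field_simps)
    finally show "integral period_box (\<lambda>x. f x * f x) \<le> 0 + e" by simp
  qed
  moreover have "integral period_box (\<lambda>x. f x * f x) \<ge> 0" by (intro integral_nonneg i2) auto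
  ultimately have "integral period_box (\<lambda>x. f x * f x) = 0" by linarith
  moreover have "box (0 :: real ^ 3) (\<chi> i. 2 * pi) \<noteq> {}" by (simp add: interval_ne_empty_cart)
  moreover have "continuous_on (cbox 0 (\<chi> i. 2 * pi)) (\<lambda>x. f x * f x)"
    by (intro continuous_intros continuous_on_subset[OF f(1)]) auto
  ultimately have 0: "\<forall>x\<in>period_box. f x * f x = 0"
    unfolding period_box_def by (subst integral_cbox_eq_0_iff[symmetric]) auto
  obtain y where y: "y \<in> period_box" "tproj y = tproj x" using tproj_period_box by (metis UNIV_I imageE)
  have "f x = descend f (tproj x)" by (rule descend_tproj[OF f(2), symmetric])
  also have "\<dots> = f y" unfolding y(2)[symmetric] by (rule descend_tproj[OF f(2)])
  finally show "f x = 0" using 0 y by simp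
qed

text \<open>The candidate sum \<open>P\<close> has the same coefficients as \<open>f\<close>, so
  uniqueness applies. The normalization is \<open>box_volume\<close>, not half of it, because the
  same real mode is counted at \<open>n\<close> and at \<open>- n\<close>; this is why
  \<open>N\<close> is symmetric and omits 0.\<close>

lemma finite_fourier_expansion:
  fixes f :: "real ^ 3 \<Rightarrow> real"
  assumes f: "continuous_on UNIV f" "periodic3 f" and N: "finite N" "N \<subseteq> int_vecs" "0 \<notin> N" "uminus ` N \<subseteq> N"
    and z: "\<And>n \<theta>. n \<in> int_vecs \<Longrightarrow> n \<notin> N \<Longrightarrow> fcoeff f n \<theta> = 0"
  shows "f x = (\<Sum>n\<in>N. fcoeff f n 0 / box_volume * cos (n \<bullet> x) + fcoeff f n (- pi / 2) / box_volume * sin (n \<bullet> x))"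
proof -
  define V where "V = box_volume"
  have V: "V > 0" using box_volume_pos by (simp add: V_def)
  define P where "P = (\<lambda>x. \<Sum>n\<in>N. fcoeff f n 0 / V * cos (n \<bullet> x + 0) + fcoeff f n (- pi / 2) / V * cos (n \<bullet> x + (- pi / 2)))"
  have Pc: "continuous_on UNIV P" unfolding P_def by (intro continuous_intros)
  have per: "cos (n \<bullet> (v + (\<chi> i. 2 * pi * of_int (k i))) + \<theta>) = cos (n \<bullet> v + \<theta>)" if "n \<in> N" for n v k \<theta>
    using periodic3_cos[of n \<theta>] N(2) that unfolding periodic3_def by blast
  have Pp: "periodic3 P"
    unfolding P_def periodic3_def by (intro allI sum.cong refl) (simp only: per)
  have phase: "fcoeff f n \<theta> = cos \<theta> * fcoeff f n 0 - sin \<theta> * fcoeff f n (- pi / 2)" for n \<theta>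
  proof -
    have "f x * cos (n \<bullet> x + \<theta>) = cos \<theta> * (f x * cos (n \<bullet> x + 0)) - sin \<theta> * (f x * cos (n \<bullet> x + - pi / 2))" for x
      by (simp add: cos_add cos_diff sin_add algebra_simps)
    then have "fcoeff f n \<theta> = integral period_box (\<lambda>x. cos \<theta> * (f x * cos (n \<bullet> x + 0)) - sin \<theta> * (f x * cos (n \<bullet> x + - pi / 2)))"
      by (simp add: fcoeff_def)
    also have "\<dots> = integral period_box (\<lambda>x. cos \<theta> * (f x * cos (n \<bullet> x + 0))) - integral period_box (\<lambda>x. sin \<theta> * (f x * cos (n \<bullet> x + - pi / 2)))"
      by (intro integral_diff integrable_period continuous_intros f)
    finally show ?thesis by (simp add: fcoeff_def)
  qed
  have neg: "fcoeff f (- n) \<theta> = fcoeff f n (- \<theta>)" for n \<theta>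
  proof -
    have "cos (- n \<bullet> x + \<theta>) = cos (n \<bullet> x + - \<theta>)" for x using cos_minus[of "n \<bullet> x + - \<theta>"] by (simp add: algebra_simps)
    then show ?thesis by (simp add: fcoeff_def)
  qed
  have fP: "fcoeff P m \<theta> = (\<Sum>n\<in>N. fcoeff f n 0 / V * fcoeff (\<lambda>x. cos (n \<bullet> x + 0)) m \<theta> + fcoeff f n (- pi / 2) / V * fcoeff (\<lambda>x. cos (n \<bullet> x + (- pi / 2))) m \<theta>)" for m \<theta>
  proof -
    have "fcoeff P m \<theta> = integral period_box (\<lambda>x. \<Sum>n\<in>N. fcoeff f n 0 / V * (cos (n \<bullet> x + 0) * cos (m \<bullet> x + \<theta>)) + fcoeff f n (- pi / 2) / V * (cos (n \<bullet> x + (- pi / 2)) * cos (m \<bullet> x + \<theta>)))"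
      unfolding fcoeff_def P_def sum_distrib_right by (simp only: distrib_right mult.assoc)
    also have "\<dots> = (\<Sum>n\<in>N. integral period_box (\<lambda>x. fcoeff f n 0 / V * (cos (n \<bullet> x + 0) * cos (m \<bullet> x + \<theta>)) + fcoeff f n (- pi / 2) / V * (cos (n \<bullet> x + (- pi / 2)) * cos (m \<bullet> x + \<theta>))))"
      by (rule integral_sum[OF N(1)]) (intro integrable_period continuous_intros)
    also have "\<dots> = (\<Sum>n\<in>N. integral period_box (\<lambda>x. fcoeff f n 0 / V * (cos (n \<bullet> x + 0) * cos (m \<bullet> x + \<theta>))) + integral period_box (\<lambda>x. fcoeff f n (- pi / 2) / V * (cos (n \<bullet> x + (- pi / 2)) * cos (m \<bullet> x + \<theta>))))"
      by (intro sum.cong refl integral_add integrable_period continuous_intros)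
    finally show ?thesis unfolding fcoeff_def by simp
  qed
  have "fcoeff P m \<theta> = fcoeff f m \<theta>" if m: "m \<in> int_vecs" for m \<theta>
  proof -
    let ?t = "\<lambda>n. (fcoeff f n 0 * ((if n = m then cos (0 - \<theta>) else 0) + (if n = - m then cos (0 + \<theta>) else 0)) +
      fcoeff f n (- pi / 2) * ((if n = m then cos (- pi / 2 - \<theta>) else 0) + (if n = - m then cos (- pi / 2 + \<theta>) else 0))) / 2"
    have "fcoeff P m \<theta> = (\<Sum>n\<in>N. ?t n)"
      unfolding fP
    proof (intro sum.cong refl)
      fix n assume "n \<in> N"
      then have n: "n \<in> int_vecs" using N by blast
      show "fcoeff f n 0 / V * fcoeff (\<lambda>x. cos (n \<bullet> x + 0)) m \<theta> + fcoeff f n (- pi / 2) / V * fcoeff (\<lambda>x. cos (n \<bullet> x + (- pi / 2))) m \<theta> = ?t n"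
        unfolding fcoeff_cos[OF n m] V_def[symmetric] using V by (simp add: add_divide_distrib)
    qed
    also have "\<dots> = fcoeff f m \<theta>"
    proof (cases "m \<in> N")
      case False
      have "- m \<notin> N" using False N(4) by (metis image_subset_iff minus_minus)
      then have "(\<Sum>n\<in>N. ?t n) = 0" using False by (intro sum.neutral) auto
      then show ?thesis using z[OF m False] by simp
    next
      case True
      have mN: "- m \<in> N" using True N(4) by blast
      have m0: "m \<noteq> 0" using True N(3) by blast
      have mm: "m \<noteq> - m"
      proof
        assume "m = - m"
        then have "2 *\<^sub>R m = 0" by (metis add.right_inverse scaleR_2)
        then show False using m0 by simp
      qed
      have "(\<Sum>n\<in>N. ?t n) = (\<Sum>n\<in>{m, - m}. ?t n)"
        using True mN by (intro sum.mono_neutral_right N(1)) auto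
      also have "\<dots> = ?t m + ?t (- m)" using mm by simp
      also have "\<dots> = cos \<theta> * fcoeff f m 0 - sin \<theta> * fcoeff f m (- pi / 2)"
        using mm phase[of m "pi / 2"] by (simp add: neg cos_add cos_diff sin_add sin_diff algebra_simps add_divide_distrib)
      finally show ?thesis unfolding phase[of m \<theta>] .
    qed
    finally show ?thesis .
  qed
  moreover have "fcoeff (\<lambda>x. f x - P x) m \<theta> = fcoeff f m \<theta> - fcoeff P m \<theta>" for m \<theta>
    unfolding fcoeff_def left_diff_distrib by (intro integral_diff fcoeff_integrable f Pc)
  ultimately have dz: "fcoeff (\<lambda>x. f x - P x) m \<theta> = 0" if "m \<in> int_vecs" for m \<theta> using that by simp
  have "periodic3 (\<lambda>x. f x - P x)" using f(2) Pp by (simp add: periodic3_def)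
  then have "f x - P x = 0" by (rule fcoeff_unique[OF continuous_on_diff[OF f(1) Pc]]) (rule dz)
  then have "f x = P x" by simp
  also have "P x = (\<Sum>n\<in>N. fcoeff f n 0 / box_volume * cos (n \<bullet> x) + fcoeff f n (- pi / 2) / box_volume * sin (n \<bullet> x))"
    unfolding P_def V_def by (intro sum.cong refl) (simp add: cos_add cos_diff)
  finally show ?thesis .
qed

section \<open>Curl eigenfields\<close>

lemma torus_analytic_has_derivative:
  assumes "torus_analytic W"
  shows "((\<lambda>v. W (p + tproj v)) has_derivative (\<lambda>h. grad W p *v h)) (at 0)"
  using assms real_analytic_at_differentiable unfolding grad_def torus_analytic_def
  by (subst jacobian_works[symmetric]) blast

lemma grad_eqI:
  assumes "((\<lambda>v. W (p + tproj v)) has_derivative F) (at 0)"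
  shows "grad W p $ i $ j = F (axis j 1) $ i"
proof -
  have "frechet_derivative (\<lambda>v. W (p + tproj v)) (at 0) = F"
    using frechet_derivative_at[OF assms] by simp
  then show ?thesis by (simp add: grad_def jacobian_def matrix_def)
qed

lemma torus_analytic_continuous:
  assumes "torus_analytic W" shows "continuous_on UNIV (\<lambda>x. W (tproj x))"
  unfolding continuous_on_eq_continuous_at[OF open_UNIV]
proof
  fix x
  have "isCont (\<lambda>v. W (tproj x + tproj v)) 0"
    using torus_analytic_has_derivative[OF assms, of "tproj x"] by (rule has_derivative_continuous)
  then have "isCont (\<lambda>v. W (tproj (x + v))) 0" by (simp add: tproj_add)
  then have "isCont (\<lambda>v. W (tproj (x + (v - x)))) x"
    by (intro continuous_at_compose[of x "\<lambda>v. v - x" "\<lambda>v. W (tproj (x + v))", unfolded o_def]) (auto intro!: continuous_intros)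
  then show "isCont (\<lambda>x. W (tproj x)) x" by simp
qed

lemma torus_analytic_lipschitz:
  assumes W: "torus_analytic W" and X: "compact X"
  obtains L where "L-lipschitz_on X (\<lambda>x. W (tproj x))"
proof -
  have "local_lipschitz {0::real} X (\<lambda>t x. W (tproj x))"
    unfolding local_lipschitz_def
  proof (intro ballI)
    fix x and t :: real assume "x \<in> X" "t \<in> {0}"
    have "real_analytic_at (\<lambda>v. W (tproj x + tproj v)) 0" using W unfolding torus_analytic_def by blast
    then obtain \<delta> C where d: "\<delta> > 0" "C \<ge> 0" "\<And>h h'. norm h < \<delta> \<Longrightarrow> norm h' < \<delta> \<Longrightarrow>
        norm (W (tproj x + tproj (0 + h)) - W (tproj x + tproj (0 + h'))) \<le> C * norm (h - h')"
      using real_analytic_at_lipschitz by blast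
    have "C-lipschitz_on (cball x (\<delta> / 2) \<inter> X) (\<lambda>x. W (tproj x))"
    proof (rule lipschitz_onI)
      fix y z assume "y \<in> cball x (\<delta> / 2) \<inter> X" "z \<in> cball x (\<delta> / 2) \<inter> X"
      then have "norm (y - x) < \<delta>" "norm (z - x) < \<delta>" using d(1) by (auto simp: dist_norm norm_minus_commute)
      from d(3)[OF this] show "dist (W (tproj y)) (W (tproj z)) \<le> C * dist y z"
        by (simp add: tproj_add dist_norm)
    qed fact
    then show "\<exists>u>0. \<exists>L. \<forall>t\<in>cball t u \<inter> {0}. L-lipschitz_on (cball x u \<inter> X) (\<lambda>x. W (tproj x))"
      using d(1) by (intro exI[of _ "\<delta> / 2"]) auto
  qed
  then show ?thesis by (rule local_lipschitz_compact_implies_lipschitz[OF _ X]) (auto intro: that)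
qed

lemma torus_analytic_tame:
  assumes W: "torus_analytic W"
  shows "tame j (\<lambda>x. W (tproj x) $ i) (\<lambda>x. grad W (tproj x) $ i $ j)"
  unfolding tame_def
proof (intro conjI allI)
  show "continuous_on UNIV (\<lambda>x. W (tproj x) $ i)" by (intro continuous_intros torus_analytic_continuous W)
  show "periodic3 (\<lambda>x. W (tproj x) $ i)" by (rule periodic3_tproj)
  show "((\<lambda>t. W (tproj (x + axis j t)) $ i) has_real_derivative grad W (tproj x) $ i $ j) (at 0)" for x
  proof -
    have ax: "(\<lambda>t. t *\<^sub>R axis j (1::real)) = axis j" by (simp add: fun_eq_iff vec_eq_iff axis_def)
    have 1: "((\<lambda>t. axis j t) has_derivative (\<lambda>t. axis j t)) (at (0::real))"
      using bounded_linear_imp_has_derivative[OF bounded_linear_scaleR_left[of "axis j (1::real)"]] unfolding ax by simp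
    have 2: "((\<lambda>v. W (tproj x + tproj v)) has_derivative (\<lambda>h. grad W (tproj x) *v h)) (at (axis j (0::real)))"
      using torus_analytic_has_derivative[OF W] by (simp add: axis_zero)
    have "((\<lambda>t. W (tproj x + tproj (axis j t))) has_derivative (\<lambda>t. grad W (tproj x) *v axis j t)) (at 0)"
      using has_derivative_compose[OF 1 2] by simp
    then have "((\<lambda>t. W (tproj x + tproj (axis j t)) $ i) has_derivative (\<lambda>t. (grad W (tproj x) *v axis j t) $ i)) (at 0)"
      by (rule bounded_linear.has_derivative[OF bounded_linear_vec_nth])
    moreover have "(grad W (tproj x) *v axis j t) $ i = grad W (tproj x) $ i $ j * t" for t
      by (simp add: matrix_vector_mult_def axis_def if_distrib cong: if_cong)
    ultimately show ?thesis by (simp add: has_field_derivative_def tproj_add)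
  qed
  \<comment> \<open>Enlarged by 1 so that it also contains the points shifted by a step
    \<open>h \<le> 1\<close>.\<close>
  define X where "X = cbox (0 :: real ^ 3) (\<chi> i. 2 * pi + 1)"
  obtain L where L: "L-lipschitz_on X (\<lambda>x. W (tproj x))"
    using torus_analytic_lipschitz[OF W, of X] by (auto simp: X_def)
  show "\<exists>L. \<forall>x\<in>period_box. \<forall>h. 0 < h \<and> h \<le> 1 \<longrightarrow> \<bar>W (tproj (x + axis j h)) $ i - W (tproj x) $ i\<bar> \<le> L * h"
  proof (intro exI[of _ L] ballI allI impI)
    fix x h assume x: "x \<in> period_box" and h: "0 < h \<and> h \<le> (1::real)"
    have "0 \<le> x $ k + axis j h $ k \<and> x $ k + axis j h $ k \<le> 2 * pi + 1" for k
    proof -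
      have "0 \<le> x $ k" "x $ k \<le> 2 * pi" using x by (auto simp: mem_period_box)
      moreover have "axis j h $ k = (if k = j then h else 0)" by (simp add: axis_def)
      ultimately show ?thesis using h by (smt (verit))
    qed
    then have xh: "x + axis j h \<in> X" by (simp add: X_def mem_box_cart)
    have "x $ k \<le> 2 * pi + 1" for k using x unfolding mem_period_box by (smt (verit))
    then have "x \<in> X" using x by (simp add: mem_period_box X_def mem_box_cart)
    then have "dist (W (tproj (x + axis j h))) (W (tproj x)) \<le> L * dist (x + axis j h) x"
      using xh by (intro lipschitz_onD[OF L])
    also have "dist (x + axis j h) x = h" using h by (simp add: dist_norm norm_eq_sqrt_inner inner_axis_axis)
    finally show "\<bar>W (tproj (x + axis j h)) $ i - W (tproj x) $ i\<bar> \<le> L * h"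
      using component_le_norm_cart[of "W (tproj (x + axis j h)) - W (tproj x)" i] by (simp add: dist_norm)
  qed
qed

section \<open>Frequencies and curl eigenmodes\<close>

definition freqs :: "real \<Rightarrow> (real ^ 3) set" where
  "freqs lam = {n \<in> int_vecs. n \<bullet> n = lam^2}"

lemma curl_components:
  "curl W p $ 1 = grad W p $ 3 $ 2 - grad W p $ 2 $ 3"
  "curl W p $ 2 = grad W p $ 1 $ 3 - grad W p $ 3 $ 1"
  "curl W p $ 3 = grad W p $ 2 $ 1 - grad W p $ 1 $ 2"
  by (simp_all add: curl_def)

text \<open>On coefficients the curl is a cross product with \<open>n\<close> up to a quarter-period
  shift. Applying it twice to a coefficient orthogonal to \<open>n\<close> multiplies by
  \<open>n \<bullet> n\<close>, while for an eigenfield it multiplies by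
  \<open>lam^2\<close>.\<close>

lemma eigenfield_fcoeff:
  assumes W: "W \<in> curl_eigenspace lam" and lam0: "lam > 0" and n: "n \<in> int_vecs" "n \<notin> freqs lam"
  shows "fcoeff (\<lambda>x. W (tproj x) $ i) n \<theta> = 0"
proof -
  have an: "torus_analytic W" and cu: "\<And>p. curl W p = lam *\<^sub>R W p" using W by (auto simp: curl_eigenspace_def)
  define c where "c = (\<lambda>i \<theta>. fcoeff (\<lambda>x. W (tproj x) $ i) n \<theta>)"
  note g = tame_fcoeff[OF torus_analytic_tame[OF an] n(1)]
  have curlc: "lam * c k \<theta> = n $ j * c i (\<theta> - pi / 2) - n $ j' * c i' (\<theta> - pi / 2)"
    if "\<And>p. lam * W p $ k = grad W p $ i $ j - grad W p $ i' $ j'" for k i j i' j' \<theta>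
  proof -
    have "lam * c k \<theta> = integral period_box (\<lambda>x. (lam * W (tproj x) $ k) * cos (n \<bullet> x + \<theta>))"
      unfolding c_def fcoeff_def mult.assoc by simp
    also have "\<dots> = integral period_box (\<lambda>x. grad W (tproj x) $ i $ j * cos (n \<bullet> x + \<theta>) - grad W (tproj x) $ i' $ j' * cos (n \<bullet> x + \<theta>))"
      unfolding that left_diff_distrib ..
    also have "\<dots> = fcoeff (\<lambda>x. grad W (tproj x) $ i $ j) n \<theta> - fcoeff (\<lambda>x. grad W (tproj x) $ i' $ j') n \<theta>"
      unfolding fcoeff_def by (intro integral_diff g(1))
    finally show ?thesis unfolding g(2) c_def .
  qed
  have comp: "lam * W p $ k = curl W p $ k" for p k using cu[of p] by simp
  have c1: "lam * c 1 \<theta> = n $ 2 * c 3 (\<theta> - pi / 2) - n $ 3 * c 2 (\<theta> - pi / 2)"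
    and c2: "lam * c 2 \<theta> = n $ 3 * c 1 (\<theta> - pi / 2) - n $ 1 * c 3 (\<theta> - pi / 2)"
    and c3: "lam * c 3 \<theta> = n $ 1 * c 2 (\<theta> - pi / 2) - n $ 2 * c 1 (\<theta> - pi / 2)" for \<theta>
    using curlc[of 1 3 2 2 3 \<theta>] curlc[of 2 1 3 3 1 \<theta>] curlc[of 3 2 1 1 2 \<theta>] unfolding comp curl_components by auto
  \<comment> \<open>Two quarter-period shifts change the sign, the real counterpart of the square of
    \<open>\<i>\<close>.\<close>
  have neg: "c i (\<theta> - pi / 2 - pi / 2) = - c i \<theta>" for i
  proof -
    have "cos (n \<bullet> x + (\<theta> - pi / 2 - pi / 2)) = - cos (n \<bullet> x + \<theta>)" for x
      using cos_minus_pi[of "n \<bullet> x + \<theta>"] by (simp add: algebra_simps)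
    then show ?thesis by (simp add: c_def fcoeff_def)
  qed
  have "lam * (n $ 1 * c 1 \<theta> + n $ 2 * c 2 \<theta> + n $ 3 * c 3 \<theta>) = n $ 1 * (lam * c 1 \<theta>) + n $ 2 * (lam * c 2 \<theta>) + n $ 3 * (lam * c 3 \<theta>)"
    by (simp add: algebra_simps)
  also have "\<dots> = 0" unfolding c1 c2 c3 by (simp add: algebra_simps)
  finally have div: "n $ 1 * c 1 \<theta> + n $ 2 * c 2 \<theta> + n $ 3 * c 3 \<theta> = 0" using lam0 by simp
  define s where "s = n $ 1 * c 1 \<theta> + n $ 2 * c 2 \<theta> + n $ 3 * c 3 \<theta>"
  have nn: "n \<bullet> n = n $ 1 * n $ 1 + n $ 2 * n $ 2 + n $ 3 * n $ 3" by (rule inner_real3)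
  have "lam * (lam * c 1 \<theta>) = n $ 2 * (lam * c 3 (\<theta> - pi / 2)) - n $ 3 * (lam * c 2 (\<theta> - pi / 2))"
    unfolding c1[of \<theta>] by (simp add: algebra_simps)
  also have "\<dots> = (n \<bullet> n) * c 1 \<theta> - n $ 1 * s"
    unfolding c2 c3 neg nn s_def by (simp add: algebra_simps)
  finally have 1: "lam^2 * c 1 \<theta> = (n \<bullet> n) * c 1 \<theta>" using div by (simp add: s_def power2_eq_square)
  have "lam * (lam * c 2 \<theta>) = n $ 3 * (lam * c 1 (\<theta> - pi / 2)) - n $ 1 * (lam * c 3 (\<theta> - pi / 2))"
    unfolding c2[of \<theta>] by (simp add: algebra_simps)
  also have "\<dots> = (n \<bullet> n) * c 2 \<theta> - n $ 2 * s"
    unfolding c1 c3 neg nn s_def by (simp add: algebra_simps)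
  finally have 2: "lam^2 * c 2 \<theta> = (n \<bullet> n) * c 2 \<theta>" using div by (simp add: s_def power2_eq_square)
  have "lam * (lam * c 3 \<theta>) = n $ 1 * (lam * c 2 (\<theta> - pi / 2)) - n $ 2 * (lam * c 1 (\<theta> - pi / 2))"
    unfolding c3[of \<theta>] by (simp add: algebra_simps)
  also have "\<dots> = (n \<bullet> n) * c 3 \<theta> - n $ 3 * s"
    unfolding c1 c2 neg nn s_def by (simp add: algebra_simps)
  finally have 3: "lam^2 * c 3 \<theta> = (n \<bullet> n) * c 3 \<theta>" using div by (simp add: s_def power2_eq_square)
  have "n \<bullet> n \<noteq> lam^2" using n by (simp add: freqs_def)
  then have "c 1 \<theta> = 0" "c 2 \<theta> = 0" "c 3 \<theta> = 0" using 1 2 3 by auto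
  then have "c i \<theta> = 0" using exhaust_3[of i] by auto
  then show ?thesis by (simp add: c_def)
qed

lemma finite_freqs: "finite (freqs lam)"
proof -
  define B where "B = {t :: real. t \<in> \<int> \<and> \<bar>t\<bar> \<le> \<bar>lam\<bar>}"
  have "finite B" unfolding B_def by (rule finite_abs_int_segment)
  then have "finite ((\<lambda>(a, b, c). vector [a, b, c] :: real ^ 3) ` (B \<times> B \<times> B))" by simp
  moreover have "freqs lam \<subseteq> (\<lambda>(a, b, c). vector [a, b, c]) ` (B \<times> B \<times> B)"
  proof
    fix n assume n: "n \<in> freqs lam"
    have "n $ i \<in> B" for i
    proof -
      have "(n $ i)^2 \<le> n \<bullet> n" unfolding inner_real3 power2_eq_square using exhaust_3[of i] by auto
      then have "(n $ i)^2 \<le> lam^2" using n by (simp add: freqs_def)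
      then show ?thesis using n by (simp add: B_def freqs_def int_vecs_def abs_le_square_iff)
    qed
    moreover have "n = vector [n $ 1, n $ 2, n $ 3]" by (simp add: vec_eq_iff forall_3)
    ultimately show "n \<in> (\<lambda>(a, b, c). vector [a, b, c]) ` (B \<times> B \<times> B)"
      by (intro image_eqI[of _ _ "(n $ 1, n $ 2, n $ 3)"]) auto
  qed
  ultimately show ?thesis by (rule finite_subset[rotated])
qed

text \<open>A field may have several such expansions; below, two expansions of one eigenfield with
  different phases are compared.\<close>

definition trig_field :: "'i set \<Rightarrow> ('i \<Rightarrow> real ^ 3) \<Rightarrow> ('i \<Rightarrow> real) \<Rightarrow> ('i \<Rightarrow> real ^ 3) \<Rightarrow> (torus3 \<Rightarrow> real ^ 3) \<Rightarrow> bool" where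
  "trig_field I n \<theta> a W \<longleftrightarrow> (\<forall>x. W (tproj x) = (\<Sum>k\<in>I. cos (n k \<bullet> x + \<theta> k) *\<^sub>R a k))"

lemma eigenfield_trig_field:
  assumes W: "W \<in> curl_eigenspace lam" and lam0: "lam > 0"
  obtains a where "trig_field (freqs lam \<times> {0, - pi / 2}) fst snd a W"
proof -
  have an: "torus_analytic W" using W by (auto simp: curl_eigenspace_def)
  let ?f = "\<lambda>i x. W (tproj x) $ i"
  define a where "a = (\<lambda>k :: (real ^ 3) \<times> real. (\<chi> i. fcoeff (?f i) (fst k) (snd k) / box_volume) :: real ^ 3)"
  have e: "W (tproj x) $ i = (\<Sum>n\<in>freqs lam. fcoeff (?f i) n 0 / box_volume * cos (n \<bullet> x) + fcoeff (?f i) n (- pi / 2) / box_volume * sin (n \<bullet> x))" for x i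
  proof (rule finite_fourier_expansion)
    show "continuous_on UNIV (?f i)" by (intro continuous_intros torus_analytic_continuous an)
    show "periodic3 (?f i)" by (rule periodic3_tproj)
    show "0 \<notin> freqs lam" using lam0 by (simp add: freqs_def)
    show "uminus ` freqs lam \<subseteq> freqs lam" by (auto simp: freqs_def int_vecs_uminus)
    show "fcoeff (?f i) n \<theta> = 0" if "n \<in> int_vecs" "n \<notin> freqs lam" for n \<theta>
      by (rule eigenfield_fcoeff[OF W lam0 that])
    show "finite (freqs lam)" by (rule finite_freqs)
    show "freqs lam \<subseteq> int_vecs" by (auto simp: freqs_def)
  qed
  have "W (tproj x) = (\<Sum>k\<in>freqs lam \<times> {0, - pi / 2}. cos (fst k \<bullet> x + snd k) *\<^sub>R a k)" for x
  proof -
    have "(\<Sum>k\<in>freqs lam \<times> {0, - pi / 2}. cos (fst k \<bullet> x + snd k) *\<^sub>R a k) =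
      (\<Sum>n\<in>freqs lam. \<Sum>\<theta>\<in>{0, - pi / 2}. cos (n \<bullet> x + \<theta>) *\<^sub>R a (n, \<theta>))"
      by (subst sum.cartesian_product) (simp add: split_def)
    also have "\<dots> = (\<Sum>n\<in>freqs lam. cos (n \<bullet> x) *\<^sub>R a (n, 0) + sin (n \<bullet> x) *\<^sub>R a (n, - pi / 2))"
      by (simp add: cos_diff)
    also have "\<dots> = W (tproj x)"
      unfolding vec_eq_iff by (intro allI, subst e) (simp add: a_def mult.commute)
    finally show ?thesis by simp
  qed
  then show ?thesis using that unfolding trig_field_def by blast
qed

lemma trig_field_grad:
  assumes W: "trig_field I n \<theta> a W" and I: "finite I"
  shows "grad W (tproj x) $ i $ j = (\<Sum>k\<in>I. - sin (n k \<bullet> x + \<theta> k) * n k $ j * a k $ i)"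
proof -
  have "((\<lambda>v. \<Sum>k\<in>I. cos (n k \<bullet> (x + v) + \<theta> k) *\<^sub>R a k) has_derivative (\<lambda>h. \<Sum>k\<in>I. (- sin (n k \<bullet> x + \<theta> k) * (n k \<bullet> h)) *\<^sub>R a k)) (at 0)"
    by (auto intro!: derivative_eq_intros sum.cong simp: inner_add_right)
  then have "((\<lambda>v. W (tproj x + tproj v)) has_derivative (\<lambda>h. \<Sum>k\<in>I. (- sin (n k \<bullet> x + \<theta> k) * (n k \<bullet> h)) *\<^sub>R a k)) (at 0)"
    using W by (simp add: trig_field_def tproj_add)
  from grad_eqI[OF this, of i j] show ?thesis by (simp add: inner_axis mult.assoc)
qed

lemma cross3_components:
  "cross3 x y $ 1 = x $ 2 * y $ 3 - y $ 2 * x $ 3"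
  "cross3 x y $ 2 = x $ 3 * y $ 1 - y $ 3 * x $ 1"
  "cross3 x y $ 3 = x $ 1 * y $ 2 - y $ 1 * x $ 2"
  by (simp_all add: cross3_def)

lemma trig_field_curl:
  assumes W: "trig_field I n \<theta> a W" and I: "finite I"
  shows "curl W (tproj x) = (\<Sum>k\<in>I. - sin (n k \<bullet> x + \<theta> k) *\<^sub>R cross3 (n k) (a k))"
  unfolding vec_eq_iff forall_3 curl_components trig_field_grad[OF W I]
  by (simp add: cross3_components sum_subtractf[symmetric] algebra_simps)

lemma trig_field_analytic:
  assumes W: "trig_field I n \<theta> a W" and I: "finite I" shows "torus_analytic W"
  unfolding torus_analytic_def
proof
  fix p obtain u where u: "tproj u = p" using tproj_surj by blast
  have "real_analytic_at (\<lambda>v. \<Sum>k\<in>I. cos (n k \<bullet> v + (n k \<bullet> u + \<theta> k)) *\<^sub>R a k) 0"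
    by (intro real_analytic_at_sum I real_analytic_at_cos)
  also have "(\<lambda>v. \<Sum>k\<in>I. cos (n k \<bullet> v + (n k \<bullet> u + \<theta> k)) *\<^sub>R a k) = (\<lambda>v. W (p + tproj v))"
    using W unfolding u[symmetric] tproj_add trig_field_def by (simp add: inner_add_right algebra_simps)
  finally show "real_analytic_at (\<lambda>v. W (p + tproj v)) 0" .
qed

text \<open>The real part of \<open>exp (\<i> (n \<bullet> x + \<theta>))\<close> times
  \<open>lam^2 a - (n \<bullet> a) n + \<i> lam (n \<times> a)\<close>. For
  \<open>a = axis 1 1\<close> the amplitude is the complex polarization vector used for the
  separation of tensors.\<close>

definition beltrami_mode :: "real \<Rightarrow> real ^ 3 \<Rightarrow> real \<Rightarrow> real ^ 3 \<Rightarrow> torus3 \<Rightarrow> real ^ 3" where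
  "beltrami_mode lam n \<theta> a = descend (\<lambda>x. cos (n \<bullet> x + \<theta>) *\<^sub>R (lam^2 *\<^sub>R a - (n \<bullet> a) *\<^sub>R n) - sin (n \<bullet> x + \<theta>) *\<^sub>R (lam *\<^sub>R cross3 n a))"

lemma beltrami_mode_tproj:
  assumes "n \<in> int_vecs"
  shows "beltrami_mode lam n \<theta> a (tproj x) = cos (n \<bullet> x + \<theta>) *\<^sub>R (lam^2 *\<^sub>R a - (n \<bullet> a) *\<^sub>R n) - sin (n \<bullet> x + \<theta>) *\<^sub>R (lam *\<^sub>R cross3 n a)"
proof -
  have s: "sin t = cos (t + (- pi / 2))" for t :: real by (simp add: cos_diff)
  have "periodic3 (\<lambda>x. cos (n \<bullet> x + \<theta>))" "periodic3 (\<lambda>x. sin (n \<bullet> x + \<theta>))"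
    using periodic3_cos[OF assms] unfolding s add.assoc by blast+
  then have "periodic3 (\<lambda>x. cos (n \<bullet> x + \<theta>) *\<^sub>R (lam^2 *\<^sub>R a - (n \<bullet> a) *\<^sub>R n) - sin (n \<bullet> x + \<theta>) *\<^sub>R (lam *\<^sub>R cross3 n a))"
    by (simp add: periodic3_def)
  then show ?thesis unfolding beltrami_mode_def by (rule descend_tproj)
qed

lemma beltrami_mode_trig_field:
  assumes "n \<in> int_vecs"
  shows "trig_field (UNIV :: bool set) (\<lambda>_. n) (\<lambda>b. if b then \<theta> else \<theta> + pi / 2)
    (\<lambda>b. if b then lam^2 *\<^sub>R a - (n \<bullet> a) *\<^sub>R n else lam *\<^sub>R cross3 n a) (beltrami_mode lam n \<theta> a)"
proof -
  have "cos (n \<bullet> x + (\<theta> + pi / 2)) = - sin (n \<bullet> x + \<theta>)" for x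
    using cos_add[of "n \<bullet> x + \<theta>" "pi / 2"] by (simp add: add.assoc)
  then show ?thesis unfolding trig_field_def by (simp add: beltrami_mode_tproj[OF assms] UNIV_bool)
qed

lemma beltrami_mode_grad:
  assumes "n \<in> int_vecs"
  shows "grad (beltrami_mode lam n \<theta> a) (tproj x) $ i $ j =
    (- sin (n \<bullet> x + \<theta>) * (lam^2 * a $ i - (n \<bullet> a) * n $ i) - cos (n \<bullet> x + \<theta>) * (lam * cross3 n a $ i)) * n $ j"
proof -
  have "sin (n \<bullet> x + (\<theta> + pi / 2)) = cos (n \<bullet> x + \<theta>)"
    using sin_add[of "n \<bullet> x + \<theta>" "pi / 2"] by (simp add: add.assoc)
  then show ?thesis unfolding trig_field_grad[OF beltrami_mode_trig_field[OF assms] finite_class.finite_UNIV]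
    by (simp add: UNIV_bool algebra_simps)
qed

lemma beltrami_mode_eigenfield:
  assumes n: "n \<in> freqs lam" shows "beltrami_mode lam n \<theta> a \<in> curl_eigenspace lam"
proof -
  have ni: "n \<in> int_vecs" and nn: "n \<bullet> n = lam^2" using n by (auto simp: freqs_def)
  note tf = beltrami_mode_trig_field[OF ni, of \<theta> lam a]
  have "curl (beltrami_mode lam n \<theta> a) p = lam *\<^sub>R beltrami_mode lam n \<theta> a p" for p
  proof -
    obtain x where x: "tproj x = p" using tproj_surj by blast
    have s: "sin (n \<bullet> x + (\<theta> + pi / 2)) = cos (n \<bullet> x + \<theta>)"
      using sin_add[of "n \<bullet> x + \<theta>" "pi / 2"] by (simp add: add.assoc)
    have "curl (beltrami_mode lam n \<theta> a) (tproj x) = - sin (n \<bullet> x + \<theta>) *\<^sub>R cross3 n (lam^2 *\<^sub>R a - (n \<bullet> a) *\<^sub>R n)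
        + - sin (n \<bullet> x + (\<theta> + pi / 2)) *\<^sub>R cross3 n (lam *\<^sub>R cross3 n a)"
      unfolding trig_field_curl[OF tf finite_class.finite_UNIV] by (simp add: UNIV_bool)
    note cb = this
    have c1: "cross3 n (lam^2 *\<^sub>R a - (n \<bullet> a) *\<^sub>R n) = lam^2 *\<^sub>R cross3 n a"
      by (simp add: vec_eq_iff forall_3 cross3_components algebra_simps)
    have "cross3 n (cross3 n a) = (n \<bullet> a) *\<^sub>R n - (n \<bullet> n) *\<^sub>R a"
      by (simp add: vec_eq_iff forall_3 cross3_components inner_real3 algebra_simps)
    then have c2: "cross3 n (lam *\<^sub>R cross3 n a) = lam *\<^sub>R ((n \<bullet> a) *\<^sub>R n - lam^2 *\<^sub>R a)"
      by (simp add: nn cross_mult_right)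
    show ?thesis unfolding x[symmetric] cb s c1 c2 beltrami_mode_tproj[OF ni]
      by (simp add: algebra_simps power2_eq_square)
  qed
  then show ?thesis using trig_field_analytic[OF tf] by (simp add: curl_eigenspace_def)
qed

definition mode_index :: "real \<Rightarrow> ((real ^ 3) \<times> real \<times> 3) set" where
  "mode_index lam = freqs lam \<times> {0, - pi / 2} \<times> UNIV"

text \<open>A finite spanning family with many linear relations: each frequency contributes six
  modes, which span at most a plane.\<close>

definition basis_mode :: "real \<Rightarrow> (real ^ 3) \<times> real \<times> 3 \<Rightarrow> torus3 \<Rightarrow> real ^ 3" where
  "basis_mode lam = (\<lambda>(n, \<theta>, j). beltrami_mode lam n \<theta> (axis j 1))"

lemma finite_mode_index: "finite (mode_index lam)"
  by (simp add: mode_index_def finite_freqs)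

lemma basis_mode_eigenfield: "k \<in> mode_index lam \<Longrightarrow> basis_mode lam k \<in> curl_eigenspace lam"
  by (auto simp: mode_index_def basis_mode_def beltrami_mode_eigenfield)

text \<open>With \<open>C\<close> the curl, \<open>W = (C\<^sup>2 + lam C) W / (2 lam\<^sup>2)\<close>, and \<open>C\<^sup>2 + lam C\<close> maps every
  Fourier mode with frequency in \<^term>\<open>freqs lam\<close> to a Beltrami mode.\<close>

lemma eigenfield_span:
  assumes W: "W \<in> curl_eigenspace lam" and lam0: "lam > 0"
  obtains c where "\<And>p. W p = (\<Sum>k\<in>mode_index lam. c k *\<^sub>R basis_mode lam k p)"
proof -
  define I where "I = freqs lam \<times> {0 :: real, - pi / 2}"
  have fI: "finite I" by (simp add: I_def finite_freqs)
  obtain a where a: "trig_field I fst snd a W" unfolding I_def using eigenfield_trig_field[OF W lam0] .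
  have cu: "\<And>p. curl W p = lam *\<^sub>R W p" using W by (auto simp: curl_eigenspace_def)
  have X: "lam *\<^sub>R W (tproj x) = (\<Sum>k\<in>I. - sin (fst k \<bullet> x + snd k) *\<^sub>R cross3 (fst k) (a k))" for x :: "real ^ 3"
    using trig_field_curl[OF a fI, where x = x] cu by simp
  \<comment> \<open>The eigenvalue equation divided by \<open>lam\<close> is a second expansion of
    \<open>W\<close>. Its curl supplies the double cross products of the amplitudes.\<close>
  have "trig_field I fst (\<lambda>k. snd k + pi / 2) (\<lambda>k. (1 / lam) *\<^sub>R cross3 (fst k) (a k)) W"
    unfolding trig_field_def
  proof
    fix x :: "real ^ 3"
    have c: "cos (fst k \<bullet> x + (snd k + pi / 2)) = - sin (fst k \<bullet> x + snd k)" for k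
      using cos_add[of "fst k \<bullet> x + snd k" "pi / 2"] by (simp add: add.assoc)
    have "W (tproj x) = (1 / lam) *\<^sub>R (lam *\<^sub>R W (tproj x))" using lam0 by simp
    then show "W (tproj x) = (\<Sum>k\<in>I. cos (fst k \<bullet> x + (snd k + pi / 2)) *\<^sub>R (1 / lam) *\<^sub>R cross3 (fst k) (a k))"
      unfolding X c scaleR_sum_right by (simp add: mult.commute)
  qed
  note tf2 = trig_field_curl[OF this fI]
  have Y: "lam^2 *\<^sub>R W (tproj x) = (\<Sum>k\<in>I. cos (fst k \<bullet> x + snd k) *\<^sub>R (lam^2 *\<^sub>R a k - (fst k \<bullet> a k) *\<^sub>R fst k))" for x :: "real ^ 3"
  proof -
    have s: "sin (fst k \<bullet> x + (snd k + pi / 2)) = cos (fst k \<bullet> x + snd k)" for k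
      using sin_add[of "fst k \<bullet> x + snd k" "pi / 2"] by (simp add: add.assoc)
    have "lam^2 *\<^sub>R W (tproj x) = lam *\<^sub>R curl W (tproj x)" using cu by (simp add: power2_eq_square)
    also have "\<dots> = (\<Sum>k\<in>I. cos (fst k \<bullet> x + snd k) *\<^sub>R (- cross3 (fst k) (cross3 (fst k) (a k))))"
      unfolding tf2 scaleR_sum_right using lam0 by (intro sum.cong refl) (simp add: s cross_mult_right)
    also have "\<dots> = (\<Sum>k\<in>I. cos (fst k \<bullet> x + snd k) *\<^sub>R (lam^2 *\<^sub>R a k - (fst k \<bullet> a k) *\<^sub>R fst k))"
    proof (intro sum.cong refl arg_cong2[where f = scaleR])
      fix k assume "k \<in> I"
      then have "fst k \<bullet> fst k = lam^2" by (auto simp: I_def freqs_def)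
      moreover have "cross3 (fst k) (cross3 (fst k) (a k)) = (fst k \<bullet> a k) *\<^sub>R fst k - (fst k \<bullet> fst k) *\<^sub>R a k"
        by (simp add: vec_eq_iff forall_3 cross3_components inner_real3 algebra_simps)
      ultimately show "- cross3 (fst k) (cross3 (fst k) (a k)) = lam^2 *\<^sub>R a k - (fst k \<bullet> a k) *\<^sub>R fst k" by simp
    qed
    finally show ?thesis .
  qed
  have Z: "(2 * lam^2) *\<^sub>R W p = (\<Sum>k\<in>I. beltrami_mode lam (fst k) (snd k) (a k) p)" for p
  proof -
    obtain x where x: "tproj x = p" using tproj_surj by blast
    have "(2 * lam^2) *\<^sub>R W p = lam^2 *\<^sub>R W p + lam *\<^sub>R (lam *\<^sub>R W p)" by (simp add: power2_eq_square scaleR_add_left[symmetric])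
    also have "\<dots> = (\<Sum>k\<in>I. cos (fst k \<bullet> x + snd k) *\<^sub>R (lam^2 *\<^sub>R a k - (fst k \<bullet> a k) *\<^sub>R fst k) + lam *\<^sub>R (- sin (fst k \<bullet> x + snd k) *\<^sub>R cross3 (fst k) (a k)))"
      unfolding x[symmetric] X Y scaleR_sum_right sum.distrib ..
    also have "\<dots> = (\<Sum>k\<in>I. beltrami_mode lam (fst k) (snd k) (a k) p)"
    proof (intro sum.cong refl)
      fix k assume "k \<in> I"
      then have "fst k \<in> int_vecs" by (auto simp: I_def freqs_def)
      then show "cos (fst k \<bullet> x + snd k) *\<^sub>R (lam^2 *\<^sub>R a k - (fst k \<bullet> a k) *\<^sub>R fst k) + lam *\<^sub>R (- sin (fst k \<bullet> x + snd k) *\<^sub>R cross3 (fst k) (a k)) = beltrami_mode lam (fst k) (snd k) (a k) p"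
        unfolding x[symmetric] by (simp add: beltrami_mode_tproj)
    qed
    finally show ?thesis .
  qed
  \<comment> \<open>The mode is linear in its amplitude, so the three coordinate vectors
    suffice.\<close>
  have lin: "beltrami_mode lam n \<theta> b p = (\<Sum>j\<in>UNIV. b $ j *\<^sub>R beltrami_mode lam n \<theta> (axis j 1) p)" if "n \<in> int_vecs" for n \<theta> b p
  proof -
    obtain x where x: "tproj x = p" using tproj_surj by blast
    show ?thesis unfolding x[symmetric] beltrami_mode_tproj[OF that] vec_eq_iff forall_3
      by (simp add: sum_3 cross3_components inner_real3 axis_def algebra_simps)
  qed
  define c where "c = (\<lambda>(n, \<theta>, j). a (n, \<theta>) $ j / (2 * lam^2))"
  have "W p = (\<Sum>k\<in>mode_index lam. c k *\<^sub>R basis_mode lam k p)" for p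
  proof -
    have "W p = (1 / (2 * lam^2)) *\<^sub>R ((2 * lam^2) *\<^sub>R W p)" using lam0 by simp
    also have "\<dots> = (\<Sum>k\<in>I. (1 / (2 * lam^2)) *\<^sub>R beltrami_mode lam (fst k) (snd k) (a k) p)" unfolding Z scaleR_sum_right ..
    also have "\<dots> = (\<Sum>k\<in>I. \<Sum>j\<in>UNIV. c (fst k, snd k, j) *\<^sub>R basis_mode lam (fst k, snd k, j) p)"
    proof (intro sum.cong refl)
      fix k assume "k \<in> I"
      then have k: "fst k \<in> int_vecs" by (auto simp: I_def freqs_def)
      show "(1 / (2 * lam^2)) *\<^sub>R beltrami_mode lam (fst k) (snd k) (a k) p = (\<Sum>j\<in>UNIV. c (fst k, snd k, j) *\<^sub>R basis_mode lam (fst k, snd k, j) p)"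
        by (subst lin[OF k]) (simp add: scaleR_sum_right c_def basis_mode_def)
    qed
    also have "\<dots> = (\<Sum>k\<in>mode_index lam. c k *\<^sub>R basis_mode lam k p)"
    proof -
      have "(\<Sum>(n, \<theta>)\<in>freqs lam \<times> {0, - pi / 2}. \<Sum>j\<in>UNIV. c (n, \<theta>, j) *\<^sub>R basis_mode lam (n, \<theta>, j) p) =
        (\<Sum>n\<in>freqs lam. \<Sum>\<theta>\<in>{0, - pi / 2}. \<Sum>j\<in>UNIV. c (n, \<theta>, j) *\<^sub>R basis_mode lam (n, \<theta>, j) p)"
        by (rule sum.cartesian_product[symmetric])
      also have "\<dots> = (\<Sum>n\<in>freqs lam. \<Sum>(\<theta>, j)\<in>{0, - pi / 2} \<times> UNIV. c (n, \<theta>, j) *\<^sub>R basis_mode lam (n, \<theta>, j) p)"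
        by (intro sum.cong refl sum.cartesian_product)
      also have "\<dots> = (\<Sum>(n, \<theta>, j)\<in>freqs lam \<times> {0, - pi / 2} \<times> UNIV. c (n, \<theta>, j) *\<^sub>R basis_mode lam (n, \<theta>, j) p)"
        by (subst sum.cartesian_product) (simp only: split_def fst_conv snd_conv)
      finally show ?thesis unfolding I_def mode_index_def by (simp add: split_def)
    qed
    finally show ?thesis .
  qed
  then show ?thesis using that by blast
qed

lemma grad_linear_combination:
  assumes "finite K" "\<And>k. k \<in> K \<Longrightarrow> torus_analytic (V k)"
  shows "torus_analytic (\<lambda>p. \<Sum>k\<in>K. c k *\<^sub>R V k p)" "grad (\<lambda>p. \<Sum>k\<in>K. c k *\<^sub>R V k p) p = (\<Sum>k\<in>K. c k *\<^sub>R grad (V k) p)"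
proof -
  show "torus_analytic (\<lambda>p. \<Sum>k\<in>K. c k *\<^sub>R V k p)"
    using assms unfolding torus_analytic_def by (intro allI real_analytic_at_sum real_analytic_at_scaleR) auto
  have "((\<lambda>v. \<Sum>k\<in>K. c k *\<^sub>R V k (p + tproj v)) has_derivative (\<lambda>h. \<Sum>k\<in>K. c k *\<^sub>R (grad (V k) p *v h))) (at 0)"
    by (intro has_derivative_sum has_derivative_scaleR_right torus_analytic_has_derivative assms)
  from grad_eqI[OF this] show "grad (\<lambda>p. \<Sum>k\<in>K. c k *\<^sub>R V k p) p = (\<Sum>k\<in>K. c k *\<^sub>R grad (V k) p)"
    by (simp add: vec_eq_iff matrix_vector_mult_def axis_def if_distrib cong: if_cong)
qed

lemma curl_eigenspace_combination:
  assumes K: "finite K" "\<And>k. k \<in> K \<Longrightarrow> V k \<in> curl_eigenspace lam"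
  shows "(\<lambda>p. \<Sum>k\<in>K. c k *\<^sub>R V k p) \<in> curl_eigenspace lam"
proof -
  have an: "\<And>k. k \<in> K \<Longrightarrow> torus_analytic (V k)" and cu: "\<And>k p. k \<in> K \<Longrightarrow> curl (V k) p = lam *\<^sub>R V k p"
    using K(2) by (auto simp: curl_eigenspace_def)
  have g: "torus_analytic (\<lambda>p. \<Sum>k\<in>K. c k *\<^sub>R V k p)"
    by (rule grad_linear_combination(1)[OF K(1)]) (rule an)
  have g2: "grad (\<lambda>p. \<Sum>k\<in>K. c k *\<^sub>R V k p) p = (\<Sum>k\<in>K. c k *\<^sub>R grad (V k) p)" for p
    by (rule grad_linear_combination(2)[OF K(1)]) (rule an)
  have "curl (\<lambda>p. \<Sum>k\<in>K. c k *\<^sub>R V k p) p = lam *\<^sub>R (\<Sum>k\<in>K. c k *\<^sub>R V k p)" for p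
  proof -
    have "curl (\<lambda>p. \<Sum>k\<in>K. c k *\<^sub>R V k p) p = (\<Sum>k\<in>K. c k *\<^sub>R curl (V k) p)"
      unfolding vec_eq_iff forall_3 curl_components g2
      by (simp add: curl_components right_diff_distrib sum_subtractf)
    also have "\<dots> = lam *\<^sub>R (\<Sum>k\<in>K. c k *\<^sub>R V k p)"
      unfolding scaleR_sum_right by (intro sum.cong refl) (simp add: cu)
    finally show ?thesis .
  qed
  then show ?thesis using g by (simp add: curl_eigenspace_def)
qed

section \<open>Hausdorff null sets\<close>

text \<open>Upper bounds \<open>d n\<close> replace diameters, so boundedness need not be carried
  along. No mesh size occurs, since for \<open>s > 0\<close> a small sum already forces every
  \<open>d n\<close> to be small. The value 0 is allowed for \<open>d n\<close> and contributes
  \<open>0 powr s = 0\<close>.\<close>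

definition cover_null :: "real \<Rightarrow> 'a::metric_space set \<Rightarrow> bool" where
  "cover_null s S \<longleftrightarrow> (\<forall>e>0. \<exists>(U :: nat \<Rightarrow> 'a set) d. S \<subseteq> (\<Union>n. U n) \<and> (\<forall>n. 0 \<le> d n) \<and>
     (\<forall>n. \<forall>x\<in>U n. \<forall>y\<in>U n. dist x y \<le> d n) \<and> (\<Sum>n. ennreal (d n powr s)) \<le> ennreal e)"

lemma cover_nullE:
  assumes "cover_null s S" "e > 0"
  obtains U :: "nat \<Rightarrow> 'a::metric_space set" and d where "S \<subseteq> (\<Union>n. U n)" "\<And>n. 0 \<le> d n"
    "\<And>n x y. x \<in> U n \<Longrightarrow> y \<in> U n \<Longrightarrow> dist x y \<le> d n" "(\<Sum>n. ennreal (d n powr s)) \<le> ennreal e"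
  using assms unfolding cover_null_def by metis

lemma cover_null_subset: "cover_null s T \<Longrightarrow> S \<subseteq> T \<Longrightarrow> cover_null s S"
  unfolding cover_null_def by (meson order_trans)

lemma cover_null_UN_nat:
  assumes "\<And>i::nat. cover_null s (A i)" shows "cover_null s (\<Union>i. A i)"
  unfolding cover_null_def
proof (intro allI impI)
  fix e :: real assume e: "e > 0"
  have "\<forall>i. \<exists>(U :: nat \<Rightarrow> 'a set) d. A i \<subseteq> (\<Union>n. U n) \<and> (\<forall>n. 0 \<le> d n) \<and>
     (\<forall>n. \<forall>x\<in>U n. \<forall>y\<in>U n. dist x y \<le> d n) \<and> (\<Sum>n. ennreal (d n powr s)) \<le> ennreal (e * (1/2) ^ Suc i)"
    using assms e unfolding cover_null_def by simp
  then obtain U :: "nat \<Rightarrow> nat \<Rightarrow> 'a set" and d where Ud: "\<And>i. A i \<subseteq> (\<Union>n. U i n)" "\<And>i n. 0 \<le> d i n"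
     "\<And>i n x y. x \<in> U i n \<Longrightarrow> y \<in> U i n \<Longrightarrow> dist x y \<le> d i n"
     "\<And>i. (\<Sum>n. ennreal (d i n powr s)) \<le> ennreal (e * (1/2) ^ Suc i)"
    by metis
  show "\<exists>(V :: nat \<Rightarrow> 'a set) c. (\<Union>i. A i) \<subseteq> (\<Union>n. V n) \<and> (\<forall>n. 0 \<le> c n) \<and>
     (\<forall>n. \<forall>x\<in>V n. \<forall>y\<in>V n. dist x y \<le> c n) \<and> (\<Sum>n. ennreal (c n powr s)) \<le> ennreal e"
  proof (intro exI conjI allI ballI)
    let ?V = "\<lambda>n. (\<lambda>(i, j). U i j) (prod_decode n)"
    let ?c = "\<lambda>n. (\<lambda>(i, j). d i j) (prod_decode n)"
    show "(\<Union>i. A i) \<subseteq> (\<Union>n. ?V n)"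
    proof
      fix x assume "x \<in> (\<Union>i. A i)"
      then obtain i j where "x \<in> U i j" using Ud(1) by blast
      then show "x \<in> (\<Union>n. ?V n)" by (intro UN_I[of "prod_encode (i, j)"]) auto
    qed
    show "0 \<le> ?c n" for n using Ud(2) by (simp add: split_def)
    show "dist x y \<le> ?c n" if "x \<in> ?V n" "y \<in> ?V n" for n x y using that Ud(3) by (simp add: split_def)
    have "(\<Sum>n. ennreal (?c n powr s)) = (\<Sum>n. (\<lambda>(i, j). ennreal (d i j powr s)) (prod_decode n))"
      by (simp add: split_def)
    also have "\<dots> = (\<Sum>i. \<Sum>j. ennreal (d i j powr s))" by (rule suminf_ennreal_2dimen) simp
    also have "\<dots> \<le> (\<Sum>i. ennreal (e * (1/2) ^ Suc i))" by (intro suminf_le Ud(4)) auto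
    also have "\<dots> = ennreal (\<Sum>i. e * (1/2) ^ Suc i)"
      using e by (intro suminf_ennreal2 summable_mult) (auto intro: summable_geometric simp: summable_Suc_iff)
    also have "(\<Sum>i. e * (1/2) ^ Suc i) = e"
      using sums_mult[OF power_half_series, of e] by (simp add: sums_iff)
    finally show "(\<Sum>n. ennreal (?c n powr s)) \<le> ennreal e" .
  qed
qed

lemma cover_null_empty: "cover_null s {}"
  unfolding cover_null_def
  by (intro allI impI exI[of _ "\<lambda>_. {}"] exI[of _ "\<lambda>_. 0"]) auto

lemma cover_null_UN:
  assumes "countable I" "\<And>i. i \<in> I \<Longrightarrow> cover_null s (A i)" shows "cover_null s (\<Union>i\<in>I. A i)"
proof (cases "I = {}")
  case False
  have "cover_null s (\<Union>n. A (from_nat_into I n))"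
    using assms(2) False by (intro cover_null_UN_nat) (simp add: from_nat_into)
  also have "(\<Union>n. A (from_nat_into I n)) = (\<Union>i\<in>I. A i)"
    using range_from_nat_into[OF False assms(1)] by (metis image_image)
  finally show ?thesis .
qed (simp add: cover_null_empty)

lemma finite_cover:
  assumes I: "finite I" and cov: "S \<subseteq> (\<Union>i\<in>I. f i)" and d: "d \<ge> 0" "\<And>i x y. i \<in> I \<Longrightarrow> x \<in> f i \<Longrightarrow> y \<in> f i \<Longrightarrow> dist x y \<le> d"
    and e: "real (card I) * d powr s \<le> e"
  shows "\<exists>(U :: nat \<Rightarrow> 'a::metric_space set) d. S \<subseteq> (\<Union>n. U n) \<and> (\<forall>n. 0 \<le> d n) \<and>
     (\<forall>n. \<forall>x\<in>U n. \<forall>y\<in>U n. dist x y \<le> d n) \<and> (\<Sum>n. ennreal (d n powr s)) \<le> ennreal e"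
proof -
  obtain h where h: "bij_betw h {0..<card I} I" using ex_bij_betw_nat_finite[OF I] by blast
  \<comment> \<open>The finite cover is continued by empty sets of size bound 0.\<close>
  define U where "U = (\<lambda>n. if n < card I then f (h n) else {})"
  define c where "c = (\<lambda>n. if n < card I then d else 0)"
  have "S \<subseteq> (\<Union>n. U n)"
  proof
    fix x assume "x \<in> S"
    then obtain i where i: "i \<in> I" "x \<in> f i" using cov by blast
    then obtain n where "n < card I" "h n = i" using h by (metis atLeastLessThan_iff bij_betw_imp_surj_on imageE)
    then show "x \<in> (\<Union>n. U n)" using i by (auto simp: U_def)
  qed
  moreover have "dist x y \<le> c n" if "x \<in> U n" "y \<in> U n" for n x y
  proof -
    have n: "n < card I" using that(1) by (simp add: U_def split: if_splits)
    then have "h n \<in> I" using h by (auto simp: bij_betw_def)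
    then show ?thesis using that n d(2) by (simp add: U_def c_def)
  qed
  moreover have "(\<Sum>n. ennreal (c n powr s)) \<le> ennreal e"
  proof -
    have "(\<Sum>n. ennreal (c n powr s)) = (\<Sum>n<card I. ennreal (c n powr s))"
      by (rule suminf_finite) (auto simp: c_def)
    also have "\<dots> = (\<Sum>n<card I. ennreal (d powr s))" by (intro sum.cong) (auto simp: c_def)
    also have "\<dots> = ennreal (real (card I) * d powr s)" by (simp add: ennreal_mult ennreal_of_nat_eq_real_of_nat)
    also have "\<dots> \<le> ennreal e" using e by (rule ennreal_leI)
    finally show ?thesis .
  qed
  moreover have "0 \<le> c n" for n using d(1) by (simp add: c_def)
  ultimately show ?thesis by blast
qed

lemma cover_null_hausdorff_measure:
  fixes S :: "'a::metric_space set"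
  assumes s: "s > 0" and S: "cover_null s S" shows "hausdorff_measure s S = 0"
proof -
  have "hausdorff_premeasure s \<delta> S \<le> ennreal e" if \<delta>: "\<delta> > 0" and e: "e > 0" for \<delta> e
  proof -
    \<comment> \<open>The cap \<open>\<delta> powr s\<close> excludes every
      \<open>d n > \<delta>\<close>, since that single term would exceed the sum.\<close>
    define e' where "e' = min e (\<delta> powr s)"
    have e': "e' > 0" using \<delta> e by (simp add: e'_def)
    obtain U :: "nat \<Rightarrow> 'a set" and d where U: "S \<subseteq> (\<Union>n. U n)" "\<And>n. 0 \<le> d n"
      "\<And>n x y. x \<in> U n \<Longrightarrow> y \<in> U n \<Longrightarrow> dist x y \<le> d n" "(\<Sum>n. ennreal (d n powr s)) \<le> ennreal e'"
      using cover_nullE[OF S e'] by blast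
    have dle: "d n \<le> \<delta>" for n
    proof (rule ccontr)
      assume "\<not> d n \<le> \<delta>"
      then have "\<delta> powr s < d n powr s" using \<delta> s by (intro powr_less_mono2) auto
      moreover have "ennreal (d n powr s) \<le> (\<Sum>n. ennreal (d n powr s))"
        by (rule order_trans[OF _ sum_le_suminf[of _ "{n}"]]) auto
      then have "ennreal (d n powr s) \<le> ennreal e'" using U(4) by (rule order_trans)
      then have "d n powr s \<le> e'" using e' by (simp add: ennreal_le_iff)
      ultimately show False by (simp add: e'_def)
    qed
    have bd: "bounded (U n)" for n
    proof (cases "U n = {}")
      case False
      then obtain x where "x \<in> U n" by blast
      then have "\<forall>y\<in>U n. dist x y \<le> d n" using U(3) by blast
      then show ?thesis unfolding bounded_def by blast
    qed simp
    have di: "diameter (U n) \<le> d n" for n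
      using U(2,3) by (auto simp: diameter_def intro!: cSUP_least)
    have dn: "0 \<le> diameter (U n)" for n using bd by (rule diameter_ge_0)
    have "hausdorff_premeasure s \<delta> S \<le> (\<Sum>n. diam_power s (U n))"
      unfolding hausdorff_premeasure_def
      by (rule INF_lower) (use U bd di dle order_trans in blast)
    also have "\<dots> \<le> (\<Sum>n. ennreal (d n powr s))"
      using s di dn by (intro suminf_le) (auto simp: diam_power_def intro!: ennreal_leI powr_mono2)
    also have "\<dots> \<le> ennreal e'" by (rule U(4))
    also have "\<dots> \<le> ennreal e" by (rule ennreal_leI) (simp add: e'_def)
    finally show ?thesis .
  qed
  then have "hausdorff_premeasure s \<delta> S = 0" if "\<delta> > 0" for \<delta>
  proof -
    have "hausdorff_premeasure s \<delta> S \<le> 0"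
      by (rule ennreal_le_epsilon) (use \<open>\<And>\<delta> e. \<lbrakk>0 < \<delta>; 0 < e\<rbrakk> \<Longrightarrow> hausdorff_premeasure s \<delta> S \<le> ennreal e\<close> that in simp)
    then show ?thesis by simp
  qed
  then show ?thesis by (simp add: hausdorff_measure_def)
qed

lemma cover_null_image:
  assumes S: "cover_null s S" and f: "\<And>x y. dist (f x) (f y) \<le> dist x y"
  shows "cover_null s (f ` S)"
  unfolding cover_null_def
proof (intro allI impI)
  fix e :: real assume e: "e > 0"
  obtain U :: "nat \<Rightarrow> 'a set" and d where U: "S \<subseteq> (\<Union>n. U n)" "\<And>n. 0 \<le> d n"
      "\<And>n x y. x \<in> U n \<Longrightarrow> y \<in> U n \<Longrightarrow> dist x y \<le> d n" "(\<Sum>n. ennreal (d n powr s)) \<le> ennreal e"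
      using cover_nullE[OF S e] by blast
  show "\<exists>V d. f ` S \<subseteq> (\<Union>n. V n) \<and> (\<forall>n. 0 \<le> d n) \<and>
     (\<forall>n. \<forall>x\<in>V n. \<forall>y\<in>V n. dist x y \<le> d n) \<and> (\<Sum>n. ennreal (d n powr s)) \<le> ennreal e"
  proof (intro exI conjI allI ballI)
    show "f ` S \<subseteq> (\<Union>n. f ` U n)" using U(1) by blast
    fix n x y assume "x \<in> f ` U n" "y \<in> f ` U n"
    then obtain x' y' where "x' \<in> U n" "y' \<in> U n" and xy: "x = f x'" "y = f y'" by blast
    then have "dist x' y' \<le> d n" using U(3) by blast
    then show "dist x y \<le> d n" unfolding xy using f[of x' y'] by linarith
  qed (rule U)+
qed

lemma cover_null_negligible:
  fixes S :: "'a::euclidean_space set"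
  assumes S: "cover_null (DIM('a)) S" shows "negligible S"
  unfolding negligible_outer_le
proof (intro allI impI)
  fix e :: real assume e: "e > 0"
  define D where "D = DIM('a)"
  \<comment> \<open>Each \<open>U n\<close> lies in a cube of side \<open>2 * d n\<close>, which
    costs the factor \<open>2 ^ D\<close> in volume.\<close>
  define e' where "e' = e / 2 ^ D"
  have e': "e' > 0" using e by (simp add: e'_def)
  obtain U :: "nat \<Rightarrow> 'a set" and d where U: "S \<subseteq> (\<Union>n. U n)" "\<And>n. 0 \<le> d n"
      "\<And>n x y. x \<in> U n \<Longrightarrow> y \<in> U n \<Longrightarrow> dist x y \<le> d n" "(\<Sum>n. ennreal (d n powr DIM('a))) \<le> ennreal e'"
      using cover_nullE[OF S e'] by blast
  define c where "c = (\<lambda>n. SOME x. x \<in> U n)"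
  define B where "B = (\<lambda>n. cbox (c n - d n *\<^sub>R One) (c n + d n *\<^sub>R One))"
  have UB: "U n \<subseteq> B n" for n
  proof
    fix x assume x: "x \<in> U n"
    then have "c n \<in> U n" unfolding c_def by (rule someI)
    then have "norm (x - c n) \<le> d n" using U(3)[OF x] by (simp add: dist_norm)
    then have "\<bar>(x - c n) \<bullet> b\<bar> \<le> d n" if "b \<in> Basis" for b using Basis_le_norm[OF that, of "x - c n"] by linarith
    then show "x \<in> B n" by (fastforce simp: B_def mem_box inner_diff_left inner_add_left abs_le_iff)
  qed
  have em: "emeasure lborel (B n) = ennreal (2 ^ D * d n powr D)" for n
  proof -
    have "emeasure lborel (B n) = ennreal ((2 * d n) ^ D)"
      using U(2)[of n] by (simp add: B_def emeasure_lborel_cbox_eq inner_diff_left inner_add_left D_def)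
    also have "(2 * d n) ^ D = 2 ^ D * d n powr D"
      using U(2)[of n] by (cases "d n = 0") (simp_all add: power_mult_distrib powr_realpow D_def)
    finally show ?thesis .
  qed
  have "emeasure lborel (\<Union>n. B n) \<le> (\<Sum>n. emeasure lborel (B n))"
    by (rule emeasure_subadditive_countably) (auto simp: B_def)
  also have "\<dots> = ennreal (2 ^ D) * (\<Sum>n. ennreal (d n powr D))"
    unfolding em by (simp add: ennreal_mult)
  also have "\<dots> \<le> ennreal (2 ^ D) * ennreal e'" using U(4) by (intro mult_left_mono) (auto simp: D_def)
  also have "\<dots> = ennreal e" using e by (simp add: ennreal_mult[symmetric] e'_def)
  finally have le: "emeasure lborel (\<Union>n. B n) \<le> ennreal e" .
  have sB: "(\<Union>n. B n) \<in> sets borel" by (auto simp: B_def)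
  then have le': "emeasure lebesgue (\<Union>n. B n) \<le> ennreal e" using le by simp
  then have lm: "(\<Union>n. B n) \<in> lmeasurable" using sB by (intro fmeasurableI) (auto simp: le_less_trans)
  have "measure lebesgue (\<Union>n. B n) \<le> e" using le' e by (simp add: measure_def enn2real_leI)
  then show "\<exists>T. S \<subseteq> T \<and> T \<in> lmeasurable \<and> measure lebesgue T \<le> e"
    using lm order_trans[OF U(1) UN_mono[OF subset_refl UB]] by (intro exI[of _ "\<Union>n. B n"] conjI)
qed

section \<open>Zero sets of trigonometric polynomials\<close>

text \<open>\<open>G n\<close> is the derivative of order \<open>n\<close> along \<open>v\<close>;
  for one cosine it is a quarter-period shift together with a factor \<open>m \<bullet> v\<close>.
  The geometric growth makes Taylor expansion along \<open>v\<close> exact, and the Lipschitz bounds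
  control zeros across \<open>v\<close>.\<close>

lemma trig_poly_derivatives:
  fixes f :: "'a::euclidean_space \<Rightarrow> real"
  assumes "trig_poly M f"
  obtains G C R where "G 0 = f" "\<And>n x t. ((\<lambda>t. G n (x + t *\<^sub>R v)) has_real_derivative G (Suc n) (x + t *\<^sub>R v)) (at t)"
    "\<And>n x. \<bar>G n x\<bar> \<le> C * R ^ n" "\<And>n. \<exists>L\<ge>0. \<forall>x y. \<bar>G n x - G n y\<bar> \<le> L * norm (x - y)" "C \<ge> 0" "R \<ge> 0"
proof -
  have "\<exists>G C R. G 0 = f \<and> (\<forall>n x t. ((\<lambda>t. G n (x + t *\<^sub>R v)) has_real_derivative G (Suc n) (x + t *\<^sub>R v)) (at t))
    \<and> (\<forall>n x. \<bar>G n x\<bar> \<le> C * R ^ n) \<and> (\<forall>n. \<exists>L\<ge>0. \<forall>x y. \<bar>G n x - G n y\<bar> \<le> L * norm (x - y)) \<and> C \<ge> 0 \<and> R \<ge> 0"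
    using assms
  proof (induction rule: trig_poly.induct)
    case (trig_poly_cos m a \<theta>)
    define G where "G = (\<lambda>n x. a * (m \<bullet> v) ^ n * cos (m \<bullet> x + \<theta> + n * (pi / 2)))"
    have "((\<lambda>t. G n (x + t *\<^sub>R v)) has_real_derivative G (Suc n) (x + t *\<^sub>R v)) (at t)" for n x t
    proof -
      have shift: "cos (u + pi / 2) = - sin u" for u :: real by (simp add: cos_add)
      have e: "w + real (Suc n) * (pi / 2) = (w + real n * (pi / 2)) + pi / 2" for w :: real
        by (simp add: algebra_simps add_divide_distrib)
      have G: "G (Suc n) (x + t *\<^sub>R v) = a * (m \<bullet> v) ^ n * (- sin (m \<bullet> (x + t *\<^sub>R v) + \<theta> + n * (pi / 2)) * (m \<bullet> v))"
        unfolding G_def e shift by simp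
      show ?thesis unfolding G unfolding G_def
        by (auto intro!: derivative_eq_intros simp: inner_add_right)
    qed
    moreover have "\<bar>G n x\<bar> \<le> \<bar>a\<bar> * \<bar>m \<bullet> v\<bar> ^ n" for n x
    proof -
      have "\<bar>G n x\<bar> = \<bar>a\<bar> * \<bar>m \<bullet> v\<bar> ^ n * \<bar>cos (m \<bullet> x + \<theta> + n * (pi / 2))\<bar>" by (simp add: G_def abs_mult power_abs)
      also have "\<dots> \<le> \<bar>a\<bar> * \<bar>m \<bullet> v\<bar> ^ n * 1" by (intro mult_left_mono) auto
      finally show ?thesis by simp
    qed
    moreover have "\<exists>L\<ge>0. \<forall>x y. \<bar>G n x - G n y\<bar> \<le> L * norm (x - y)" for n
    proof (intro exI[of _ "\<bar>a * (m \<bullet> v) ^ n\<bar> * norm m"] conjI allI)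
      fix x y
      have lip: "\<bar>cos s - cos t\<bar> \<le> \<bar>s - t\<bar>" for s t :: real
      proof -
        have "\<bar>cos s - cos t\<bar> = 2 * \<bar>sin ((s + t) / 2)\<bar> * \<bar>sin ((t - s) / 2)\<bar>" by (simp add: cos_diff_cos abs_mult)
        also have "\<dots> \<le> 2 * 1 * \<bar>(t - s) / 2\<bar>" by (intro mult_mono abs_sin_x_le_abs_x) auto
        finally show ?thesis by simp
      qed
      have "\<bar>G n x - G n y\<bar> = \<bar>a * (m \<bullet> v) ^ n\<bar> * \<bar>cos (m \<bullet> x + \<theta> + n * (pi / 2)) - cos (m \<bullet> y + \<theta> + n * (pi / 2))\<bar>"
        by (simp only: G_def right_diff_distrib[symmetric] abs_mult)
      also have "\<dots> \<le> \<bar>a * (m \<bullet> v) ^ n\<bar> * \<bar>m \<bullet> (x - y)\<bar>"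
        by (intro mult_left_mono order_trans[OF lip]) (auto simp: inner_diff_right)
      also have "\<dots> \<le> \<bar>a * (m \<bullet> v) ^ n\<bar> * (norm m * norm (x - y))" by (intro mult_left_mono Cauchy_Schwarz_ineq2) auto
      finally show "\<bar>G n x - G n y\<bar> \<le> \<bar>a * (m \<bullet> v) ^ n\<bar> * norm m * norm (x - y)" by (simp add: mult.assoc)
    qed auto
    moreover have "G 0 = (\<lambda>x. a * cos (m \<bullet> x + \<theta>))" by (simp add: G_def)
    ultimately show ?case by (intro exI[of _ G] exI[of _ "\<bar>a\<bar>"] exI[of _ "\<bar>m \<bullet> v\<bar>"]) auto
  next
    case (trig_poly_add f g)
    obtain G C R where G: "G 0 = f" "\<And>n x t. ((\<lambda>t. G n (x + t *\<^sub>R v)) has_real_derivative G (Suc n) (x + t *\<^sub>R v)) (at t)"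
      "\<And>n x. \<bar>G n x\<bar> \<le> C * R ^ n" "\<And>n. \<exists>L\<ge>0. \<forall>x y. \<bar>G n x - G n y\<bar> \<le> L * norm (x - y)" "C \<ge> 0" "R \<ge> 0"
      using trig_poly_add.IH(1) by blast
    obtain H D S where H: "H 0 = g" "\<And>n x t. ((\<lambda>t. H n (x + t *\<^sub>R v)) has_real_derivative H (Suc n) (x + t *\<^sub>R v)) (at t)"
      "\<And>n x. \<bar>H n x\<bar> \<le> D * S ^ n" "\<And>n. \<exists>L\<ge>0. \<forall>x y. \<bar>H n x - H n y\<bar> \<le> L * norm (x - y)" "D \<ge> 0" "S \<ge> 0"
      using trig_poly_add.IH(2) by blast
    define M where "M = (\<lambda>n x. G n x + H n x)"
    have "M 0 = (\<lambda>x. f x + g x)" by (simp add: M_def G H)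
    moreover have "((\<lambda>t. M n (x + t *\<^sub>R v)) has_real_derivative M (Suc n) (x + t *\<^sub>R v)) (at t)" for n x t
      unfolding M_def by (intro DERIV_add G H)
    moreover have "\<bar>M n x\<bar> \<le> (C + D) * (max R S) ^ n" for n x
    proof -
      have "\<bar>M n x\<bar> \<le> C * R ^ n + D * S ^ n" unfolding M_def using G(3)[of n x] H(3)[of n x] by linarith
      also have "\<dots> \<le> C * (max R S) ^ n + D * (max R S) ^ n" using G H by (intro add_mono mult_left_mono power_mono) auto
      finally show ?thesis by (simp add: algebra_simps)
    qed
    moreover have "\<exists>L\<ge>0. \<forall>x y. \<bar>M n x - M n y\<bar> \<le> L * norm (x - y)" for n
    proof -
      obtain L where L: "L \<ge> 0" "\<And>x y. \<bar>G n x - G n y\<bar> \<le> L * norm (x - y)" using G(4)[of n] by blast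
      obtain L' where L': "L' \<ge> 0" "\<And>x y. \<bar>H n x - H n y\<bar> \<le> L' * norm (x - y)" using H(4)[of n] by blast
      have "\<bar>M n x - M n y\<bar> \<le> (L + L') * norm (x - y)" for x y
        unfolding M_def distrib_right using L(2)[of x y] L'(2)[of x y] by linarith
      then show ?thesis using L(1) L'(1) by (intro exI[of _ "L + L'"]) auto
    qed
    moreover have "C + D \<ge> 0" "max R S \<ge> 0" using G H by auto
    ultimately show ?case by blast
  qed
  then show ?thesis using that by blast
qed

text \<open>The Taylor remainder at 1 is at most \<open>C * R ^ n / fact n\<close>, which tends to
  0. Thus a zero of infinite order along a line forces vanishing at its other end.\<close>

lemma vanishing_derivatives:
  fixes h :: "nat \<Rightarrow> real \<Rightarrow> real"
  assumes d: "\<And>n t. (h n has_real_derivative h (Suc n) t) (at t)" and b: "\<And>n t. \<bar>h n t\<bar> \<le> C * R ^ n"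
    and z: "\<And>n. h n 0 = 0"
  shows "h 0 1 = 0"
proof -
  have le: "\<bar>h 0 1\<bar> \<le> C * (R ^ n / fact n)" for n
  proof -
    obtain t where "h 0 1 = (\<Sum>m<n. (h m 0 / fact m) * 1 ^ m) + (h n t / fact n) * 1 ^ n"
      using Maclaurin_all_le[of h "h 0" 1 n] d by blast
    then have "h 0 1 = h n t / fact n" using z by simp
    then have "\<bar>h 0 1\<bar> = \<bar>h n t\<bar> / fact n" by simp
    also have "\<dots> \<le> C * R ^ n / fact n" by (intro divide_right_mono b) simp
    finally show ?thesis by simp
  qed
  have "(\<lambda>n. R ^ n / fact n) \<longlonglongrightarrow> 0"
    using summable_LIMSEQ_zero[OF summable_exp[of R]] by (simp add: divide_inverse mult.commute)
  then have "(\<lambda>n. C * (R ^ n / fact n)) \<longlonglongrightarrow> C * 0" by (intro tendsto_mult_left)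
  then have "\<bar>h 0 1\<bar> \<le> C * 0" using le by (intro LIMSEQ_le_const) auto
  then show ?thesis by simp
qed

text \<open>Along \<open>v\<close> the function is strictly monotone near a zero in the piece, so the projection along \<open>v\<close> to
  a coordinate hyperplane is injective there with a Lipschitz inverse.\<close>

lemma transversal_zero_separation:
  fixes g g' :: "'a::euclidean_space \<Rightarrow> real"
  assumes d: "\<And>x t. ((\<lambda>t. g (x + t *\<^sub>R v)) has_real_derivative g' (x + t *\<^sub>R v)) (at t)"
    and L: "L \<ge> 0" "\<And>x y. \<bar>g x - g y\<bar> \<le> L * norm (x - y)"
    and L': "\<And>x y. \<bar>g' x - g' y\<bar> \<le> L' * norm (x - y)" "L' \<ge> 0"
    and c: "c > 0" and x: "g x = 0" "\<bar>g' x\<bar> \<ge> c" and y: "g y = 0"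
    and yx: "y - x = \<tau> *\<^sub>R v + w" and small: "L' * (\<bar>\<tau>\<bar> * norm v) \<le> c / 2"
  shows "norm (y - x) \<le> (1 + 2 * L * norm v / c) * norm w"
proof -
  \<comment> \<open>Mean value theorem along \<open>v\<close>: the smallness hypothesis keeps the
    derivative at least \<open>c / 2\<close> in absolute value on the segment.\<close>
  have lower: "\<bar>\<tau>\<bar> * (c / 2) \<le> \<bar>g (x + \<tau> *\<^sub>R v)\<bar>"
  proof (cases "\<tau> = 0")
    case False
    have "\<exists>\<xi>. \<bar>\<xi>\<bar> \<le> \<bar>\<tau>\<bar> \<and> g (x + \<tau> *\<^sub>R v) - g x = \<tau> * g' (x + \<xi> *\<^sub>R v)"
    proof (cases "\<tau> > 0")
      case True
      from MVT2[OF True, of "\<lambda>t. g (x + t *\<^sub>R v)" "\<lambda>t. g' (x + t *\<^sub>R v)"] d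
      obtain \<xi> where "0 < \<xi>" "\<xi> < \<tau>" "g (x + \<tau> *\<^sub>R v) - g (x + 0 *\<^sub>R v) = (\<tau> - 0) * g' (x + \<xi> *\<^sub>R v)" by blast
      then show ?thesis by (intro exI[of _ \<xi>]) auto
    next
      case False
      then have "\<tau> < 0" using \<open>\<tau> \<noteq> 0\<close> by simp
      from MVT2[OF this, of "\<lambda>t. g (x + t *\<^sub>R v)" "\<lambda>t. g' (x + t *\<^sub>R v)"] d
      obtain \<xi> where "\<tau> < \<xi>" "\<xi> < 0" "g (x + 0 *\<^sub>R v) - g (x + \<tau> *\<^sub>R v) = (0 - \<tau>) * g' (x + \<xi> *\<^sub>R v)" by blast
      then show ?thesis by (intro exI[of _ \<xi>]) auto
    qed
    then obtain \<xi> where xi: "\<bar>\<xi>\<bar> \<le> \<bar>\<tau>\<bar>" "g (x + \<tau> *\<^sub>R v) - g x = \<tau> * g' (x + \<xi> *\<^sub>R v)" by blast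
    have "\<bar>g' (x + \<xi> *\<^sub>R v) - g' x\<bar> \<le> L' * (\<bar>\<xi>\<bar> * norm v)" using L'(1)[of "x + \<xi> *\<^sub>R v" x] by simp
    also have "\<dots> \<le> L' * (\<bar>\<tau>\<bar> * norm v)" using xi L'(2) by (intro mult_left_mono mult_right_mono) auto
    also have "\<dots> \<le> c / 2" by (rule small)
    finally have "c / 2 \<le> \<bar>g' (x + \<xi> *\<^sub>R v)\<bar>" using x(2) by linarith
    then have "\<bar>\<tau>\<bar> * (c / 2) \<le> \<bar>\<tau>\<bar> * \<bar>g' (x + \<xi> *\<^sub>R v)\<bar>" by (intro mult_left_mono) auto
    also have "\<dots> = \<bar>g (x + \<tau> *\<^sub>R v)\<bar>" using xi x(1) by (simp add: abs_mult)
    finally show ?thesis .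
  qed simp
  have "\<bar>g (x + \<tau> *\<^sub>R v)\<bar> = \<bar>g (x + \<tau> *\<^sub>R v) - g y\<bar>" using y by simp
  also have "\<dots> \<le> L * norm (x + \<tau> *\<^sub>R v - y)" by (rule L(2))
  also have "x + \<tau> *\<^sub>R v - y = - w" using yx by (simp add: algebra_simps)
  finally have "\<bar>\<tau>\<bar> * (c / 2) \<le> L * norm w" using lower by simp
  then have "\<bar>\<tau>\<bar> \<le> 2 * L / c * norm w" using c by (simp add: field_simps)
  then have "\<bar>\<tau>\<bar> * norm v \<le> 2 * L / c * norm w * norm v" by (intro mult_right_mono) auto
  moreover have "norm (y - x) \<le> \<bar>\<tau>\<bar> * norm v + norm w" unfolding yx by (metis norm_scaleR norm_triangle_ineq)
  ultimately have "norm (y - x) \<le> 2 * L / c * norm w * norm v + norm w" by linarith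
  then show ?thesis by (simp add: algebra_simps)
qed

text \<open>\<open>\<psi>\<close> projects along \<open>v\<close> to the hyperplane orthogonal to
  \<open>j\<close>, and \<open>sep\<close> says that its inverse on \<open>S\<close> is Lipschitz. A
  grid of mesh \<open>1 / M\<close> in that hyperplane has of the order of
  \<open>M ^ (D - 1)\<close> cells, whose preimages in \<open>S\<close> have diameter at most
  \<open>C * D / M\<close>.\<close>

lemma cover_null_transversal_ball:
  fixes S :: "'a::euclidean_space set" and v :: 'a
  assumes s: "s > real DIM('a) - 1" and j: "j \<in> Basis" "v \<bullet> j \<noteq> 0" and C: "C \<ge> 0"
    and sep: "\<And>x y. x \<in> S \<Longrightarrow> y \<in> S \<Longrightarrow> norm (y - x) \<le> C * norm ((y - x) - ((y - x) \<bullet> j / (v \<bullet> j)) *\<^sub>R v)"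
    and bd: "S \<subseteq> ball q r" and r: "r > 0"
  shows "cover_null s S"
  unfolding cover_null_def
proof (intro allI impI)
  fix e :: real assume e: "e > 0"
  define D where "D = DIM('a)"
  have D1: "D \<ge> 1" by (simp add: D_def Suc_leI)
  then have "real D \<ge> 1" by simp
  then have s0: "s > 0" using s unfolding D_def by linarith
  define \<psi> where "\<psi> = (\<lambda>x. x - (x \<bullet> j / (v \<bullet> j)) *\<^sub>R v)"
  have \<psi>_diff: "\<psi> (x - y) = \<psi> x - \<psi> y" for x y by (simp add: \<psi>_def inner_diff_left diff_divide_distrib algebra_simps)
  have \<psi>j: "\<psi> x \<bullet> j = 0" for x using j by (simp add: \<psi>_def inner_diff_left)
  define R where "R = (1 + norm v / \<bar>v \<bullet> j\<bar>) * r"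
  have R0: "R > 0" using r by (simp add: R_def add_pos_nonneg)
  have \<psi>_bound: "norm (\<psi> x) \<le> (1 + norm v / \<bar>v \<bullet> j\<bar>) * norm x" for x
  proof -
    have "norm (\<psi> x) \<le> norm x + norm ((x \<bullet> j / (v \<bullet> j)) *\<^sub>R v)" unfolding \<psi>_def by (rule norm_triangle_ineq4)
    also have "norm ((x \<bullet> j / (v \<bullet> j)) *\<^sub>R v) = \<bar>x \<bullet> j\<bar> * (norm v / \<bar>v \<bullet> j\<bar>)" by simp
    also have "\<dots> \<le> norm x * (norm v / \<bar>v \<bullet> j\<bar>)" using j by (intro mult_right_mono Basis_le_norm) auto
    finally show ?thesis by (simp add: algebra_simps)
  qed
  have \<psi>S: "\<bar>\<psi> (x - q) \<bullet> b\<bar> \<le> R" if "x \<in> S" "b \<in> Basis" for x b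
  proof -
    have "norm (x - q) \<le> r" using bd that by (auto simp: dist_norm norm_minus_commute less_imp_le)
    have "\<bar>\<psi> (x - q) \<bullet> b\<bar> \<le> norm (\<psi> (x - q))" using that by (rule_tac Basis_le_norm)
    also have "\<dots> \<le> (1 + norm v / \<bar>v \<bullet> j\<bar>) * norm (x - q)" by (rule \<psi>_bound)
    also have "\<dots> \<le> R" unfolding R_def using \<open>norm (x - q) \<le> r\<close> by (intro mult_left_mono) auto
    finally show ?thesis .
  qed
  \<comment> \<open>Collects the constants: the total cost of the grid is at most
    \<open>c1 * M powr (D - 1 - s)\<close>, which tends to 0 because
    \<open>s > D - 1\<close>.\<close>
  define c1 where "c1 = (2 * R + 4) ^ (D - 1) * (C * D) powr s"
  have lim: "((\<lambda>M::nat. c1 * real M powr (real D - 1 - s)) \<longlonglongrightarrow> c1 * 0)"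
    using s by (intro tendsto_mult_left tendsto_neg_powr filterlim_real_sequentially) (auto simp: D_def)
  then have "eventually (\<lambda>M::nat. c1 * real M powr (real D - 1 - s) < e) sequentially"
    using e by (intro order_tendstoD(2)[where y = "c1 * 0"]) auto
  then obtain M :: nat where M: "M \<ge> 1" "c1 * real M powr (real D - 1 - s) < e"
    unfolding eventually_sequentially by (metis nat_le_linear)
  \<comment> \<open>The added 1 makes \<open>M * R < N\<close> strict, so every cell label lies
    below \<open>N\<close>.\<close>
  define N where "N = nat \<lceil>M * R\<rceil> + 1"
  have N: "M * R \<le> real N" unfolding N_def by linarith
  have N': "2 * real N \<le> M * (2 * R + 4)"
  proof -
    have "real N \<le> M * R + 2" unfolding N_def using R0 by (simp add: of_nat_nat) linarith
    moreover have "4 \<le> 4 * real M" using M by simp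
    ultimately show ?thesis by (simp add: algebra_simps)
  qed
  define I where "I = (Basis - {j}) \<rightarrow>\<^sub>E {- int N..<int N}"
  have finI: "finite I" unfolding I_def by (intro finite_PiE) auto
  have cI: "card I = (2 * N) ^ (D - 1)"
    using j by (simp add: I_def card_PiE D_def card_Diff_singleton nat_mult_distrib power_mult_distrib)
  define cell where "cell = (\<lambda>k. {x \<in> S. \<forall>b\<in>Basis - {j}. \<lfloor>M * (\<psi> (x - q) \<bullet> b)\<rfloor> = k b})"
  have h4: "real (card I) * (C * (D / M)) powr s \<le> e"
  proof -
    have "real (card I) = (2 * real N) ^ (D - 1)" by (simp add: cI)
    also have "\<dots> \<le> (M * (2 * R + 4)) ^ (D - 1)" using N' by (intro power_mono) auto
    also have "\<dots> = real M powr (real D - 1) * (2 * R + 4) ^ (D - 1)"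
      using M D1 by (simp add: power_mult_distrib powr_realpow[symmetric] of_nat_diff)
    finally have 1: "real (card I) \<le> real M powr (real D - 1) * (2 * R + 4) ^ (D - 1)" .
    have "(C * (D / M)) powr s = (C * D) powr s * real M powr (- s)"
    proof -
      have "(C * (D / M)) powr s = (C * D / M) powr s" by simp
      also have "\<dots> = (C * D) powr s / real M powr s" by (rule powr_divide)
      finally show ?thesis by (simp add: powr_minus divide_inverse)
    qed
    then have "real (card I) * (C * (D / M)) powr s \<le> (real M powr (real D - 1) * (2 * R + 4) ^ (D - 1)) * ((C * D) powr s * real M powr (- s))"
      using 1 by (simp only:) (intro mult_right_mono, auto)
    also have "\<dots> = c1 * (real M powr (real D - 1) * real M powr (- s))" by (simp add: c1_def mult_ac)
    also have "\<dots> = c1 * real M powr (real D - 1 - s)" by (simp add: powr_add[symmetric])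
    finally show ?thesis using M(2) by linarith
  qed
  have h1: "S \<subseteq> (\<Union>k\<in>I. cell k)"
  proof
    fix x assume x: "x \<in> S"
    define k where "k = (\<lambda>b\<in>Basis - {j}. \<lfloor>M * (\<psi> (x - q) \<bullet> b)\<rfloor>)"
    have "\<lfloor>M * (\<psi> (x - q) \<bullet> b)\<rfloor> \<in> {- int N..<int N}" if "b \<in> Basis" for b
    proof -
      have "\<bar>M * (\<psi> (x - q) \<bullet> b)\<bar> \<le> M * R" using \<psi>S[OF x that] M by (simp add: abs_mult)
      moreover have "M * R < real N" unfolding N_def by linarith
      ultimately have "- real N \<le> M * (\<psi> (x - q) \<bullet> b)" "M * (\<psi> (x - q) \<bullet> b) < real N" by linarith+
      then show ?thesis by (auto simp: le_floor_iff floor_less_iff)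
    qed
    then have "k \<in> I" by (auto simp: I_def k_def)
    moreover have "x \<in> cell k" using x by (simp add: cell_def k_def)
    ultimately show "x \<in> (\<Union>k\<in>I. cell k)" by blast
  qed
  have h3: "dist x y \<le> C * (D / M)" if k: "x \<in> cell k" "y \<in> cell k" for k x y
  proof -
    have xy: "x \<in> S" "y \<in> S" using k by (auto simp: cell_def)
    have b: "\<bar>\<psi> (y - x) \<bullet> b\<bar> \<le> 1 / M" if "b \<in> Basis" for b
    proof (cases "b = j")
      case False
      then have "\<lfloor>M * (\<psi> (x - q) \<bullet> b)\<rfloor> = \<lfloor>M * (\<psi> (y - q) \<bullet> b)\<rfloor>" using k that by (simp add: cell_def)
      then have "\<bar>M * (\<psi> (y - q) \<bullet> b) - M * (\<psi> (x - q) \<bullet> b)\<bar> \<le> 1" by linarith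
      moreover have "M * (\<psi> (y - q) \<bullet> b) - M * (\<psi> (x - q) \<bullet> b) = M * (\<psi> (y - x) \<bullet> b)"
        by (simp add: \<psi>_diff inner_diff_left algebra_simps)
      ultimately have "M * \<bar>\<psi> (y - x) \<bullet> b\<bar> \<le> 1" by (simp add: abs_mult)
      then show ?thesis using M by (simp add: field_simps)
    qed (simp add: \<psi>j)
    have "norm (\<psi> (y - x)) \<le> (\<Sum>b\<in>Basis. \<bar>\<psi> (y - x) \<bullet> b\<bar>)" by (rule norm_le_l1)
    also have "\<dots> \<le> (\<Sum>b\<in>(Basis::'a set). 1 / M)" by (intro sum_mono b)
    also have "\<dots> = D / M" by (simp add: D_def)
    finally have "C * norm (\<psi> (y - x)) \<le> C * (D / M)" using C by (rule mult_left_mono)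
    moreover have "norm (y - x) \<le> C * norm (\<psi> (y - x))" unfolding \<psi>_def by (rule sep[OF xy])
    ultimately show ?thesis by (simp add: dist_norm norm_minus_commute)
  qed
  have h2: "C * (D / M) \<ge> 0" using C by simp
  show "\<exists>(U :: nat \<Rightarrow> 'a set) d. S \<subseteq> (\<Union>n. U n) \<and> (\<forall>n. 0 \<le> d n) \<and>
     (\<forall>n. \<forall>x\<in>U n. \<forall>y\<in>U n. dist x y \<le> d n) \<and> (\<Sum>n. ennreal (d n powr s)) \<le> ennreal e"
    by (rule finite_cover[OF finI h1 h2 _ h4]) (rule h3)
qed

lemma cover_null_transversal_zeros:
  fixes g g' :: "'a::euclidean_space \<Rightarrow> real"
  assumes s: "s > real DIM('a) - 1" and v: "v \<noteq> 0"
    and d: "\<And>x t. ((\<lambda>t. g (x + t *\<^sub>R v)) has_real_derivative g' (x + t *\<^sub>R v)) (at t)"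
    and L: "L \<ge> 0" "\<And>x y. \<bar>g x - g y\<bar> \<le> L * norm (x - y)"
    and L': "\<And>x y. \<bar>g' x - g' y\<bar> \<le> L' * norm (x - y)" "L' \<ge> 0"
    and c: "c > 0"
  shows "cover_null s {x. g x = 0 \<and> \<bar>g' x\<bar> \<ge> c}"
proof -
  define S where "S = {x. g x = 0 \<and> \<bar>g' x\<bar> \<ge> c}"
  obtain j where j: "j \<in> Basis" "v \<bullet> j \<noteq> 0" using v by (metis euclidean_all_zero_iff)
  define k where "k = L' * (2 * norm v / \<bar>v \<bullet> j\<bar>)"
  have k: "k \<ge> 0" using L' by (simp add: k_def)
  \<comment> \<open>Two points of a ball of radius \<open>r\<close> differ by at most
    \<open>2 * r / \<bar>v \<bullet> j\<bar>\<close> in the parameter along \<open>v\<close>; then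
    the derivative varies by at most \<open>k * r \<le> c / 2\<close>. The summand 1 guards against
    \<open>k = 0\<close>.\<close>
  define r where "r = c / (2 * (k + 1))"
  have r: "r > 0" using c k by (simp add: r_def)
  have kr: "k * r \<le> c / 2" using c k by (simp add: r_def field_simps)
  have ball: "cover_null s (S \<inter> ball q r)" for q
  proof (rule cover_null_transversal_ball[OF s j, where C = "1 + 2 * L * norm v / c" and q = q and r = r])
    fix x y assume xy: "x \<in> S \<inter> ball q r" "y \<in> S \<inter> ball q r"
    define \<tau> where "\<tau> = (y - x) \<bullet> j / (v \<bullet> j)"
    have "norm (y - x) \<le> 2 * r" using xy norm_triangle_ineq4[of "y - q" "x - q"] by (auto simp: dist_norm norm_minus_commute)
    then have "\<bar>\<tau>\<bar> \<le> 2 * r / \<bar>v \<bullet> j\<bar>"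
      using Basis_le_norm[OF j(1), of "y - x"] by (simp add: \<tau>_def divide_right_mono)
    then have "L' * (\<bar>\<tau>\<bar> * norm v) \<le> L' * ((2 * r / \<bar>v \<bullet> j\<bar>) * norm v)" using L' by (intro mult_left_mono mult_right_mono) auto
    also have "\<dots> = k * r" by (simp add: k_def)
    finally have small: "L' * (\<bar>\<tau>\<bar> * norm v) \<le> c / 2" using kr by linarith
    show "norm (y - x) \<le> (1 + 2 * L * norm v / c) * norm (y - x - ((y - x) \<bullet> j / (v \<bullet> j)) *\<^sub>R v)"
      by (rule transversal_zero_separation[OF d L L' c _ _ _ _ small]) (use xy in \<open>auto simp: S_def \<tau>_def\<close>)
  qed (use r c L in auto)
  obtain Q :: "'a set" where Q: "countable Q" "\<And>X. open X \<Longrightarrow> X \<noteq> {} \<Longrightarrow> \<exists>d\<in>Q. d \<in> X"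
    by (rule countable_dense_setE) blast
  have "cover_null s (\<Union>q\<in>Q. S \<inter> ball q r)" by (intro cover_null_UN Q(1) ball)
  moreover have "S \<subseteq> (\<Union>q\<in>Q. S \<inter> ball q r)"
  proof
    fix x assume x: "x \<in> S"
    obtain q where "q \<in> Q" "q \<in> ball x r" using Q(2)[of "ball x r"] r by auto
    then show "x \<in> (\<Union>q\<in>Q. S \<inter> ball q r)" using x by (auto simp: dist_commute)
  qed
  ultimately show ?thesis unfolding S_def[symmetric] by (rule cover_null_subset)
qed

text \<open>For a zero \<open>x\<close>, a direction \<open>v\<close> from a countable dense set has
  \<open>f (x + v) \<noteq> 0\<close>, so some derivative along \<open>v\<close> is nonzero at
  \<open>x\<close>. The derivative just below the first nonzero one has a transversal zero there.
  Direction, order and lower bound of the slope range over countable sets.\<close>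

theorem cover_null_trig_poly_zeros:
  fixes f :: "'a::euclidean_space \<Rightarrow> real"
  assumes f: "trig_poly M f" and nz: "f x0 \<noteq> 0" and s: "s > real DIM('a) - 1"
  shows "cover_null s {x. f x = 0}"
proof -
  obtain Q :: "'a set" where Q: "countable Q" "\<And>X. open X \<Longrightarrow> X \<noteq> {} \<Longrightarrow> \<exists>d\<in>Q. d \<in> X"
    by (rule countable_dense_setE) blast
  have "\<forall>v. \<exists>G C R. G 0 = f \<and> (\<forall>n x t. ((\<lambda>t. G n (x + t *\<^sub>R v)) has_real_derivative G (Suc n) (x + t *\<^sub>R v)) (at t))
    \<and> (\<forall>n x. \<bar>G n x\<bar> \<le> C * R ^ n) \<and> (\<forall>n. \<exists>L\<ge>0. \<forall>x y. \<bar>G n x - G n y\<bar> \<le> L * norm (x - y))"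
  proof
    fix v
    show "\<exists>G C R. G 0 = f \<and> (\<forall>n x t. ((\<lambda>t. G n (x + t *\<^sub>R v)) has_real_derivative G (Suc n) (x + t *\<^sub>R v)) (at t))
    \<and> (\<forall>n x. \<bar>G n x\<bar> \<le> C * R ^ n) \<and> (\<forall>n. \<exists>L\<ge>0. \<forall>x y. \<bar>G n x - G n y\<bar> \<le> L * norm (x - y))"
      by (rule trig_poly_derivatives[OF f, where v = v]) blast
  qed
  then obtain G C R where G: "\<And>v. G v 0 = f"
    "\<And>v n x t. ((\<lambda>t. G v n (x + t *\<^sub>R v)) has_real_derivative G v (Suc n) (x + t *\<^sub>R v)) (at t)"
    "\<And>v n x. \<bar>G v n x\<bar> \<le> C v * R v ^ n" "\<And>v n. \<exists>L\<ge>0. \<forall>x y. \<bar>G v n x - G v n y\<bar> \<le> L * norm (x - y)"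
    by metis
  define P where "P = (\<lambda>v n k. {x. G v n x = 0 \<and> \<bar>G v (Suc n) x\<bar> \<ge> inverse (real (Suc k))})"
  have P: "cover_null s (P v n k)" if "v \<in> Q - {0}" for v n k
  proof -
    obtain L where L: "L \<ge> 0" "\<And>x y. \<bar>G v n x - G v n y\<bar> \<le> L * norm (x - y)" using G(4) by metis
    obtain L' where L': "L' \<ge> 0" "\<And>x y. \<bar>G v (Suc n) x - G v (Suc n) y\<bar> \<le> L' * norm (x - y)" using G(4) by metis
    show ?thesis unfolding P_def
      by (rule cover_null_transversal_zeros[OF s _ G(2) L L'(2,1)]) (use that in auto)
  qed
  have "cover_null s (\<Union>v\<in>Q - {0}. \<Union>n. \<Union>k. P v n k)"
    by (intro cover_null_UN cover_null_UN_nat P countable_Diff Q(1))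
  moreover have "{x. f x = 0} \<subseteq> (\<Union>v\<in>Q - {0}. \<Union>n. \<Union>k. P v n k)"
  proof
    fix x assume "x \<in> {x. f x = 0}"
    then have fx: "f x = 0" by simp
    have cf: "continuous_on UNIV f"
    proof -
      obtain L where L: "L \<ge> 0" "\<And>x y. \<bar>f x - f y\<bar> \<le> L * norm (x - y)" using G(1,4) by metis
      have "L-lipschitz_on UNIV f" using L by (intro lipschitz_onI) (auto simp: dist_norm)
      then show ?thesis by (rule lipschitz_on_continuous_on)
    qed
    have "continuous_on UNIV (\<lambda>v. f (x + v))"
      by (rule continuous_on_compose2[OF cf]) (intro continuous_intros, simp)
    then have "open {v. f (x + v) \<noteq> 0}" by (intro open_Collect_neq continuous_on_const)
    moreover have "x0 - x \<in> {v. f (x + v) \<noteq> 0}" using nz by simp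
    ultimately obtain v where v: "v \<in> Q" "f (x + v) \<noteq> 0" using Q(2)[of "{v. f (x + v) \<noteq> 0}"] by blast
    then have v0: "v \<noteq> 0" using fx by auto
    have "\<exists>n. G v n x \<noteq> 0"
    proof (rule ccontr)
      assume neg: "\<nexists>n. G v n x \<noteq> 0"
      have "(\<lambda>n t. G v n (x + t *\<^sub>R v)) 0 1 = 0"
        by (rule vanishing_derivatives[where C = "C v" and R = "R v"]) (use G neg in auto)
      then show False using v G(1) by simp
    qed
    define n where "n = (LEAST n. G v n x \<noteq> 0)"
    have n: "G v n x \<noteq> 0" unfolding n_def by (rule LeastI_ex) fact
    then have "n \<noteq> 0" using G(1) fx by metis
    then obtain m where m: "n = Suc m" using not0_implies_Suc by blast
    then have "m < (LEAST n. G v n x \<noteq> 0)" by (simp add: n_def[symmetric])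
    then have zm: "G v m x = 0" using not_less_Least by blast
    obtain k where "inverse (real (Suc k)) < \<bar>G v (Suc m) x\<bar>" using reals_Archimedean[of "\<bar>G v (Suc m) x\<bar>"] n m by auto
    then have "x \<in> P v m k" using zm by (simp add: P_def)
    then show "x \<in> (\<Union>v\<in>Q - {0}. \<Union>n. \<Union>k. P v n k)" using v v0 by blast
  qed
  ultimately show ?thesis by (rule cover_null_subset)
qed

section \<open>The rank of the jet map\<close>

text \<open>The quadratic form of the matrix at \<open>f\<close> is the sum of the squares of
  \<open>h k \<bullet> f\<close>, so its kernel is the common orthogonal complement of the
  \<open>h k\<close>.\<close>

lemma det_gram_eq_0:
  fixes h :: "'j \<Rightarrow> real ^ 'm"
  assumes J: "finite J"
  shows "det (\<chi> p q. \<Sum>k\<in>J. h k $ p * h k $ q) = 0 \<longleftrightarrow> (\<exists>f. f \<noteq> 0 \<and> (\<forall>k\<in>J. h k \<bullet> f = 0))"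
proof -
  let ?A = "\<chi> p q. \<Sum>k\<in>J. h k $ p * h k $ q"
  have Af: "?A *v f = (\<Sum>k\<in>J. (h k \<bullet> f) *\<^sub>R h k)" for f
  proof -
    have "(?A *v f) $ p = (\<Sum>k\<in>J. (h k \<bullet> f) *\<^sub>R h k) $ p" for p
    proof -
      have "(?A *v f) $ p = (\<Sum>q\<in>UNIV. \<Sum>k\<in>J. h k $ p * (h k $ q * f $ q))"
        by (simp add: matrix_vector_mult_def sum_distrib_right mult.assoc)
      also have "\<dots> = (\<Sum>k\<in>J. \<Sum>q\<in>UNIV. h k $ p * (h k $ q * f $ q))" by (rule sum.swap)
      also have "\<dots> = (\<Sum>k\<in>J. h k $ p * (h k \<bullet> f))" by (simp add: inner_vec_def sum_distrib_left)
      finally show ?thesis by (simp add: mult.commute)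
    qed
    then show ?thesis by (simp add: vec_eq_iff)
  qed
  have "det ?A \<noteq> 0 \<longleftrightarrow> invertible ?A" by (simp add: invertible_det_nz)
  also have "\<dots> \<longleftrightarrow> (\<exists>B. B ** ?A = mat 1)" by (rule invertible_left_inverse)
  also have "\<dots> \<longleftrightarrow> (\<forall>f. ?A *v f = 0 \<longrightarrow> f = 0)" by (rule matrix_left_invertible_ker)
  also have "\<dots> \<longleftrightarrow> (\<forall>f. (\<forall>k\<in>J. h k \<bullet> f = 0) \<longrightarrow> f = 0)"
  proof -
    have "?A *v f = 0 \<longleftrightarrow> (\<forall>k\<in>J. h k \<bullet> f = 0)" for f
    proof
      assume "?A *v f = 0"
      then have "(\<Sum>k\<in>J. (h k \<bullet> f) *\<^sub>R h k) \<bullet> f = 0" unfolding Af by simp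
      then have "(\<Sum>k\<in>J. (h k \<bullet> f) * (h k \<bullet> f)) = 0" by (simp add: inner_sum_left)
      then show "\<forall>k\<in>J. h k \<bullet> f = 0" using J by (simp add: sum_nonneg_eq_0_iff)
    qed (simp add: Af)
    then show ?thesis by simp
  qed
  finally show ?thesis by auto
qed

section \<open>Trace-free gradients in place of jets\<close>

definition gradmap :: "torus3 ^ 'k \<Rightarrow> (torus3 \<Rightarrow> real ^ 3) \<Rightarrow> real ^ 3 ^ 3 ^ 'k" where
  "gradmap x W = (\<chi> l. grad W (x $ l))"

definition tracefree :: "(real ^ 3 ^ 3 ^ 'k) set" where
  "tracefree = {M. \<forall>l. trace (M $ l) = 0}"

definition curl_vec :: "real ^ 3 ^ 3 \<Rightarrow> real ^ 3" where
  "curl_vec A = vector [A $ 3 $ 2 - A $ 2 $ 3, A $ 1 $ 3 - A $ 3 $ 1, A $ 2 $ 1 - A $ 1 $ 2]"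

text \<open>An eigenfield equals its curl divided by \<open>lam\<close>, so the value of the field
  is part of the information in its gradient.\<close>

definition jet_of_grad :: "real \<Rightarrow> real ^ 3 ^ 3 ^ 'k \<Rightarrow> ((real ^ 3) \<times> (real ^ 3 ^ 3)) ^ 'k" where
  "jet_of_grad lam M = (\<chi> l. ((1 / lam) *\<^sub>R curl_vec (M $ l), sym_part (M $ l)))"

lemma curl_vec_components:
  "curl_vec A $ 1 = A $ 3 $ 2 - A $ 2 $ 3" "curl_vec A $ 2 = A $ 1 $ 3 - A $ 3 $ 1" "curl_vec A $ 3 = A $ 2 $ 1 - A $ 1 $ 2"
  by (simp_all add: curl_vec_def)

lemma sym_part_nth: "sym_part A $ i $ j = (A $ i $ j + A $ j $ i) / 2"
  by (simp add: sym_part_def transpose_def)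

lemma linear_curl_vec: "linear curl_vec"
  by (rule linearI) (simp_all add: vec_eq_iff forall_3 curl_vec_components algebra_simps)

lemma linear_sym_part: "linear sym_part"
  by (rule linearI) (simp_all add: vec_eq_iff sym_part_nth algebra_simps add_divide_distrib)

lemma grad_determined:
  assumes "curl_vec A = curl_vec B" "sym_part A = sym_part B" shows "A = B"
proof -
  have s: "A $ i $ j + A $ j $ i = B $ i $ j + B $ j $ i" for i j
    using arg_cong[OF assms(2), of "\<lambda>M. M $ i $ j"] by (simp add: sym_part_nth)
  have c: "A $ 3 $ 2 - A $ 2 $ 3 = B $ 3 $ 2 - B $ 2 $ 3" "A $ 1 $ 3 - A $ 3 $ 1 = B $ 1 $ 3 - B $ 3 $ 1" "A $ 2 $ 1 - A $ 1 $ 2 = B $ 2 $ 1 - B $ 1 $ 2"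
    using arg_cong[OF assms(1), of "\<lambda>M. M $ 1"] arg_cong[OF assms(1), of "\<lambda>M. M $ 2"] arg_cong[OF assms(1), of "\<lambda>M. M $ 3"]
    by (simp_all add: curl_vec_components)
  show ?thesis unfolding vec_eq_iff forall_3
    using s[of 1 1] s[of 2 2] s[of 3 3] s[of 1 2] s[of 1 3] s[of 2 3] c by auto
qed

lemma linear_jet_of_grad: "linear (jet_of_grad lam)"
  by (rule linearI)
     (simp_all add: vec_eq_iff jet_of_grad_def linear_add[OF linear_curl_vec] linear_add[OF linear_sym_part]
        linear_scale[OF linear_curl_vec] linear_scale[OF linear_sym_part] algebra_simps)

lemma inj_jet_of_grad:
  assumes "lam \<noteq> 0" shows "inj (jet_of_grad lam)"
proof (rule injI)
  fix M N :: "real ^ 3 ^ 3 ^ 'k" assume e: "jet_of_grad lam M = jet_of_grad lam N"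
  have "M $ l = N $ l" for l
    using arg_cong[OF e, of "\<lambda>J. J $ l"] assms by (rule_tac grad_determined) (simp_all add: jet_of_grad_def)
  then show "M = N" by (simp add: vec_eq_iff)
qed

lemma curl_eq_curl_vec: "curl W p = curl_vec (grad W p)"
  by (simp add: curl_def curl_vec_def)

lemma jet_map_eq:
  assumes "W \<in> curl_eigenspace lam" "lam > 0" shows "jet_map x W = jet_of_grad lam (gradmap x W)"
proof -
  have "W p = (1 / lam) *\<^sub>R curl_vec (grad W p)" for p
    using assms unfolding curl_eigenspace_def by (simp flip: curl_eq_curl_vec)
  then show ?thesis by (simp add: jet_map_def jet_of_grad_def gradmap_def vec_eq_iff)
qed

lemma jet_space_eq:
  assumes lam: "lam > 0" shows "jet_space = jet_of_grad lam ` tracefree"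
proof (intro equalityI subsetI)
  fix y :: "((real ^ 3) \<times> (real ^ 3 ^ 3)) ^ 'k" assume y: "y \<in> jet_space"
  \<comment> \<open>The antisymmetric matrix whose curl vector is \<open>u\<close>; the halves
    compensate for the difference of two opposite entries.\<close>
  define B where "B = (\<lambda>u :: real ^ 3. vector [vector [0, - u $ 3 / 2, u $ 2 / 2], vector [u $ 3 / 2, 0, - u $ 1 / 2], vector [- u $ 2 / 2, u $ 1 / 2, 0]] :: real ^ 3 ^ 3)"
  have B: "curl_vec (B u) = u" "transpose (B u) = - B u" "trace (B u) = 0" for u
    by (simp_all add: B_def vec_eq_iff forall_3 curl_vec_components transpose_def trace_def sum_3)
  define M where "M = (\<chi> l. snd (y $ l) + B (lam *\<^sub>R fst (y $ l)))"
  have S: "transpose (snd (y $ l)) = snd (y $ l)" "trace (snd (y $ l)) = 0" for l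
    using y by (auto simp: jet_space_def Sym0_def)
  have cs: "curl_vec (snd (y $ l)) = 0" for l
  proof -
    have "snd (y $ l) $ i $ j = snd (y $ l) $ j $ i" for i j
      using arg_cong[OF S(1)[of l], of "\<lambda>A. A $ i $ j"] by (simp add: transpose_def)
    then show ?thesis by (simp add: vec_eq_iff forall_3 curl_vec_components)
  qed
  have "sym_part (M $ l) = snd (y $ l)" for l
  proof -
    have "transpose (M $ l) = snd (y $ l) - B (lam *\<^sub>R fst (y $ l))"
    proof -
      have "transpose (A + C) = transpose A + transpose C" for A C :: "real ^ 3 ^ 3" by (simp add: vec_eq_iff transpose_def)
      then show ?thesis by (simp add: M_def S(1) B(2))
    qed
    then show ?thesis by (simp add: sym_part_def M_def scaleR_2[symmetric])
  qed
  moreover have "curl_vec (M $ l) = lam *\<^sub>R fst (y $ l)" for l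
    by (simp add: M_def linear_add[OF linear_curl_vec] cs B)
  ultimately have "jet_of_grad lam M = y" using lam by (simp add: jet_of_grad_def vec_eq_iff prod_eq_iff)
  moreover have "M \<in> tracefree" using S(2) B(3) by (simp add: tracefree_def M_def trace_add)
  ultimately show "y \<in> jet_of_grad lam ` tracefree" by blast
next
  fix y assume "y \<in> jet_of_grad lam ` (tracefree :: (real ^ 3 ^ 3 ^ 'k) set)"
  then obtain M :: "real ^ 3 ^ 3 ^ 'k" where M: "M \<in> tracefree" "y = jet_of_grad lam M" by blast
  have "transpose (sym_part A) = sym_part A" "trace (sym_part A) = trace A" for A
    by (simp_all add: vec_eq_iff transpose_def sym_part_nth add.commute trace_def)
  then show "y \<in> jet_space" using M by (simp add: jet_space_def Sym0_def jet_of_grad_def tracefree_def)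
qed

lemma gradmap_combination:
  assumes "finite K" "\<And>k. k \<in> K \<Longrightarrow> V k \<in> curl_eigenspace lam"
  shows "gradmap x (\<lambda>p. \<Sum>k\<in>K. c k *\<^sub>R V k p) = (\<Sum>k\<in>K. c k *\<^sub>R gradmap x (V k))"
proof -
  have "grad (\<lambda>p. \<Sum>k\<in>K. c k *\<^sub>R V k p) p = (\<Sum>k\<in>K. c k *\<^sub>R grad (V k) p)" for p
    by (rule grad_linear_combination(2)[OF assms(1)]) (use assms(2) in \<open>auto simp: curl_eigenspace_def\<close>)
  then show ?thesis by (simp add: gradmap_def vec_eq_iff)
qed

lemma gradmap_basis:
  "gradmap x (\<lambda>p. \<Sum>k\<in>mode_index lam. c k *\<^sub>R basis_mode lam k p) = (\<Sum>k\<in>mode_index lam. c k *\<^sub>R gradmap x (basis_mode lam k))"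
  by (rule gradmap_combination[OF finite_mode_index]) (rule basis_mode_eigenfield)

lemma eigenspace_basis: "(\<lambda>p. \<Sum>k\<in>mode_index lam. c k *\<^sub>R basis_mode lam k p) \<in> curl_eigenspace lam"
  by (rule curl_eigenspace_combination[OF finite_mode_index]) (rule basis_mode_eigenfield)

lemma gradmap_image:
  assumes "lam > 0"
  shows "gradmap x ` curl_eigenspace lam = range (\<lambda>c. \<Sum>k\<in>mode_index lam. c k *\<^sub>R gradmap x (basis_mode lam k))"
proof (intro equalityI subsetI)
  fix M assume "M \<in> gradmap x ` curl_eigenspace lam"
  then obtain W where W: "W \<in> curl_eigenspace lam" "M = gradmap x W" by blast
  obtain c where "\<And>p. W p = (\<Sum>k\<in>mode_index lam. c k *\<^sub>R basis_mode lam k p)" by (rule eigenfield_span[OF W(1) assms], rule that)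
  then have "W = (\<lambda>p. \<Sum>k\<in>mode_index lam. c k *\<^sub>R basis_mode lam k p)" by blast
  then have "M = (\<Sum>k\<in>mode_index lam. c k *\<^sub>R gradmap x (basis_mode lam k))"
    using W(2) by (simp only: gradmap_basis)
  then show "M \<in> range (\<lambda>c. \<Sum>k\<in>mode_index lam. c k *\<^sub>R gradmap x (basis_mode lam k))" by blast
next
  fix M assume "M \<in> range (\<lambda>c. \<Sum>k\<in>mode_index lam. c k *\<^sub>R gradmap x (basis_mode lam k))"
  then obtain c where "M = (\<Sum>k\<in>mode_index lam. c k *\<^sub>R gradmap x (basis_mode lam k))" by blast
  then have "M = gradmap x (\<lambda>p. \<Sum>k\<in>mode_index lam. c k *\<^sub>R basis_mode lam k p)"
    by (simp only: gradmap_basis)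
  then show "M \<in> gradmap x ` curl_eigenspace lam"
    using eigenspace_basis by blast
qed

lemma trace_basis_mode:
  assumes "k \<in> mode_index lam" shows "trace (grad (basis_mode lam k) p) = 0"
proof -
  obtain n \<theta> j where k: "k = (n, \<theta>, j)" by (metis prod.exhaust)
  have n: "n \<in> int_vecs" "n \<bullet> n = lam^2" using assms by (auto simp: k mode_index_def freqs_def)
  obtain x where x: "tproj x = p" using tproj_surj by blast
  define a :: "real ^ 3" where "a = axis j 1"
  define s c d where "s = sin (n \<bullet> x + \<theta>)" "c = cos (n \<bullet> x + \<theta>)" "d = n \<bullet> a"
  note df = this
  have g: "grad (basis_mode lam k) p $ i $ i = (- s * (lam^2 * a $ i - d * n $ i) - c * (lam * cross3 n a $ i)) * n $ i" for i
    unfolding k basis_mode_def x[symmetric] a_def df by (simp add: beltrami_mode_grad[OF n(1)])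
  have "trace (grad (basis_mode lam k) p) = - s * (lam^2 * (n $ 1 * a $ 1 + n $ 2 * a $ 2 + n $ 3 * a $ 3) - d * (n $ 1 * n $ 1 + n $ 2 * n $ 2 + n $ 3 * n $ 3))
      - c * lam * (n $ 1 * cross3 n a $ 1 + n $ 2 * cross3 n a $ 2 + n $ 3 * cross3 n a $ 3)"
    unfolding trace_def sum_3 g by (simp add: algebra_simps)
  also have "\<dots> = - s * (lam^2 * d - d * lam^2) - c * lam * (n \<bullet> cross3 n a)"
    unfolding inner_real3[symmetric] df n(2) ..
  also have "n \<bullet> cross3 n a = 0" by (rule dot_cross_self)
  finally show ?thesis by simp
qed

lemma linear_trace: "linear (trace :: real ^ 3 ^ 3 \<Rightarrow> real)"
  by (rule linearI) (simp_all add: trace_def sum.distrib sum_distrib_left)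

lemma subspace_tracefree: "subspace tracefree"
  unfolding subspace_def tracefree_def
  by (simp add: linear_0[OF linear_trace] linear_add[OF linear_trace] linear_scale[OF linear_trace])

lemma gradmap_tracefree:
  assumes "lam > 0" shows "gradmap x ` curl_eigenspace lam \<subseteq> tracefree"
proof -
  have "gradmap x (basis_mode lam k) \<in> tracefree" if "k \<in> mode_index lam" for k
    using trace_basis_mode[OF that] by (simp add: tracefree_def gradmap_def)
  then have "(\<Sum>k\<in>mode_index lam. c k *\<^sub>R gradmap x (basis_mode lam k)) \<in> tracefree" for c
    by (intro subspace_sum subspace_scale subspace_tracefree)
  then show ?thesis unfolding gradmap_image[OF assms] by blast
qed

lemma inner_mat_1: "mat 1 \<bullet> A = trace (A :: real ^ 3 ^ 3)"
  by (simp add: inner_vec_def trace_def mat_def sum_3)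

text \<open>Orthogonal complement, in dimension \<open>9 * CARD('k)\<close>, of the pairwise
  orthogonal trace directions, one for each point.\<close>

lemma dim_tracefree: "dim (tracefree :: (real ^ 3 ^ 3 ^ 'k) set) = 8 * CARD('k)"
proof -
  define r :: "'k \<Rightarrow> real ^ 3 ^ 3 ^ 'k" where "r = (\<lambda>l. axis l (mat 1))"
  have r: "r l \<bullet> M = trace (M $ l)" for l M by (simp add: r_def inner_axis' inner_mat_1)
  have t3: "trace (mat 1 :: real ^ 3 ^ 3) = 3" by (simp add: trace_def mat_def sum_3)
  have rr: "r l \<bullet> r m = (if l = m then 3 else 0)" for l m
    unfolding r by (simp add: r_def axis_def t3 linear_0[OF linear_trace])
  have inj: "inj r" by (rule injI) (metis rr zero_neq_numeral)
  have r0: "0 \<notin> range r" using rr by (metis imageE inner_zero_left zero_neq_numeral)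
  have "pairwise orthogonal (range r)" by (auto simp: pairwise_def orthogonal_def rr)
  then have "independent (range r)" using r0 by (rule pairwise_orthogonal_independent)
  then have d1: "dim (span (range r)) = CARD('k)" by (simp add: dim_eq_card_independent card_image[OF inj])
  have "{y \<in> UNIV. \<forall>x\<in>span (range r). orthogonal x y} = tracefree"
  proof (intro equalityI subsetI)
    fix y assume "y \<in> {y \<in> UNIV. \<forall>x\<in>span (range r). orthogonal x y}"
    then have "orthogonal (r l) y" for l by (auto intro: span_base)
    then show "y \<in> tracefree" by (simp add: tracefree_def orthogonal_def r)
  next
    fix y :: "real ^ 3 ^ 3 ^ 'k" assume y: "y \<in> tracefree"
    then have gen: "orthogonal y x" if "x \<in> range r" for x
      using that by (auto simp: orthogonal_def inner_commute[of y] r tracefree_def)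
    have "orthogonal y x" if "x \<in> span (range r)" for x by (rule orthogonal_to_span[OF that]) (rule gen)
    then show "y \<in> {y \<in> UNIV. \<forall>x\<in>span (range r). orthogonal x y}" by (simp add: orthogonal_commute)
  qed
  moreover have "dim {y \<in> UNIV. \<forall>x\<in>span (range r). orthogonal x y} + dim (span (range r)) = dim (UNIV :: (real ^ 3 ^ 3 ^ 'k) set)"
    by (rule dim_subspace_orthogonal_to_vectors) auto
  ultimately show ?thesis using d1 by simp
qed

lemma jet_rank_eq:
  assumes "lam > 0" shows "jet_rank lam x = dim (gradmap x ` curl_eigenspace lam)"
proof -
  have "jet_map x ` curl_eigenspace lam = jet_of_grad lam ` gradmap x ` curl_eigenspace lam"
    unfolding image_image using assms by (intro image_cong refl) (simp add: jet_map_eq)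
  then show ?thesis unfolding jet_rank_def
    using assms by (simp add: dim_image_eq[OF linear_jet_of_grad inj_on_subset[OF inj_jet_of_grad]])
qed

lemma subspace_gradmap_image:
  assumes "lam > 0" shows "subspace (gradmap x ` curl_eigenspace lam)"
  unfolding gradmap_image[OF assms] subspace_def
proof (intro conjI ballI allI)
  let ?f = "\<lambda>c. \<Sum>k\<in>mode_index lam. c k *\<^sub>R gradmap x (basis_mode lam k)"
  show "0 \<in> range ?f" by (rule range_eqI[of _ _ "\<lambda>_. 0"]) simp
  fix M assume "M \<in> range ?f"
  then obtain c where c: "M = ?f c" by blast
  show "r *\<^sub>R M \<in> range ?f" for r
    by (rule range_eqI[of _ _ "\<lambda>k. r * c k"]) (simp add: c scaleR_sum_right)
  fix N assume "N \<in> range ?f"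
  then obtain d where d: "N = ?f d" by blast
  show "M + N \<in> range ?f"
    by (rule range_eqI[of _ _ "\<lambda>k. c k + d k"]) (simp add: c d scaleR_add_left sum.distrib)
qed

text \<open>The gradients of eigenfields form a subspace of the trace-free families. If it is
  proper, a nonzero trace-free family is orthogonal to it, and orthogonality can be tested on the
  finitely many spanning modes.\<close>

lemma full_rank_iff:
  fixes x :: "torus3 ^ 'k"
  assumes lam: "lam > 0"
  shows "jet_rank lam x < 8 * CARD('k) \<longleftrightarrow> gradmap x ` curl_eigenspace lam \<noteq> tracefree"
    and "jet_rank lam x < 8 * CARD('k) \<longleftrightarrow> (\<exists>f\<in>tracefree. f \<noteq> 0 \<and> (\<forall>k\<in>mode_index lam. gradmap x (basis_mode lam k) \<bullet> f = 0))"
proof -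
  let ?G = "gradmap x ` curl_eigenspace lam"
  note sub = gradmap_tracefree[OF lam, of x]
  note ss = subspace_gradmap_image[OF lam, of x]
  have le: "dim ?G \<le> 8 * CARD('k)" using dim_subset[OF sub] by (simp add: dim_tracefree)
  have eqI: "?G = tracefree" if "dim ?G = 8 * CARD('k)"
    using subspace_dim_equal[OF ss subspace_tracefree sub] that by (simp add: dim_tracefree)
  show A: "jet_rank lam x < 8 * CARD('k) \<longleftrightarrow> ?G \<noteq> tracefree"
    unfolding jet_rank_eq[OF lam]
  proof
    assume lt: "dim ?G < 8 * CARD('k)"
    show "?G \<noteq> tracefree"
    proof
      assume "?G = tracefree"
      with lt show False by (simp add: dim_tracefree)
    qed
  next
    assume "?G \<noteq> tracefree"
    then show "dim ?G < 8 * CARD('k)" using eqI le by linarith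
  qed
  show "jet_rank lam x < 8 * CARD('k) \<longleftrightarrow> (\<exists>f\<in>tracefree. f \<noteq> 0 \<and> (\<forall>k\<in>mode_index lam. gradmap x (basis_mode lam k) \<bullet> f = 0))"
    unfolding A
  proof
    assume "?G \<noteq> tracefree"
    moreover have "span ?G = ?G" using ss by (simp add: span_eq_iff)
    moreover have spt: "span tracefree = (tracefree :: (real ^ 3 ^ 3 ^ 'k) set)" using subspace_tracefree by (simp add: span_eq_iff)
    ultimately have "span ?G \<subset> span tracefree" using sub by blast
    then obtain f where f: "f \<noteq> 0" "f \<in> span tracefree" "\<And>y. y \<in> span ?G \<Longrightarrow> orthogonal f y"
      using orthogonal_to_subspace_exists_gen by blast
    have "f \<in> tracefree" using f(2) unfolding spt .
    moreover have "gradmap x (basis_mode lam k) \<bullet> f = 0" if "k \<in> mode_index lam" for k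
      using f(3)[of "gradmap x (basis_mode lam k)"] basis_mode_eigenfield[OF that] by (auto simp: orthogonal_def inner_commute intro: span_base)
    ultimately show "\<exists>f\<in>tracefree. f \<noteq> 0 \<and> (\<forall>k\<in>mode_index lam. gradmap x (basis_mode lam k) \<bullet> f = 0)" using f(1) by blast
  next
    assume "\<exists>f\<in>tracefree. f \<noteq> 0 \<and> (\<forall>k\<in>mode_index lam. gradmap x (basis_mode lam k) \<bullet> f = 0)"
    then obtain f where f: "f \<in> tracefree" "f \<noteq> 0" "\<And>k. k \<in> mode_index lam \<Longrightarrow> gradmap x (basis_mode lam k) \<bullet> f = 0" by blast
    show "?G \<noteq> tracefree"
    proof
      assume "?G = tracefree"
      then have "f \<in> ?G" using f(1) by simp
      then obtain c where "f = (\<Sum>k\<in>mode_index lam. c k *\<^sub>R gradmap x (basis_mode lam k))"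
        unfolding gradmap_image[OF lam] by blast
      then have "f \<bullet> f = (\<Sum>k\<in>mode_index lam. c k *\<^sub>R gradmap x (basis_mode lam k)) \<bullet> f" by simp
      also have "\<dots> = 0" by (simp add: inner_sum_left f(3))
      finally show False using f(2) by simp
    qed
  qed
qed

text \<open>A determinant needs a single index type for rows and columns; flattening preserves inner
  products.\<close>

definition flat :: "real ^ 3 ^ 3 ^ 'k \<Rightarrow> real ^ ('k \<times> 3 \<times> 3)" where
  "flat M = (\<chi> q. M $ fst q $ fst (snd q) $ snd (snd q))"

lemma flat_inner: "flat M \<bullet> flat N = M \<bullet> N"
proof -
  have "flat M \<bullet> flat N = (\<Sum>(l, i, j)\<in>UNIV. M $ l $ i $ j * N $ l $ i $ j)"
    by (simp add: inner_vec_def flat_def split_def)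
  also have "\<dots> = (\<Sum>l\<in>UNIV. \<Sum>(i, j)\<in>UNIV. M $ l $ i $ j * N $ l $ i $ j)"
    unfolding UNIV_Times_UNIV[symmetric] by (subst sum.cartesian_product) simp
  also have "\<dots> = (\<Sum>l\<in>UNIV. \<Sum>i\<in>UNIV. \<Sum>j\<in>UNIV. M $ l $ i $ j * N $ l $ i $ j)"
    unfolding UNIV_Times_UNIV[symmetric] by (subst (2) sum.cartesian_product) simp
  finally show ?thesis by (simp add: inner_vec_def)
qed

lemma flat_surj: "\<exists>M. flat M = f"
  by (rule exI[of _ "\<chi> l i j. f $ (l, i, j)"]) (simp add: flat_def vec_eq_iff)

lemma flat_eq_0_iff: "flat M = 0 \<longleftrightarrow> M = 0"
  using flat_inner[of M M] by (metis inner_eq_zero_iff)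

text \<open>The Gram matrix of the gradients of the basis modes, with the trace directions added to
  make it nonsingular exactly at the configurations of full rank.\<close>

definition gram_vector :: "real \<Rightarrow> torus3 ^ 'k \<Rightarrow> ((real ^ 3) \<times> real \<times> 3) + 'k \<Rightarrow> real ^ ('k \<times> 3 \<times> 3)" where
  "gram_vector lam x s = (case s of Inl k \<Rightarrow> flat (gradmap x (basis_mode lam k)) | Inr l \<Rightarrow> flat (axis l (mat 1)))"

definition gram_det :: "real \<Rightarrow> torus3 ^ 'k \<Rightarrow> real" where
  "gram_det lam x = det (\<chi> p q. \<Sum>s\<in>mode_index lam <+> UNIV. gram_vector lam x s $ p * gram_vector lam x s $ q)"

lemma gram_det_eq_0_iff:
  fixes x :: "torus3 ^ 'k"
  assumes lam: "lam > 0" shows "gram_det lam x = 0 \<longleftrightarrow> jet_rank lam x < 8 * CARD('k)"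
proof -
  have fin: "finite (mode_index lam <+> (UNIV :: 'k set))" by (simp add: finite_mode_index)
  have "gram_det lam x = 0 \<longleftrightarrow> (\<exists>f. f \<noteq> 0 \<and> (\<forall>s\<in>mode_index lam <+> UNIV. gram_vector lam x s \<bullet> f = 0))"
    unfolding gram_det_def by (rule det_gram_eq_0[OF fin])
  also have "\<dots> \<longleftrightarrow> (\<exists>M :: real ^ 3 ^ 3 ^ 'k. M \<noteq> 0 \<and> (\<forall>s\<in>mode_index lam <+> UNIV. gram_vector lam x s \<bullet> flat M = 0))"
  proof
    assume "\<exists>f. f \<noteq> 0 \<and> (\<forall>s\<in>mode_index lam <+> UNIV. gram_vector lam x s \<bullet> f = 0)"
    then obtain f where f: "f \<noteq> 0" "\<forall>s\<in>mode_index lam <+> UNIV. gram_vector lam x s \<bullet> f = 0" by blast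
    obtain M where M: "flat M = f" using flat_surj by blast
    then have "M \<noteq> 0" using f(1) flat_eq_0_iff[of M] by simp
    then show "\<exists>M :: real ^ 3 ^ 3 ^ 'k. M \<noteq> 0 \<and> (\<forall>s\<in>mode_index lam <+> UNIV. gram_vector lam x s \<bullet> flat M = 0)"
      using f(2) M by (intro exI[of _ M]) simp
  next
    assume "\<exists>M :: real ^ 3 ^ 3 ^ 'k. M \<noteq> 0 \<and> (\<forall>s\<in>mode_index lam <+> UNIV. gram_vector lam x s \<bullet> flat M = 0)"
    then obtain M :: "real ^ 3 ^ 3 ^ 'k" where M: "M \<noteq> 0" "\<forall>s\<in>mode_index lam <+> UNIV. gram_vector lam x s \<bullet> flat M = 0" by blast
    then show "\<exists>f. f \<noteq> 0 \<and> (\<forall>s\<in>mode_index lam <+> UNIV. gram_vector lam x s \<bullet> f = 0)"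
      using flat_eq_0_iff[of M] by (intro exI[of _ "flat M"]) simp
  qed
  also have "\<dots> \<longleftrightarrow> (\<exists>f\<in>tracefree. f \<noteq> 0 \<and> (\<forall>k\<in>mode_index lam. gradmap x (basis_mode lam k) \<bullet> f = 0))"
  proof -
    have "(\<forall>s\<in>mode_index lam <+> UNIV. gram_vector lam x s \<bullet> flat M = 0) \<longleftrightarrow>
      (\<forall>k\<in>mode_index lam. gradmap x (basis_mode lam k) \<bullet> M = 0) \<and> M \<in> tracefree" for M
      by (simp add: Plus_def ball_Un gram_vector_def flat_inner inner_axis' inner_mat_1 tracefree_def)
    then show ?thesis by blast
  qed
  also have "\<dots> \<longleftrightarrow> jet_rank lam x < 8 * CARD('k)" by (rule full_rank_iff(2)[OF lam, symmetric])
  finally show ?thesis .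
qed

lemma trig_poly_gram_det: "trig_poly UNIV (\<lambda>u. gram_det lam (tprojs u :: torus3 ^ 'k))"
proof -
  have "trig_poly UNIV (\<lambda>u :: real ^ 3 ^ 'k. gram_vector lam (tprojs u) s $ p)" if "s \<in> mode_index lam <+> UNIV" for s p
  proof (cases s)
    case (Inr l)
    then show ?thesis by (simp add: gram_vector_def trig_poly_const)
  next
    case (Inl k)
    obtain n \<theta> j where k: "k = (n, \<theta>, j)" by (metis prod.exhaust)
    have n: "n \<in> int_vecs" using that by (auto simp: Inl k mode_index_def freqs_def)
    obtain l i i' where p: "p = (l, i, i')" by (metis prod.exhaust)
    have ax: "axis l n \<bullet> u = n \<bullet> u $ l" for u :: "real ^ 3 ^ 'k" by (simp add: inner_axis')
    \<comment> \<open>The frequency \<open>axis l n\<close> sees only the \<open>l\<close>-th point,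
      and the sine is written as a cosine with phase lowered by \<open>pi / 2\<close>.\<close>
    have "gram_vector lam (tprojs u) s $ p = (- (lam^2 * axis j 1 $ i - (n \<bullet> axis j 1) * n $ i) * n $ i') * cos (axis l n \<bullet> u + (\<theta> - pi / 2))
       + (- (lam * cross3 n (axis j 1) $ i) * n $ i') * cos (axis l n \<bullet> u + \<theta>)" for u :: "real ^ 3 ^ 'k"
    proof -
      have "cos (axis l n \<bullet> u + (\<theta> - pi / 2)) = sin (n \<bullet> u $ l + \<theta>)"
        using cos_diff[of "n \<bullet> u $ l + \<theta>" "pi / 2"] by (simp add: ax algebra_simps)
      then show ?thesis
        unfolding Inl k p by (simp add: gram_vector_def flat_def gradmap_def tprojs_nth basis_mode_def beltrami_mode_grad[OF n] ax algebra_simps)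
    qed
    then show ?thesis by (simp only:) (intro trig_poly.intros UNIV_I)
  qed
  then show ?thesis unfolding gram_det_def
    by (intro trig_poly_det) (simp_all add: trig_poly_sum trig_poly_mult)
qed

section \<open>Generic surjectivity\<close>

lemma vec_of_triple_freqs:
  assumes "n \<in> int_sphere l" shows "vec_of_triple n \<in> freqs (of_int l)"
proof -
  obtain x y z where n: "n = (x, y, z)" by (metis prod.exhaust)
  have "real_of_int (x * x + y * y + z * z) = real_of_int (l * l)"
    using assms by (simp add: n int_sphere_def power2_eq_square)
  then show ?thesis
    by (simp add: n freqs_def int_vecs_def forall_3 vec_of_triple_def inner_real3 power2_eq_square)
qed

lemma polarization_eq:
  assumes n: "n \<in> int_sphere l"
  shows "polarization l n $ i = of_real (((of_int l)^2 *\<^sub>R axis 1 1 - (vec_of_triple n \<bullet> axis 1 1) *\<^sub>R vec_of_triple n) $ i)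
     + \<i> * of_real ((of_int l *\<^sub>R cross3 (vec_of_triple n) (axis 1 1)) $ i)"
proof -
  obtain x y z where xyz: "n = (x, y, z)" by (metis prod.exhaust)
  show ?thesis using exhaust_3[of i]
    by (auto simp: xyz polarization_def vec_of_triple_def cross3_components inner_real3 axis_def power2_eq_square)
qed

text \<open>The inner product with \<open>(1, N, N^2)\<close> for \<open>N = 2 * l + 1\<close>.
  Coordinates of absolute value at most \<open>l\<close> are balanced digits in base
  \<open>N\<close>, so the code determines a frequency on the sphere.\<close>

definition line_code :: "int \<Rightarrow> int \<times> int \<times> int \<Rightarrow> int" where
  "line_code l = (\<lambda>(x, y, z). x + (2 * l + 1) * (y + (2 * l + 1) * z))"

lemma inj_on_line_code:
  assumes l: "l > 0" shows "inj_on (line_code l) (int_sphere l)"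
proof (rule inj_onI)
  fix n m assume n: "n \<in> int_sphere l" and m: "m \<in> int_sphere l" and e: "line_code l n = line_code l m"
  have bound: "\<bar>x\<bar> \<le> l \<and> \<bar>y\<bar> \<le> l" if "(x, y, z) \<in> int_sphere l" for x y z
  proof -
    have "x^2 + y^2 + z^2 = l^2" using that by (simp add: int_sphere_def)
    then have "x^2 \<le> l^2" "y^2 \<le> l^2" using zero_le_power2[of x] zero_le_power2[of y] zero_le_power2[of z] by linarith+
    then show ?thesis using l by (simp add: abs_le_square_iff[symmetric])
  qed
  have digit: "a = b \<and> c = d" if "a + (2 * l + 1) * c = b + (2 * l + 1) * d" "\<bar>a\<bar> \<le> l" "\<bar>b\<bar> \<le> l" for a b c d
  proof -
    have "a - b = (2 * l + 1) * (d - c)" using that(1) by (simp add: algebra_simps)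
    then have "(2 * l + 1) dvd a - b" by simp
    then have "a - b = 0" by (rule dvd_small_eq_0) (use that in linarith)
    then show ?thesis using that(1) l by simp
  qed
  obtain x y z where n': "n = (x, y, z)" by (metis prod.exhaust)
  obtain x' y' z' where m': "m = (x', y', z')" by (metis prod.exhaust)
  have b: "\<bar>x\<bar> \<le> l" "\<bar>y\<bar> \<le> l" "\<bar>x'\<bar> \<le> l" "\<bar>y'\<bar> \<le> l" using bound n m n' m' by blast+
  have "x + (2 * l + 1) * (y + (2 * l + 1) * z) = x' + (2 * l + 1) * (y' + (2 * l + 1) * z')"
    using e by (simp add: n' m' line_code_def)
  from digit[OF this b(1,3)] have "x = x'" and "y + (2 * l + 1) * z = y' + (2 * l + 1) * z'" by auto
  from digit[OF this(2) b(2,4)] show "n = m" using \<open>x = x'\<close> by (simp add: n' m')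
qed

text \<open>All points are placed on one line whose direction separates the frequencies. The extra indices
  \<open>Inr i\<close>, with half-integer exponents, make the trace functional visible as well.\<close>

lemma exists_full_rank:
  assumes l: "odd l" "l > 0" and big: "1944 * CARD('k) + 6 \<le> card (int_sphere l)"
  shows "\<exists>x :: torus3 ^ 'k. gram_det (of_int l) x \<noteq> 0"
proof -
  define lam where "lam = real_of_int l"
  have lam: "lam > 0" using l by (simp add: lam_def)
  \<comment> \<open>The \<open>9 * CARD('k)\<close> additional indices all carry the identity
    tensor; their number is what interpolation at \<open>CARD('k)\<close> points with nine entries
    requires.\<close>
  define I where "I = Inl ` off_axis_sphere l \<union> Inr ` {..<9 * CARD('k)}"
  define idt :: "complex ^ (3 \<times> 3)" where "idt = (\<chi> p. if fst p = snd p then 1 else 0)"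
  define th where "th = case_sum (\<lambda>n. real_of_int (line_code l n)) (\<lambda>i::nat. real i + 1/2)"
  define w where "w = case_sum (mode_tensor l) (\<lambda>i::nat. idt)"
  have fI: "finite I" by (simp add: I_def finite_off_axis_sphere)
  have half: "real_of_int a \<noteq> real i + 1/2" for a :: int and i :: nat
  proof
    assume "real_of_int a = real i + 1/2"
    then have "real_of_int (2 * a) = real_of_int (2 * int i + 1)" by simp
    then have "2 * a = 2 * int i + 1" by (simp only: of_int_eq_iff)
    then show False by presburger
  qed
  have inj: "inj_on th I"
  proof (rule inj_onI)
    fix s s' assume s: "s \<in> I" "s' \<in> I" "th s = th s'"
    show "s = s'"
    proof (cases s)
      case n: (Inl n)
      show ?thesis
      proof (cases s')
        case m: (Inl m)
        have "n \<in> int_sphere l" "m \<in> int_sphere l" using s by (auto simp: n m I_def off_axis_sphere_def)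
        moreover have "line_code l n = line_code l m" using s(3) by (simp add: n m th_def)
        ultimately show ?thesis using inj_on_line_code[OF l(2)] by (simp add: n m inj_on_def)
      next
        case (Inr i) then show ?thesis using s(3) half by (simp add: n th_def)
      qed
    next
      case i: (Inr i)
      show ?thesis
      proof (cases s')
        case (Inl m) then show ?thesis using s(3) half[of "line_code l m" i] by (simp add: i th_def)
      next
        case (Inr j) then show ?thesis using s(3) by (simp add: i th_def)
      qed
    qed
  qed
  have cidt: "cdot f idt = f $ (1,1) + f $ (2,2) + f $ (3,3)" for f
    by (simp add: cdot_def idt_def sum_UNIV_prod sum_3)
  \<comment> \<open>A functional of nonzero trace sees all additional indices. A trace-free one sees
    at least one in 216 off-axis frequencies, of which there are at least
    \<open>1944 * CARD('k)\<close>.\<close>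
  have robust: "CARD(3 \<times> 3) * card (UNIV :: 'k set) \<le> card {s \<in> I. cdot f (w s) \<noteq> 0}" if f: "f \<noteq> 0" for f
  proof (cases "cdot f idt = 0")
    case True
    have "card (int_sphere l) \<le> card (off_axis_sphere l) + 6" by (rule card_off_axis_sphere)
    moreover have "card (off_axis_sphere l) \<le> 216 * card {n \<in> off_axis_sphere l. cdot f (mode_tensor l n) \<noteq> 0}"
      by (rule misses_lower_bound[OF l(1) f]) (use True cidt in simp)
    ultimately have "9 * CARD('k) \<le> card {n \<in> off_axis_sphere l. cdot f (mode_tensor l n) \<noteq> 0}" using big by linarith
    also have "\<dots> = card (Inl ` {n \<in> off_axis_sphere l. cdot f (mode_tensor l n) \<noteq> 0} :: ((int \<times> int \<times> int) + nat) set)"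
      by (rule card_image[symmetric]) simp
    also have "\<dots> \<le> card {s \<in> I. cdot f (w s) \<noteq> 0}"
      using fI by (intro card_mono) (auto simp: I_def w_def)
    finally show ?thesis by simp
  next
    case False
    have "9 * CARD('k) = card (Inr ` {..<9 * CARD('k)} :: ((int \<times> int \<times> int) + nat) set)"
      by (subst card_image) auto
    also have "\<dots> \<le> card {s \<in> I. cdot f (w s) \<noteq> 0}"
      using fI False by (intro card_mono) (auto simp: I_def w_def)
    finally show ?thesis by simp
  qed
  obtain t :: "'k \<Rightarrow> real" where t: "\<And>f. (\<forall>s\<in>I. (\<Sum>a\<in>UNIV. exp (\<i> * th s * of_real (t a)) * cdot (f a) (w s)) = 0) \<Longrightarrow> (\<forall>a\<in>UNIV. f a = 0)"
    using exponential_interpolation[OF finite_class.finite_UNIV fI inj robust] by blast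
  \<comment> \<open>The inner product of a frequency with this direction is its
    \<open>line_code\<close>, so along the line distinct frequencies have distinct
    exponents.\<close>
  define eta :: "real ^ 3" where "eta = vector [1, of_int (2 * l + 1), of_int ((2 * l + 1) * (2 * l + 1))]"
  define x :: "torus3 ^ 'k" where "x = tprojs (\<chi> a. t a *\<^sub>R eta)"
  have "gram_det lam x \<noteq> 0"
  proof
    assume "gram_det lam x = 0"
    then obtain f where f: "f \<in> tracefree" "f \<noteq> 0" "\<And>k. k \<in> mode_index lam \<Longrightarrow> gradmap x (basis_mode lam k) \<bullet> f = 0"
      unfolding gram_det_eq_0_iff[OF lam] full_rank_iff(2)[OF lam] by blast
    define fc :: "'k \<Rightarrow> complex ^ (3 \<times> 3)" where "fc = (\<lambda>a. \<chi> p. of_real (f $ a $ fst p $ snd p))"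
    have "(\<Sum>a\<in>UNIV. exp (\<i> * th s * of_real (t a)) * cdot (fc a) (w s)) = 0" if s: "s \<in> I" for s
    proof (cases s)
      case (Inr i)
      have "cdot (fc a) idt = of_real (trace (f $ a))" for a
        unfolding cidt by (simp add: fc_def trace_def sum_3)
      then show ?thesis using f(1) by (simp add: Inr w_def tracefree_def)
    next
      case (Inl n)
      then have n: "n \<in> int_sphere l" using s by (auto simp: I_def off_axis_sphere_def)
      define v where "v = vec_of_triple n"
      have v: "v \<in> freqs lam" using vec_of_triple_freqs[OF n] by (simp add: v_def lam_def)
      then have vi: "v \<in> int_vecs" by (simp add: freqs_def)
      define \<alpha> where "\<alpha> = lam^2 *\<^sub>R axis 1 1 - (v \<bullet> axis 1 1) *\<^sub>R v"
      define \<beta> where "\<beta> = lam *\<^sub>R cross3 v (axis 1 1)"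
      define D where "D = (\<lambda>(b :: real ^ 3) a. \<Sum>i\<in>UNIV. \<Sum>j\<in>UNIV. b $ i * v $ j * f $ a $ i $ j)"
      have ph: "v \<bullet> (t a *\<^sub>R eta) = th s * t a" for a
      proof -
        obtain p q r where "n = (p, q, r)" by (metis prod.exhaust)
        then show ?thesis
          by (simp add: Inl th_def v_def vec_of_triple_def eta_def inner_real3 line_code_def algebra_simps)
      qed
      have g: "(\<Sum>a\<in>UNIV. - sin (th s * t a + \<theta>) * D \<alpha> a - cos (th s * t a + \<theta>) * D \<beta> a) = 0"
        if th: "\<theta> \<in> {0, - pi / 2}" for \<theta>
      proof -
        have "(v, \<theta>, 1) \<in> mode_index lam" using v th by (auto simp: mode_index_def)
        from f(3)[OF this] have "gradmap x (basis_mode lam (v, \<theta>, 1)) \<bullet> f = 0" .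
        moreover have "gradmap x (basis_mode lam (v, \<theta>, 1)) \<bullet> f =
          (\<Sum>a\<in>UNIV. \<Sum>i\<in>UNIV. \<Sum>j\<in>UNIV. ((- sin (th s * t a + \<theta>) * \<alpha> $ i - cos (th s * t a + \<theta>) * \<beta> $ i) * v $ j) * f $ a $ i $ j)"
          unfolding inner_vec_def
          by (simp add: gradmap_def x_def tprojs_nth basis_mode_def beltrami_mode_grad[OF vi] ph \<alpha>_def \<beta>_def del: inner_scaleR_right)
        moreover have "(\<Sum>i\<in>UNIV. \<Sum>j\<in>UNIV. ((- sin (th s * t a + \<theta>) * \<alpha> $ i - cos (th s * t a + \<theta>) * \<beta> $ i) * v $ j) * f $ a $ i $ j)
          = - sin (th s * t a + \<theta>) * D \<alpha> a - cos (th s * t a + \<theta>) * D \<beta> a" for a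
          by (simp add: D_def sum_3 algebra_simps)
        ultimately show ?thesis by simp
      qed
      have cd: "cdot (fc a) (mode_tensor l n) = of_real (D \<alpha> a) + \<i> * of_real (D \<beta> a)" for a
      proof -
        have "cdot (fc a) (mode_tensor l n) = (\<Sum>i\<in>UNIV. \<Sum>j\<in>UNIV. of_real (f $ a $ i $ j) * ((of_real (\<alpha> $ i) + \<i> * of_real (\<beta> $ i)) * of_real (v $ j)))"
          unfolding cdot_def sum_UNIV_prod by (simp only: fc_def mode_tensor_def vec_lambda_beta fst_conv snd_conv polarization_eq[OF n] \<alpha>_def \<beta>_def v_def lam_def)
        then show ?thesis by (simp add: D_def sum_3 algebra_simps)
      qed
      let ?S = "\<Sum>a\<in>UNIV. exp (\<i> * th s * of_real (t a)) * cdot (fc a) (w s)"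
      have ex: "exp (\<i> * complex_of_real (th s) * complex_of_real (t a)) = cis (th s * t a)" for a
        by (simp add: cis_conv_exp mult.assoc)
      \<comment> \<open>The modes with phases \<open>- pi / 2\<close> and 0 supply the real part
        and, up to sign, the imaginary part of the complex sum.\<close>
      have "Re ?S = (\<Sum>a\<in>UNIV. - sin (th s * t a + (- pi / 2)) * D \<alpha> a - cos (th s * t a + (- pi / 2)) * D \<beta> a)"
        unfolding ex by (simp add: Inl w_def cd Re_sum sin_diff cos_diff)
      also have "\<dots> = 0" by (rule g) simp
      finally have re: "Re ?S = 0" .
      have "Im ?S = - (\<Sum>a\<in>UNIV. - sin (th s * t a + 0) * D \<alpha> a - cos (th s * t a + 0) * D \<beta> a)"
        unfolding ex by (simp add: Inl w_def cd Im_sum sum_negf[symmetric] add.commute)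
      also have "\<dots> = 0" using g[of 0] by simp
      finally have im: "Im ?S = 0" .
      show ?thesis by (rule complex_eqI) (use re im in simp_all)
    qed
    then have "\<forall>a\<in>UNIV. fc a = 0" by (intro t ballI)
    then have "fc a $ (i, j) = 0" for a i j by simp
    then have "f $ a $ i $ j = 0" for a i j by (simp add: fc_def)
    then show False using f(2) by (simp add: vec_eq_iff)
  qed
  then show ?thesis unfolding lam_def by blast
qed

text \<open>At coinciding points all fields have equal gradients, so a nonzero trace-free matrix
  prescribed at only one of the two indices is not attained.\<close>

lemma full_rank_in_Conf:
  fixes x :: "torus3 ^ 'k"
  assumes lam: "lam > 0" and full: "gram_det lam x \<noteq> 0" shows "x \<in> Conf"
proof (rule ccontr)
  assume "x \<notin> Conf"
  then obtain i j where ij: "i \<noteq> j" "x $ i = x $ j" by (auto simp: Conf_def)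
  define A :: "real ^ 3 ^ 3" where "A = (\<chi> p q. if p = 1 \<and> q = 2 then 1 else 0)"
  define M :: "real ^ 3 ^ 3 ^ 'k" where "M = axis i A"
  have A: "trace A = 0" "A \<noteq> 0" by (auto simp: A_def trace_def sum_3 vec_eq_iff)
  have "M \<in> tracefree" using A(1) by (simp add: tracefree_def M_def axis_def linear_0[OF linear_trace])
  then have "M \<in> gradmap x ` curl_eigenspace lam"
    using full gram_det_eq_0_iff[OF lam, of x] full_rank_iff(1)[OF lam, of x] by blast
  then obtain W where "M = gradmap x W" by blast
  then have "M $ i = M $ j" using ij by (simp add: gradmap_def)
  then show False using ij A(2) by (simp add: M_def axis_def)
qed

theorem theorem2p8:
  shows "\<exists>L::int. \<forall>lam::int. lam \<ge> L \<and> odd lam \<longrightarrow>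
    (let \<Sigma> = Sigma_set (real_of_int lam) :: (torus3 ^ 'k::finite) set;
         E = curl_eigenspace (real_of_int lam)
     in real_analytic_subset Conf \<Sigma> \<and> \<Sigma> \<noteq> Conf \<and>
        hausdorff_dim \<Sigma> \<le> ereal (3 * real CARD('k) - 1) \<and>
        torus_null \<Sigma> \<and>
        top_of_set Conf interior_of \<Sigma> = {} \<and>
        (\<forall>x \<in> Conf - \<Sigma>. jet_map x ` E = jet_space) \<and>
        (\<forall>x \<in> Conf - \<Sigma>. \<forall>H :: 'k \<Rightarrow> real ^ 3 ^ 3. (\<forall>l. H l \<in> Sym0) \<longrightarrow>
           (\<exists>W \<in> E. \<forall>l. W (x $ l) = 0 \<and> grad W (x $ l) = H l)))"
proof -
  obtain L :: int where L: "\<And>l. l \<ge> L \<Longrightarrow> odd l \<Longrightarrow> 1944 * CARD('k) + 6 \<le> card (int_sphere l)"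
    using card_int_sphere_odd_tendsto[of "1944 * CARD('k) + 6"] by blast
  show ?thesis unfolding Let_def
  proof (intro exI[of _ "max L 1"] allI impI)
    fix l :: int assume "max L 1 \<le> l \<and> odd l"
    then have l: "l \<ge> L" "l > 0" "odd l" by auto
    define lam where "lam = real_of_int l"
    have lam: "lam > 0" using l by (simp add: lam_def)
    define S where "S = (Sigma_set lam :: (torus3 ^ 'k) set)"
    define F where "F = (gram_det lam :: torus3 ^ 'k \<Rightarrow> real)"
    have S: "S = {x \<in> Conf. F x = 0}"
      by (simp add: S_def Sigma_set_def F_def gram_det_eq_0_iff[OF lam])
    obtain x0 :: "torus3 ^ 'k" where x0: "F x0 \<noteq> 0"
      using exists_full_rank[OF l(3,2) L[OF l(1,3)]] unfolding F_def lam_def by blast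
    have x0C: "x0 \<in> Conf" using full_rank_in_Conf[OF lam] x0 by (simp add: F_def)
    obtain u0 where u0: "tprojs u0 = x0" using tprojs_surj by blast
    have tp: "trig_poly UNIV (\<lambda>u. F (tprojs u))" unfolding F_def by (rule trig_poly_gram_det)
    define Z where "Z = {u. F (tprojs u) = 0}"
    have D: "DIM(real ^ 3 ^ 'k) = 3 * CARD('k)" by simp
    have Z: "cover_null s Z" if "s > 3 * real CARD('k) - 1" for s
      unfolding Z_def using that u0 x0 D by (intro cover_null_trig_poly_zeros[OF tp, of u0]) auto
    have negZ: "negligible (tprojs -` S)"
    proof (rule negligible_subset)
      \<comment> \<open>The full dimension \<open>3 * CARD('k)\<close> is an admissible exponent,
        being larger than \<open>3 * CARD('k) - 1\<close>.\<close>
      show "negligible Z" by (rule cover_null_negligible) (rule Z, simp)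
      show "tprojs -` S \<subseteq> Z" by (auto simp: Z_def S)
    qed
    have 1: "real_analytic_subset Conf S"
      unfolding real_analytic_subset_def
    proof (intro conjI ballI)
      fix p :: "torus3 ^ 'k" assume p: "p \<in> Conf"
      \<comment> \<open>The single function \<open>F\<close> defines the set on all of
        \<open>Conf\<close>, so this one neighbourhood serves for every \<open>p\<close>.\<close>
      have "torus_analytic_on Conf F" unfolding torus_analytic_on_def
      proof
        fix q :: "torus3 ^ 'k" obtain u where u: "tprojs u = q" using tprojs_surj by blast
        show "real_analytic_at (\<lambda>v. F (q + tprojs v)) 0"
          using trig_poly_real_analytic[OF trig_poly_shift[OF tp, of u]] by (simp add: u[symmetric] tprojs_add)
      qed
      then show "\<exists>U G. open U \<and> p \<in> U \<and> U \<subseteq> Conf \<and> finite G \<and> (\<forall>f\<in>G. torus_analytic_on U f) \<and> S \<inter> U = {x\<in>U. \<forall>f\<in>G. f x = 0}"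
        by (intro exI[of _ Conf] exI[of _ "{F}"]) (use p open_Conf in \<open>auto simp: S\<close>)
    qed (simp add: S)
    have 2: "S \<noteq> Conf" using x0 x0C by (auto simp: S)
    have 3: "hausdorff_dim S \<le> ereal (3 * real CARD('k) - 1)"
    proof (rule ereal_le_epsilon2)
      fix e :: real assume e: "e > 0"
      define s where "s = 3 * real CARD('k) - 1 + e"
      have c1: "real CARD('k) \<ge> 1" using zero_less_card_finite[where 'a = 'k] by linarith
      have s: "s > 0" "s > 3 * real CARD('k) - 1" using e c1 unfolding s_def by linarith+
      have "S \<subseteq> tprojs ` Z"
      proof
        fix y assume y: "y \<in> S"
        obtain u where "tprojs u = y" using tprojs_surj by blast
        then show "y \<in> tprojs ` Z" using y by (auto simp: S Z_def)
      qed
      then have "cover_null s S"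
        by (rule cover_null_subset[OF cover_null_image[OF Z[OF s(2)] dist_tprojs_le]])
      then have "hausdorff_measure s S = 0" by (rule cover_null_hausdorff_measure[OF s(1)])
      then have "hausdorff_dim S \<le> ereal s" unfolding hausdorff_dim_def using s(1) by (intro INF_lower) simp
      then show "hausdorff_dim S \<le> ereal (3 * real CARD('k) - 1) + ereal e" by (simp add: s_def)
    qed
    have 4: "torus_null S" using negZ by (simp add: torus_null_def)
    have 5: "top_of_set Conf interior_of S = {}"
    proof (rule ccontr)
      assume "top_of_set Conf interior_of S \<noteq> {}"
      then obtain y T where T: "openin (top_of_set Conf) T" "y \<in> T" "T \<subseteq> S" by (auto simp: interior_of_def)
      have "open T" by (rule openin_open_trans[OF T(1) open_Conf])
      then have "open (tprojs -` T)" by (rule open_vimage[OF _ continuous_on_tprojs])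
      moreover have "tprojs -` T \<noteq> {}" using T(2) tprojs_surj[of y] by blast
      ultimately have "\<not> negligible (tprojs -` T)" by (rule open_not_negligible)
      moreover have "negligible (tprojs -` T)" by (rule negligible_subset[OF negZ]) (use T(3) in blast)
      ultimately show False by blast
    qed
    have full: "gradmap x ` curl_eigenspace lam = tracefree" if "x \<in> Conf - S" for x
      using that full_rank_iff(1)[OF lam, of x] gram_det_eq_0_iff[OF lam, of x] by (simp add: S F_def)
    have 6: "jet_map x ` curl_eigenspace lam = jet_space" if "x \<in> Conf - S" for x
    proof -
      have "jet_map x ` curl_eigenspace lam = jet_of_grad lam ` gradmap x ` curl_eigenspace lam"
        unfolding image_image using lam by (intro image_cong refl) (simp add: jet_map_eq)
      then show ?thesis unfolding full[OF that] jet_space_eq[OF lam] .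
    qed
    have 7: "\<exists>W\<in>curl_eigenspace lam. \<forall>l. W (x $ l) = 0 \<and> grad W (x $ l) = H l"
      if x: "x \<in> Conf - S" and H: "\<forall>l. H l \<in> Sym0" for x and H :: "'k \<Rightarrow> real ^ 3 ^ 3"
    proof -
      have "(\<chi> l. H l) \<in> tracefree" using H by (simp add: tracefree_def Sym0_def)
      then obtain W where W: "W \<in> curl_eigenspace lam" "gradmap x W = (\<chi> l. H l)"
        unfolding full[OF x, symmetric] by force
      have g: "grad W (x $ l) = H l" for l
        using arg_cong[OF W(2), of "\<lambda>M. M $ l"] by (simp add: gradmap_def)
      \<comment> \<open>A symmetric gradient has zero curl, and \<open>lam\<close> times the field
        is its curl.\<close>
      have "W (x $ l) = 0" for l
      proof -
        have t: "transpose (H l) = H l" using H by (simp add: Sym0_def)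
        have "H l $ i $ j = H l $ j $ i" for i j
          using arg_cong[OF t, of "\<lambda>M. M $ j $ i"] by (simp add: transpose_def)
        then have "curl W (x $ l) = 0"
          by (simp add: curl_eq_curl_vec g vec_eq_iff forall_3 curl_vec_components)
        then show ?thesis using W(1) lam by (simp add: curl_eigenspace_def)
      qed
      then show ?thesis using W(1) g by blast
    qed
    show "real_analytic_subset Conf (Sigma_set (real_of_int l) :: (torus3 ^ 'k) set) \<and> (Sigma_set (real_of_int l) :: (torus3 ^ 'k) set) \<noteq> Conf \<and>
        hausdorff_dim (Sigma_set (real_of_int l) :: (torus3 ^ 'k) set) \<le> ereal (3 * real CARD('k) - 1) \<and>
        torus_null (Sigma_set (real_of_int l) :: (torus3 ^ 'k) set) \<and>
        top_of_set Conf interior_of (Sigma_set (real_of_int l) :: (torus3 ^ 'k) set) = {} \<and>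
        (\<forall>x \<in> Conf - (Sigma_set (real_of_int l) :: (torus3 ^ 'k) set). jet_map x ` curl_eigenspace (real_of_int l) = jet_space) \<and>
        (\<forall>x \<in> Conf - (Sigma_set (real_of_int l) :: (torus3 ^ 'k) set). \<forall>H :: 'k \<Rightarrow> real ^ 3 ^ 3. (\<forall>l. H l \<in> Sym0) \<longrightarrow>
           (\<exists>W \<in> curl_eigenspace (real_of_int l). \<forall>l. W (x $ l) = 0 \<and> grad W (x $ l) = H l))"
      using 1 2 3 4 5 6 7 unfolding S_def lam_def by blast
  qed
qed

end
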